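(* Let $K$ be a real nc convex set and let $F:K\to M_n(\mathcal M(\mathbb R))$ be a real bounded nc multivalued selfadjoint function, with complexification $F_c$ on $K_c$. Then $\mathrm{Re}\,\overline{F_c}(x)=\bar F(x)$ for all $x\in K$. Moreover, $(\bar F)_c=\overline{F_c}$; that is, taking convex envelopes commutes with complexification.
   Context: Let $\mathbb F=\mathbb R$ or $\mathbb C$. $M_{m,n}(\mathbb F)$ denotes the bounded operators $\ell^2_n\to\ell^2_m$ (cardinals possibly infinite, bounded by a fixed large enough infinite cardinal $\kappa$); for an operator space $E$, $M_n(E)$ is the space of $n\times n$ matrices over $E$ whose finitely supported submatrices are uniformly bounded, and $\mathcal M(E)=\bigsqcup_{m\le\kappa}M_m(E)$. A real (resp. complex) nc convex set over a real (resp. complex) dual operator space $E$ is $K=\bigsqcup_mK_m\subseteq\mathcal M(E)$ closed under direct sums ($\sum_i\alpha_ix_i\alpha_i^*\in K_m$ for bounded families $x_i\in K_{m_i}$ and isometries $\alpha_i\in M_{m,m_i}(\mathbb F)$ with $\sum_i\alpha_i\alpha_i^*=1_m$) and compressions ($\beta^*x\beta\in K_k$ for $x\in K_m$, $\beta\in M_{m,k}(\mathbb F)$ an isometry). For $x,y\in M_m(E)$, $c(x+iy)=\begin{bmatrix} x & -y \\ y & x \end{bmatrix}$, and the complexification of a real nc convex set $K$ is the complex nc convex set $K_c$ with $(K_c)_m=\{x+iy:c(x+iy)\in K_{2m}\}$; $K\subseteq K_c$ via $x\mapsto x+i0$. A bounded nc multivalued selfadjoint function $F:K\to M_n(\mathcal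 M(\mathbb F))$ assigns to each $x\in K_m$ a nonempty set $F(x)\subseteq M_n(M_m(\mathbb F))_{\rm sa}$ such that: $F(\beta x\beta^* )=(1_n\otimes\beta)F(x)(1_n\otimes\beta^* )$ for unitaries $\beta\in M_m(\mathbb F)$; $F$ respects direct sums (if $\gamma_i\in F(x_i)$, with $(x_i)$ and $(\gamma_i)$ bounded families, then $\oplus_i\gamma_i\in F(\oplus_ix_i)$); $F$ is upward directed, $F(x)=F(x)+M_n(M_m(\mathbb F))^+$; and $F$ is bounded: there is $\lambda>0$ such that for every $x$ and $\beta\in F(x)$ there is $\alpha\in F(x)$ with $\alpha\le\beta$, $\|\alpha\|\le\lambda$. Its graph is $\mathrm{Graph}_m(F)=\{(x,\alpha):x\in K_m,\alpha\in F(x)\}$, a subset of $\bigsqcup_mK_m\times M_n(M_m(\mathbb F))$, where compressions and direct sums act by $\alpha^*(x,\gamma)\alpha=(\alpha^*x\alpha,(1_n\otimes\alpha^* )\gamma(1_n\otimes\alpha))$. The convex envelope $\bar F$ of $F$ is the multivalued function with $\mathrm{Graph}(\bar F)=\overline{\mathrm{ncconv}}(\mathrm{Graph}(F))$, the smallest nc convex (over $\mathbb F$) subset of $\bigsqcup_mK_m\times M_n(M_m(\mathbb F))$ which is levelwise weak* closed there and contains $\mathrm{Graph}(F)$. The complexification of a real multivalued $F$ is $F_c(z)=(1_n\otimes u_m^* )F(c(z))(1_n\otimes u_m)$ for $z\in(K_c)_m$, where $u_m=\frac1{\sqrt2}\begin{bmatrix} 1_m \\ -i1_m \end{bmatrix}$.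 $\overline{F_c}$ is the (complex) convex envelope of $F_c$. $\mathrm{Re}$ of a set of complex matrices $a+ib$ ($a,b$ real matrices) is the set of the corresponding $a$. *)

theory Defs
  imports
    "HOL-Analysis.Analysis"
    "HOL-Library.Equipollence"
    "Jordan_Normal_Form.Conjugate"
begin

text \<open>
  All notions are defined once for a scalar field \<open>'f\<close> of sort
  \<open>{conjugatable_field, real_normed_field}\<close> and are used at \<open>'f = real\<close> and \<open>'f = complex\<close>;
  \<^const>\<open>conjugate\<close> is the identity on the reals and complex conjugation on the complex numbers.

  The infinite type \<open>'k\<close> plays the role of the cardinal bound kappa. A cardinal
  \<open>1 \<le> m \<le> kappa\<close> is represented by one chosen subset of \<open>'k\<close> of that cardinality, and
  l2 of \<open>m\<close> is l2 of that subset.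
\<close>

definition levels :: "'k set set" where
  "levels = {m. m \<noteq> {} \<and> m = (SOME B. B \<approx> m)}"


section \<open>Matrices of bounded operators\<close>

text \<open>Operators are given by their matrices, which vanish outside the relevant index sets.
  \<open>op_le I J A C\<close> says that \<open>A\<close>, restricted to \<open>I \<times> J\<close>, is the matrix of a bounded operator
  from l2 of \<open>J\<close> to l2 of \<open>I\<close> of norm at most \<open>C\<close>.\<close>

definition op_le ::
  "'i set \<Rightarrow> 'j set \<Rightarrow> ('i \<Rightarrow> 'j \<Rightarrow> 'f::{conjugatable_field,real_normed_field}) \<Rightarrow> real \<Rightarrow> bool" where
  "op_le I J A C \<longleftrightarrow> 0 \<le> C \<and>
     (\<forall>I' J' \<eta> \<xi>. finite I' \<longrightarrow> I' \<subseteq> I \<longrightarrow> finite J' \<longrightarrow> J' \<subseteq> J \<longrightarrow>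
        norm (\<Sum>i\<in>I'. \<Sum>j\<in>J'. conjugate (\<eta> i) * A i j * \<xi> j)
          \<le> C * sqrt (\<Sum>i\<in>I'. (norm (\<eta> i))\<^sup>2) * sqrt (\<Sum>j\<in>J'. (norm (\<xi> j))\<^sup>2))"

definition Mat ::
  "'i set \<Rightarrow> 'j set \<Rightarrow> ('i \<Rightarrow> 'j \<Rightarrow> 'f::{conjugatable_field,real_normed_field}) set" where
  "Mat I J = {A. (\<forall>i j. i \<notin> I \<or> j \<notin> J \<longrightarrow> A i j = 0) \<and> (\<exists>C. op_le I J A C)}"

definition mmul ::
  "('i \<Rightarrow> 'j \<Rightarrow> 'f::real_normed_field) \<Rightarrow> ('j \<Rightarrow> 'l \<Rightarrow> 'f) \<Rightarrow> 'i \<Rightarrow> 'l \<Rightarrow> 'f" where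
  "mmul A B = (\<lambda>i l. \<Sum>\<^sub>\<infinity>j. A i j * B j l)"

definition adj :: "('i \<Rightarrow> 'j \<Rightarrow> 'f::conjugatable_field) \<Rightarrow> 'j \<Rightarrow> 'i \<Rightarrow> 'f" where
  "adj A = (\<lambda>j i. conjugate (A i j))"

definition idm :: "'i set \<Rightarrow> 'i \<Rightarrow> 'i \<Rightarrow> 'f::field" where
  "idm I = (\<lambda>i j. if i = j \<and> i \<in> I then 1 else 0)"

definition isometry ::
  "'i set \<Rightarrow> 'j set \<Rightarrow> ('i \<Rightarrow> 'j \<Rightarrow> 'f::{conjugatable_field,real_normed_field}) \<Rightarrow> bool" where
  "isometry I J \<alpha> \<longleftrightarrow> \<alpha> \<in> Mat I J \<and> mmul (adj \<alpha>) \<alpha> = idm J"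

definition unitary ::
  "'i set \<Rightarrow> ('i \<Rightarrow> 'i \<Rightarrow> 'f::{conjugatable_field,real_normed_field}) \<Rightarrow> bool" where
  "unitary I \<beta> \<longleftrightarrow> isometry I I \<beta> \<and> mmul \<beta> (adj \<beta>) = idm I"

definition selfadjoint :: "('i \<Rightarrow> 'i \<Rightarrow> 'f::conjugatable_field) \<Rightarrow> bool" where
  "selfadjoint A \<longleftrightarrow> adj A = A"

text \<open>Over the reals, selfadjointness is not implied by nonnegativity of the quadratic form.
  By boundedness it suffices to test the form on finitely supported vectors.\<close>

definition pos_cone ::
  "'i set \<Rightarrow> ('i \<Rightarrow> 'i \<Rightarrow> 'f::{conjugatable_field,real_normed_field}) set" where
  "pos_cone I = {A \<in> Mat I I. selfadjoint A \<and>
     (\<forall>I' \<xi>. finite I' \<longrightarrow> I' \<subseteq> I \<longrightarrow>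
        (\<exists>r\<ge>0. (\<Sum>i\<in>I'. \<Sum>j\<in>I'. conjugate (\<xi> i) * A i j * \<xi> j) = of_real r))}"

text \<open>The matrix of \<open>1\<^sub>n \<otimes> \<alpha>\<close>; elements of \<open>M\<^sub>n(M\<^sub>m)\<close> are matrices over the index set \<open>n \<times> m\<close>.\<close>

definition amp :: "'k set \<Rightarrow> ('i \<Rightarrow> 'j \<Rightarrow> 'f::field) \<Rightarrow> 'k \<times> 'i \<Rightarrow> 'k \<times> 'j \<Rightarrow> 'f" where
  "amp n \<alpha> = (\<lambda>(p, i) (q, j). if p = q \<and> p \<in> n then \<alpha> i j else 0)"


section \<open>Operator spaces and their duals\<close>

text \<open>An operator space is given by its scalar multiplication and its matrix norms; only the
  entries with indices below \<open>n\<close> of the second argument of \<open>mnorm V n\<close> matter. The last two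
  axioms are Ruan's. Completeness is not required, since only the operator space dual is used.\<close>

record ('f, 'v) opspace =
  scale :: "'f \<Rightarrow> 'v \<Rightarrow> 'v"
  mnorm :: "nat \<Rightarrow> (nat \<Rightarrow> nat \<Rightarrow> 'v) \<Rightarrow> real"

definition operator_space ::
  "('f::{conjugatable_field,real_normed_field}, 'v::ab_group_add) opspace \<Rightarrow> bool" where
  "operator_space V \<longleftrightarrow>
     vector_space (scale V) \<and>
     (\<forall>n x y. (\<forall>i<n. \<forall>j<n. x i j = y i j) \<longrightarrow> mnorm V n x = mnorm V n y) \<and>
     (\<forall>n x. 0 \<le> mnorm V n x) \<and>
     (\<forall>n x. mnorm V n x = 0 \<longleftrightarrow> (\<forall>i<n. \<forall>j<n. x i j = 0)) \<and>
     (\<forall>n x y. mnorm V n (\<lambda>i j. x i j + y i j) \<le> mnorm V n x + mnorm V n y) \<and>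
     (\<forall>n c x. mnorm V n (\<lambda>i j. scale V c (x i j)) = norm c * mnorm V n x) \<and>
     (\<forall>n k x y. mnorm V (n + k)
          (\<lambda>i j. if i < n \<and> j < n then x i j
                 else if n \<le> i \<and> n \<le> j then y (i - n) (j - n) else 0)
        = max (mnorm V n x) (mnorm V k y)) \<and>
     (\<forall>n k \<alpha> \<beta> a b x. op_le {..<n} {..<k} \<alpha> a \<longrightarrow> op_le {..<k} {..<n} \<beta> b \<longrightarrow>
        mnorm V n (\<lambda>i j. \<Sum>p<k. \<Sum>q<k. scale V (\<alpha> i p * \<beta> q j) (x p q))
          \<le> a * mnorm V k x * b)"

text \<open>A dual operator space is the operator space dual \<open>E = V\<^sup>*\<close> of an operator space \<open>V\<close>.
  \<open>dual_le V A x C\<close> says that the \<open>A \<times> A\<close> submatrix of \<open>x\<close> has norm at most \<open>C\<close> in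
  \<open>M\<^sub>A(V\<^sup>*) = CB(V, M\<^sub>A)\<close>.\<close>

definition dual_le ::
  "('f::{conjugatable_field,real_normed_field}, 'v) opspace
    \<Rightarrow> 'k set \<Rightarrow> ('k \<Rightarrow> 'k \<Rightarrow> 'v \<Rightarrow> 'f) \<Rightarrow> real \<Rightarrow> bool" where
  "dual_le V A x C \<longleftrightarrow>
     (\<forall>q v. mnorm V q v \<le> 1 \<longrightarrow>
        op_le (A \<times> {..<q}) (A \<times> {..<q}) (\<lambda>(i, k) (j, l). x i j (v k l)) C)"

text \<open>The ball of radius \<open>C\<close> in \<open>M\<^sub>m(V\<^sup>*)\<close>, the space of all \<open>m \<times> m\<close> matrices over \<open>V\<^sup>*\<close> whose finite
  submatrices are uniformly bounded.\<close>

definition Mdual_ball ::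
  "('f::{conjugatable_field,real_normed_field}, 'v::ab_group_add) opspace
    \<Rightarrow> 'k set \<Rightarrow> real \<Rightarrow> ('k \<Rightarrow> 'k \<Rightarrow> 'v \<Rightarrow> 'f) set" where
  "Mdual_ball V m C = {x.
     (\<forall>i j. i \<notin> m \<or> j \<notin> m \<longrightarrow> x i j = (\<lambda>_. 0)) \<and>
     (\<forall>i j. Vector_Spaces.linear (scale V) (*) (x i j)) \<and>
     (\<forall>A. finite A \<longrightarrow> A \<subseteq> m \<longrightarrow> dual_le V A x C)}"


section \<open>nc convexity and weak* topologies\<close>

text \<open>
  The structure shared by the two ambient spaces needed below, \<open>\<M>(E)\<close> and
  the disjoint union of the \<open>M\<^sub>m(E) \<times> M\<^sub>n(M\<^sub>m)\<close>:
  \<open>norm_ball m C\<close> is the ball of radius \<open>C\<close> at level \<open>m\<close>, \<open>cnj_by \<alpha> x\<close> is \<open>\<alpha> x \<alpha>\<^sup>*\<close>, \<open>fsum I y\<close> is the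
  (weak*) sum of the family \<open>y\<close>, and \<open>entries m\<close> consists of the evaluations of
  single matrix entries at elements of the predual.
  A subset of a disjoint union over all levels is a function from levels to sets; its values
  outside of \<^const>\<open>levels\<close> are irrelevant.
\<close>

record ('k, 'f, 'x) ncspace =
  norm_ball :: "'k set \<Rightarrow> real \<Rightarrow> 'x set"
  cnj_by :: "('k \<Rightarrow> 'k \<Rightarrow> 'f) \<Rightarrow> 'x \<Rightarrow> 'x"
  fsum :: "'k set \<Rightarrow> ('k \<Rightarrow> 'x) \<Rightarrow> 'x"
  entries :: "'k set \<Rightarrow> ('x \<Rightarrow> 'f) set"

definition level :: "('k, 'f, 'x) ncspace \<Rightarrow> 'k set \<Rightarrow> 'x set" where
  "level X m = (\<Union>C. norm_ball X m C)"

definition closed_direct_sums ::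
  "('k, 'f::{conjugatable_field,real_normed_field}, 'x) ncspace \<Rightarrow> ('k set \<Rightarrow> 'x set) \<Rightarrow> bool" where
  "closed_direct_sums X K \<longleftrightarrow>
     (\<forall>m\<in>levels. \<forall>I \<mu> \<alpha> x.
        (\<forall>i\<in>I. \<mu> i \<in> levels \<and> isometry m (\<mu> i) (\<alpha> i) \<and> x i \<in> K (\<mu> i)) \<longrightarrow>
        (\<exists>C. \<forall>i\<in>I. x i \<in> norm_ball X (\<mu> i) C) \<longrightarrow>
        (\<forall>k l. ((\<lambda>i. mmul (\<alpha> i) (adj (\<alpha> i)) k l) has_sum idm m k l) I) \<longrightarrow>
        fsum X I (\<lambda>i. cnj_by X (\<alpha> i) (x i)) \<in> K m)"

definition closed_compressions ::
  "('k, 'f::{conjugatable_field,real_normed_field}, 'x) ncspace \<Rightarrow> ('k set \<Rightarrow> 'x set) \<Rightarrow> bool" where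
  "closed_compressions X K \<longleftrightarrow>
     (\<forall>m\<in>levels. \<forall>k\<in>levels. \<forall>x\<in>K m. \<forall>\<beta>. isometry m k \<beta> \<longrightarrow> cnj_by X (adj \<beta>) x \<in> K k)"

definition nc_convex ::
  "('k, 'f::{conjugatable_field,real_normed_field}, 'x) ncspace \<Rightarrow> ('k set \<Rightarrow> 'x set) \<Rightarrow> bool" where
  "nc_convex X K \<longleftrightarrow>
     (\<forall>m\<in>levels. K m \<subseteq> level X m) \<and> closed_direct_sums X K \<and> closed_compressions X K"

text \<open>The weak*-continuous functionals on \<open>M\<^sub>m(V\<^sup>*) = (V \<otimes>\<^sup>^ T\<^sub>m)\<^sup>*\<close> (operator space projective tensor
  product with the trace class) are the norm limits of finite linear combinations of the
  functionals \<open>x \<mapsto> x\<^sub>i\<^sub>j(v)\<close>, since the span of the elementary tensors of \<open>v\<close> with matrix units is dense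
  in the predual; for \<open>V\<close> the scalar field this gives the trace class functionals.\<close>

definition wstar_functionals ::
  "('k, 'f::{conjugatable_field,real_normed_field}, 'x) ncspace \<Rightarrow> 'k set \<Rightarrow> ('x \<Rightarrow> 'f) set" where
  "wstar_functionals X m = {\<phi>. \<forall>\<epsilon>>0. \<exists>T c. finite T \<and> T \<subseteq> entries X m \<and>
     (\<forall>C\<ge>0. \<forall>x\<in>norm_ball X m C. norm (\<phi> x - (\<Sum>f\<in>T. c f * f x)) \<le> \<epsilon> * C)}"

definition weakstar ::
  "('k, 'f::{conjugatable_field,real_normed_field}, 'x) ncspace \<Rightarrow> 'k set \<Rightarrow> 'x topology" where
  "weakstar X m = topology_generated_by
     {{x \<in> level X m. \<phi> x \<in> U} | \<phi> U. \<phi> \<in> wstar_functionals X m \<and> open U}"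

text \<open>The smallest nc convex subset of \<open>B\<close> which is levelwise weak* closed in \<open>B\<close> and contains \<open>G\<close>.\<close>

definition closed_ncconv ::
  "('k, 'f::{conjugatable_field,real_normed_field}, 'x) ncspace
    \<Rightarrow> ('k set \<Rightarrow> 'x set) \<Rightarrow> ('k set \<Rightarrow> 'x set) \<Rightarrow> 'k set \<Rightarrow> 'x set" where
  "closed_ncconv X B G m = \<Inter>{W m | W. nc_convex X W \<and>
     (\<forall>k\<in>levels. G k \<subseteq> W k \<and> W k \<subseteq> B k \<and> closedin (subtopology (weakstar X k) (B k)) (W k))}"


section \<open>The ambient spaces\<close>

definition Mspace ::
  "('f::{conjugatable_field,real_normed_field}, 'v::ab_group_add) opspace
    \<Rightarrow> ('k, 'f, 'k \<Rightarrow> 'k \<Rightarrow> 'v \<Rightarrow> 'f) ncspace" where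
  "Mspace V = \<lparr>
     norm_ball = Mdual_ball V,
     cnj_by = (\<lambda>\<alpha> x i j v. mmul \<alpha> (mmul (\<lambda>k l. x k l v) (adj \<alpha>)) i j),
     fsum = (\<lambda>I y k l v. \<Sum>\<^sub>\<infinity>i\<in>I. y i k l v),
     entries = (\<lambda>m. {\<lambda>x. x i j v | i j v. i \<in> m \<and> j \<in> m})\<rparr>"

definition graph_space ::
  "('f::{conjugatable_field,real_normed_field}, 'v::ab_group_add) opspace \<Rightarrow> 'k set
    \<Rightarrow> ('k, 'f, ('k \<Rightarrow> 'k \<Rightarrow> 'v \<Rightarrow> 'f) \<times> ('k \<times> 'k \<Rightarrow> 'k \<times> 'k \<Rightarrow> 'f)) ncspace" where
  "graph_space V n = \<lparr>
     norm_ball = (\<lambda>m C. norm_ball (Mspace V) m C \<times>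
               {\<gamma> \<in> Mat (n \<times> m) (n \<times> m). op_le (n \<times> m) (n \<times> m) \<gamma> C}),
     cnj_by = (\<lambda>\<alpha> (x, \<gamma>). (cnj_by (Mspace V) \<alpha> x, mmul (amp n \<alpha>) (mmul \<gamma> (adj (amp n \<alpha>))))),
     fsum = (\<lambda>I y. (fsum (Mspace V) I (\<lambda>i. fst (y i)), \<lambda>p q. \<Sum>\<^sub>\<infinity>i\<in>I. snd (y i) p q)),
     entries = (\<lambda>m. {\<lambda>(x, \<gamma>). f x | f. f \<in> entries (Mspace V) m} \<union>
                    {\<lambda>(x, \<gamma>). \<gamma> p q | p q. p \<in> n \<times> m \<and> q \<in> n \<times> m})\<rparr>"


section \<open>Multivalued nc functions\<close>

text \<open>A multivalued function takes the level as an additional argument, since the levels of \<open>K\<close> are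
  a disjoint union (for instance, the zero matrix occurs at every level).\<close>

type_synonym ('k, 'v, 'f) multifun =
  "'k set \<Rightarrow> ('k \<Rightarrow> 'k \<Rightarrow> 'v \<Rightarrow> 'f) \<Rightarrow> ('k \<times> 'k \<Rightarrow> 'k \<times> 'k \<Rightarrow> 'f) set"

definition Graph ::
  "('k set \<Rightarrow> ('k \<Rightarrow> 'k \<Rightarrow> 'v \<Rightarrow> 'f) set) \<Rightarrow> ('k, 'v, 'f) multifun
    \<Rightarrow> 'k set \<Rightarrow> (('k \<Rightarrow> 'k \<Rightarrow> 'v \<Rightarrow> 'f) \<times> ('k \<times> 'k \<Rightarrow> 'k \<times> 'k \<Rightarrow> 'f)) set" where
  "Graph K F m = {(x, \<gamma>). x \<in> K m \<and> \<gamma> \<in> F m x}"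

text \<open>Respecting direct sums says that direct sums of bounded families in the graph stay in the graph.
  The isometries in \<^const>\<open>closed_direct_sums\<close> are all the ways to identify the level \<open>m\<close> with a sum of
  the levels \<open>\<mu> i\<close>; by unitary equivariance one of them would suffice.\<close>

definition bounded_nc_multifun ::
  "('f::{conjugatable_field,real_normed_field}, 'v::ab_group_add) opspace
    \<Rightarrow> ('k set \<Rightarrow> ('k \<Rightarrow> 'k \<Rightarrow> 'v \<Rightarrow> 'f) set) \<Rightarrow> 'k set \<Rightarrow> ('k, 'v, 'f) multifun \<Rightarrow> bool" where
  "bounded_nc_multifun V K n F \<longleftrightarrow>
     (\<forall>m\<in>levels. \<forall>x\<in>K m. F m x \<noteq> {} \<and> F m x \<subseteq> {\<gamma> \<in> Mat (n \<times> m) (n \<times> m). selfadjoint \<gamma>}) \<and>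
     (\<forall>m\<in>levels. \<forall>x\<in>K m. \<forall>\<beta>. unitary m \<beta> \<longrightarrow>
        F m (cnj_by (Mspace V) \<beta> x) =
          (\<lambda>\<gamma>. mmul (amp n \<beta>) (mmul \<gamma> (amp n (adj \<beta>)))) ` F m x) \<and>
     closed_direct_sums (graph_space V n) (Graph K F) \<and>
     (\<forall>m\<in>levels. \<forall>x\<in>K m.
        F m x = {\<lambda>p q. \<gamma> p q + \<delta> p q | \<gamma> \<delta>. \<gamma> \<in> F m x \<and> \<delta> \<in> pos_cone (n \<times> m)}) \<and>
     (\<exists>c>0. \<forall>m\<in>levels. \<forall>x\<in>K m. \<forall>\<beta>\<in>F m x. \<exists>\<alpha>\<in>F m x.
        (\<lambda>p q. \<beta> p q - \<alpha> p q) \<in> pos_cone (n \<times> m) \<and> op_le (n \<times> m) (n \<times> m) \<alpha> c)"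

definition envelope ::
  "('f::{conjugatable_field,real_normed_field}, 'v::ab_group_add) opspace
    \<Rightarrow> ('k set \<Rightarrow> ('k \<Rightarrow> 'k \<Rightarrow> 'v \<Rightarrow> 'f) set) \<Rightarrow> 'k set
    \<Rightarrow> ('k, 'v, 'f) multifun \<Rightarrow> ('k, 'v, 'f) multifun" where
  "envelope V K n F m x =
     {\<gamma>. (x, \<gamma>) \<in> closed_ncconv (graph_space V n) (\<lambda>k. K k \<times> Mat (n \<times> k) (n \<times> k)) (Graph K F) m}"


section \<open>Complexification\<close>

text \<open>The complexification \<open>V\<^sub>c\<close> of a real operator space: the pair \<open>(v, w)\<close> is \<open>v + iw\<close>, and the norm
  of \<open>v + iw\<close> in \<open>M\<^sub>n(V\<^sub>c)\<close> is that of the \<open>2n \<times> 2n\<close> block matrix with rows \<open>(v, -w)\<close> and \<open>(w, v)\<close>.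
  The complexification of \<open>E = V\<^sup>*\<close> is \<open>E\<^sub>c = (V\<^sub>c)\<^sup>*\<close>, where \<open>f + ig\<close> with \<open>f, g \<in> E\<close> is the complex linear
  extension of the real linear map \<open>v \<mapsto> f v + i g v\<close>.\<close>

definition complexify :: "(real, 'v::ab_group_add) opspace \<Rightarrow> (complex, 'v \<times> 'v) opspace" where
  "complexify V = \<lparr>
     scale = (\<lambda>c (v, w). (scale V (Re c) v - scale V (Im c) w, scale V (Re c) w + scale V (Im c) v)),
     mnorm = (\<lambda>n x. mnorm V (2 * n) (\<lambda>i j.
        if i < n then (if j < n then fst (x i j) else - snd (x i (j - n)))
        else (if j < n then snd (x (i - n) j) else fst (x (i - n) (j - n)))))\<rparr>"

definition re_part :: "('k \<Rightarrow> 'k \<Rightarrow> 'v \<times> 'v::zero \<Rightarrow> complex) \<Rightarrow> 'k \<Rightarrow> 'k \<Rightarrow> 'v \<Rightarrow> real" where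
  "re_part z = (\<lambda>i j v. Re (z i j (v, 0)))"

definition im_part :: "('k \<Rightarrow> 'k \<Rightarrow> 'v \<times> 'v::zero \<Rightarrow> complex) \<Rightarrow> 'k \<Rightarrow> 'k \<Rightarrow> 'v \<Rightarrow> real" where
  "im_part z = (\<lambda>i j v. Im (z i j (v, 0)))"

definition re_embed :: "('k \<Rightarrow> 'k \<Rightarrow> 'v \<Rightarrow> real) \<Rightarrow> 'k \<Rightarrow> 'k \<Rightarrow> 'v \<times> 'v \<Rightarrow> complex" where
  "re_embed x = (\<lambda>i j (v, w). Complex (x i j v) (x i j w))"

text \<open>\<open>dbl m\<close> is the cardinal \<open>2m\<close>, and \<open>halves m\<close> is a fixed bijection from it to the disjoint union of
  two copies of \<open>m\<close>, which identifies l2 of \<open>2m\<close> with the direct sum of two copies of l2 of \<open>m\<close>.\<close>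

definition dbl :: "'k set \<Rightarrow> 'k set" where
  "dbl m = (SOME d. d \<in> levels \<and> d \<approx> m <+> m)"

definition halves :: "'k set \<Rightarrow> 'k \<Rightarrow> 'k + 'k" where
  "halves m = (SOME h. bij_betw h (dbl m) (m <+> m))"

definition cmat ::
  "'k set \<Rightarrow> ('k \<Rightarrow> 'k \<Rightarrow> 'v \<times> 'v::zero \<Rightarrow> complex) \<Rightarrow> 'k \<Rightarrow> 'k \<Rightarrow> 'v \<Rightarrow> real" where
  "cmat m z = (\<lambda>i j v.
     if i \<in> dbl m \<and> j \<in> dbl m then
       (case (halves m i, halves m j) of
          (Inl k, Inl l) \<Rightarrow> re_part z k l v
        | (Inl k, Inr l) \<Rightarrow> - im_part z k l v
        | (Inr k, Inl l) \<Rightarrow> im_part z k l v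
        | (Inr k, Inr l) \<Rightarrow> re_part z k l v)
     else 0)"

definition umat :: "'k set \<Rightarrow> 'k \<Rightarrow> 'k \<Rightarrow> complex" where
  "umat m = (\<lambda>i j.
     if i \<in> dbl m then
       (case halves m i of
          Inl k \<Rightarrow> idm m k j / complex_of_real (sqrt 2)
        | Inr k \<Rightarrow> - \<i> * idm m k j / complex_of_real (sqrt 2))
     else 0)"

definition complexify_set ::
  "(real, 'v::ab_group_add) opspace \<Rightarrow> ('k set \<Rightarrow> ('k \<Rightarrow> 'k \<Rightarrow> 'v \<Rightarrow> real) set)
    \<Rightarrow> 'k set \<Rightarrow> ('k \<Rightarrow> 'k \<Rightarrow> 'v \<times> 'v \<Rightarrow> complex) set" where
  "complexify_set V K m = {z \<in> level (Mspace (complexify V)) m. cmat m z \<in> K (dbl m)}"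

definition complexify_fun ::
  "'k set \<Rightarrow> ('k, 'v::zero, real) multifun \<Rightarrow> ('k, 'v \<times> 'v, complex) multifun" where
  "complexify_fun n F m z =
     (\<lambda>\<gamma>. mmul (amp n (adj (umat m))) (mmul (\<lambda>p q. complex_of_real (\<gamma> p q)) (amp n (umat m))))
       ` F (dbl m) (cmat m z)"

definition Re_mats :: "('i \<Rightarrow> 'j \<Rightarrow> complex) set \<Rightarrow> ('i \<Rightarrow> 'j \<Rightarrow> real) set" where
  "Re_mats S = (\<lambda>\<gamma> p q. Re (\<gamma> p q)) ` S"

end

theory Submission
  imports Defs
begin

text \<open>
  Identify a complex matrix with the real block matrix \<open>c(A)\<close> with rows \<open>(Re A, -Im A)\<close> and
  \<open>(Im A, Re A)\<close>. Call the sets whose intersection defines an envelope its competitors.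
  Since \<open>c\<close> is compatible with products, adjoints and sums, a competitor for the real envelope pulls back along \<open>c\<close> to a competitor for the complex one; in the other direction a complex
  competitor is restricted along \<open>x \<mapsto> x + i0\<close>. The pullback contains the graph of \<open>F\<^sub>c\<close> because, for
  \<open>\<gamma> \<in> F(c(z))\<close>, the pair \<open>(c(z), c(u\<^sup>*\<gamma>u))\<close> is the average of \<open>(c(z), \<gamma>)\<close> and its conjugate by the
  unitary \<open>c(i)\<close>, hence a compression of a direct sum. The restriction contains the graph of \<open>F\<close>
  because \<open>F\<close> respects the direct sum \<open>x \<oplus> x = c(x)\<close>. Both maps are weak* continuous: a real
  functional \<open>\<phi>\<close> composed with \<open>c\<close> is the real part of \<open>y \<mapsto> \<phi>(c(y)) - i\<phi>(c(iy))\<close>. Intersecting over all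
  competitors, \<open>\<delta>\<close> in the complex envelope at \<open>z\<close> gives \<open>c(\<delta>)\<close> in the real envelope at \<open>c(z)\<close>, and
  compressing by \<open>u\<close> leads back.
\<close>

text \<open>Compression by \<open>u\<close> inverts \<open>c\<close> because
  \<open>c(A) u = u A\<close>: on the range of \<open>u\<close> the block matrix acts as
  \<open>A\<close>, on the orthogonal complement as the entrywise conjugate of \<open>A\<close>.
  Averaging over conjugation by \<open>c(i)\<close> projects all real block matrices onto those of
  the form \<open>c(A)\<close>, and this \<open>A\<close> is the compression by \<open>u\<close>;
  hence \<open>F\<^sub>c\<close>, although defined by \<open>u\<close>, fits a pullback along
  \<open>c\<close>. The average costs a second doubling, since it is a compression of a direct sum
  at level \<open>4m\<close>. The obstacle is infinite sums. \<open>infsum\<close> is 0 on families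
  that are not summable, so \<open>c\<close> passes through products and direct sums only after
  summability is proved; it comes from Cauchy-Schwarz and the relation that the
  \<open>\<alpha>\<^sub>i \<alpha>\<^sub>i\<^sup>*\<close> sum to 1. Moreover \<open>c\<close> sees
  only indices within the level and real vectors of \<open>V\<^sub>c\<close>, so \<open>c(y)\<close>
  in a competitor does not yet place \<open>y\<close> in the complex ambient space: support and
  linearity are carried along separately. Norm bounds may grow by a constant uniform in the level,
  which respects both bounded families and the norm limits defining weak* functionals.\<close>

abbreviation fnorm :: "'i set \<Rightarrow> ('i \<Rightarrow> 'f::real_normed_vector) \<Rightarrow> real" where
  "fnorm I \<xi> \<equiv> sqrt (\<Sum>i\<in>I. (norm (\<xi> i))\<^sup>2)"

lemma norm_has_sum_le:
  fixes f :: "'a \<Rightarrow> 'b::real_normed_vector"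
  assumes "(f has_sum s) A" and "\<And>F. finite F \<Longrightarrow> F \<subseteq> A \<Longrightarrow> norm (sum f F) \<le> b"
  shows "norm s \<le> b"
proof -
  have "((\<lambda>F. norm (sum f F)) \<longlongrightarrow> norm s) (finite_subsets_at_top A)"
    using assms(1) unfolding has_sum_def by (rule tendsto_norm)
  then show ?thesis
    by (rule tendsto_upperbound)
      (auto intro!: eventually_finite_subsets_at_top_weakI assms(2))
qed

lemma has_sum_sum:
  fixes f :: "'i \<Rightarrow> 'a \<Rightarrow> 'b::topological_comm_monoid_add"
  assumes "\<And>i. i \<in> I \<Longrightarrow> (f i has_sum s i) A"
  shows "((\<lambda>x. \<Sum>i\<in>I. f i x) has_sum (\<Sum>i\<in>I. s i)) A"
  using assms by (induction I rule: infinite_finite_induct) (auto intro!: has_sum_add)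

section \<open>Square summable families\<close>

text \<open>Complex scalars only: real matrices are treated through their embedding
  \<open>emb\<close>, so the Hilbert space estimates are proved once.\<close>

definition l2 :: "('a \<Rightarrow> complex) \<Rightarrow> bool" where
  "l2 \<xi> \<longleftrightarrow> (\<lambda>x. (cmod (\<xi> x))\<^sup>2) summable_on UNIV"

definition l2norm :: "('a \<Rightarrow> complex) \<Rightarrow> real" where
  "l2norm \<xi> = sqrt (\<Sum>\<^sub>\<infinity>x. (cmod (\<xi> x))\<^sup>2)"

lemma l2norm_nonneg: "0 \<le> l2norm \<xi>"
  by (simp add: l2norm_def infsum_nonneg)

lemma l2norm_sq: "(l2norm \<xi>)\<^sup>2 = (\<Sum>\<^sub>\<infinity>x. (cmod (\<xi> x))\<^sup>2)"
  by (simp add: l2norm_def infsum_nonneg)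

lemma l2_finite_le: "l2 \<xi> \<Longrightarrow> finite F \<Longrightarrow> fnorm F \<xi> \<le> l2norm \<xi>"
  unfolding l2_def l2norm_def by (intro real_sqrt_le_mono finite_sum_le_infsum) auto

lemma l2I:
  assumes "\<And>F. finite F \<Longrightarrow> (\<Sum>x\<in>F. (cmod (\<xi> x))\<^sup>2) \<le> b"
  shows "l2 \<xi>"
  unfolding l2_def
  by (rule nonneg_bdd_above_summable_on) (auto intro!: bdd_aboveI2 assms)

lemma l2_cnj: "l2 (\<lambda>x. cnj (\<xi> x)) = l2 \<xi>"
  by (simp add: l2_def)

lemma l2_scale: "l2 \<xi> \<Longrightarrow> l2 (\<lambda>x. c * \<xi> x)"
  unfolding l2_def norm_mult power_mult_distrib by (rule summable_on_cmult_right)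

lemma l2_add:
  assumes "l2 \<xi>" "l2 \<eta>" shows "l2 (\<lambda>x. \<xi> x + \<eta> x)"
proof -
  have "(\<lambda>x. 2 * (cmod (\<xi> x))\<^sup>2 + 2 * (cmod (\<eta> x))\<^sup>2) summable_on UNIV"
    using assms unfolding l2_def by (intro summable_on_add summable_on_cmult_right)
  then show ?thesis unfolding l2_def
  proof (rule summable_on_comparison_test)
    fix x
    have "(cmod (\<xi> x + \<eta> x))\<^sup>2 \<le> (cmod (\<xi> x) + cmod (\<eta> x))\<^sup>2"
      by (intro power_mono norm_triangle_ineq) auto
    also have "\<dots> \<le> 2 * (cmod (\<xi> x))\<^sup>2 + 2 * (cmod (\<eta> x))\<^sup>2"
      using sum_squares_bound[of "cmod (\<xi> x)" "cmod (\<eta> x)"] by (simp add: power2_sum)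
    finally show "(cmod (\<xi> x + \<eta> x))\<^sup>2 \<le> 2 * (cmod (\<xi> x))\<^sup>2 + 2 * (cmod (\<eta> x))\<^sup>2" .
  qed auto
qed

lemma l2_sum: "(\<And>i. i \<in> I \<Longrightarrow> l2 (\<xi> i)) \<Longrightarrow> l2 (\<lambda>x. \<Sum>i\<in>I. \<xi> i x)"
  by (induction I rule: infinite_finite_induct) (auto intro!: l2_add simp: l2_def[of "\<lambda>_. 0"])

lemma l2_mult:
  assumes "l2 \<xi>" "l2 \<eta>" shows "(\<lambda>x. cmod (\<xi> x * \<eta> x)) summable_on UNIV"
proof -
  have "(\<lambda>x. (cmod (\<xi> x))\<^sup>2 + (cmod (\<eta> x))\<^sup>2) summable_on UNIV"
    using assms unfolding l2_def by (intro summable_on_add)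
  then show ?thesis
  proof (rule summable_on_comparison_test)
    fix x
    show "cmod (\<xi> x * \<eta> x) \<le> (cmod (\<xi> x))\<^sup>2 + (cmod (\<eta> x))\<^sup>2"
      using sum_squares_bound[of "cmod (\<xi> x)" "cmod (\<eta> x)"]
        mult_nonneg_nonneg[OF norm_ge_zero[of "\<xi> x"] norm_ge_zero[of "\<eta> x"]]
      unfolding norm_mult by linarith
  qed auto
qed

lemma l2_mult_summable: "l2 \<xi> \<Longrightarrow> l2 \<eta> \<Longrightarrow> (\<lambda>x. \<xi> x * \<eta> x) summable_on UNIV"
  by (rule Infinite_Sum.abs_summable_summable[OF l2_mult])

text \<open>Testing a form bound on the very vector to be estimated leaves the square root of its
  squared norm on the right; this cancels it.\<close>

lemma le_square_of_le_mult_sqrt: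
  fixes s c :: real
  assumes "s \<le> c * sqrt s" "0 \<le> s" "0 \<le> c"
  shows "s \<le> c\<^sup>2"
proof (cases "s = 0")
  case False
  then have "0 < sqrt s" using assms by simp
  moreover have "sqrt s * sqrt s \<le> c * sqrt s" using assms by simp
  ultimately have "sqrt s \<le> c" by (rule mult_right_le_imp_le[rotated])
  then have "(sqrt s)\<^sup>2 \<le> c\<^sup>2" using assms by (intro power_mono) auto
  then show ?thesis using assms by simp
qed simp

section \<open>Bounded matrices\<close>

lemma op_leD:
  assumes "op_le I J A C" "finite I'" "I' \<subseteq> I" "finite J'" "J' \<subseteq> J"
  shows "norm (\<Sum>i\<in>I'. \<Sum>j\<in>J'. conjugate (\<eta> i) * A i j * \<xi> j)
          \<le> C * fnorm I' \<eta> * fnorm J' \<xi>"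
  using assms unfolding op_le_def by blast

lemma op_le_nonneg: "op_le I J A C \<Longrightarrow> 0 \<le> C"
  by (simp add: op_le_def)

lemma op_le_mono: "op_le I J A C \<Longrightarrow> C \<le> D \<Longrightarrow> op_le I J A D"
  unfolding op_le_def
  by (meson order.trans mult_right_mono real_sqrt_ge_zero sum_nonneg zero_le_power2)

lemma op_le_subset: "op_le I J A C \<Longrightarrow> I' \<subseteq> I \<Longrightarrow> J' \<subseteq> J \<Longrightarrow> op_le I' J' A C"
  unfolding op_le_def by (meson subset_trans)

lemma op_le_cong:
  fixes A B :: "'i \<Rightarrow> 'j \<Rightarrow> 'f::{conjugatable_field,real_normed_field}"
  assumes "op_le I J A C" "\<And>i j. i \<in> I \<Longrightarrow> j \<in> J \<Longrightarrow> A i j = B i j"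
  shows "op_le I J B C"
  unfolding op_le_def
proof (intro conjI allI impI)
  show "0 \<le> C" using assms(1) by (rule op_le_nonneg)
  fix I' J' and \<eta> :: "'i \<Rightarrow> 'f" and \<xi> :: "'j \<Rightarrow> 'f"
  assume *: "finite I'" "I' \<subseteq> I" "finite J'" "J' \<subseteq> J"
  have "(\<Sum>i\<in>I'. \<Sum>j\<in>J'. conjugate (\<eta> i) * B i j * \<xi> j)
     = (\<Sum>i\<in>I'. \<Sum>j\<in>J'. conjugate (\<eta> i) * A i j * \<xi> j)"
    using * assms(2) by (intro sum.cong refl) (auto simp: subset_iff)
  then show "norm (\<Sum>i\<in>I'. \<Sum>j\<in>J'. conjugate (\<eta> i) * B i j * \<xi> j)
      \<le> C * fnorm I' \<eta> * fnorm J' \<xi>"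
    using op_leD[OF assms(1) *] by simp
qed

text \<open>Indices at which the matrix vanishes contribute nothing, so later estimates can range
  over whole index types and forget the level.\<close>

lemma op_le_UNIV:
  fixes A :: "'i \<Rightarrow> 'j \<Rightarrow> 'f::{conjugatable_field,real_normed_field}"
  assumes "op_le I J A C" "\<And>i j. i \<notin> I \<or> j \<notin> J \<Longrightarrow> A i j = 0"
  shows "op_le UNIV UNIV A C"
  unfolding op_le_def
proof (intro conjI allI impI)
  show C: "0 \<le> C" using assms(1) by (rule op_le_nonneg)
  fix I' :: "'i set" and J' :: "'j set" and \<eta> :: "'i \<Rightarrow> 'f" and \<xi> :: "'j \<Rightarrow> 'f"
  assume *: "finite I'" "finite J'"
  have "(\<Sum>i\<in>I'. \<Sum>j\<in>J'. conjugate (\<eta> i) * A i j * \<xi> j)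
     = (\<Sum>i\<in>I'\<inter>I. \<Sum>j\<in>J'. conjugate (\<eta> i) * A i j * \<xi> j)"
    using * assms(2) by (intro sum.mono_neutral_right) auto
  also have "\<dots> = (\<Sum>i\<in>I'\<inter>I. \<Sum>j\<in>J'\<inter>J. conjugate (\<eta> i) * A i j * \<xi> j)"
    using * assms(2) by (intro sum.cong refl sum.mono_neutral_right) auto
  also have "norm \<dots> \<le> C * sqrt (\<Sum>i\<in>I'\<inter>I. (norm (\<eta> i))\<^sup>2) * sqrt (\<Sum>j\<in>J'\<inter>J. (norm (\<xi> j))\<^sup>2)"
    using * by (intro op_leD[OF assms(1)]) auto
  also have "\<dots> \<le> C * fnorm I' \<eta> * fnorm J' \<xi>"
    using * C by (intro mult_mono mult_nonneg_nonneg real_sqrt_le_mono sum_mono2) (auto intro!: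
        sum_nonneg)
  finally show "norm (\<Sum>i\<in>I'. \<Sum>j\<in>J'. conjugate (\<eta> i) * A i j * \<xi> j)
      \<le> C * fnorm I' \<eta> * fnorm J' \<xi>" .
qed

lemma MatD: "A \<in> Mat I J \<Longrightarrow> i \<notin> I \<or> j \<notin> J \<Longrightarrow> A i j = 0"
  by (auto simp: Mat_def)

lemma Mat_op_le_UNIV: "A \<in> Mat I J \<Longrightarrow> \<exists>C. op_le UNIV UNIV A C"
  unfolding Mat_def using op_le_UNIV[of I J A] by blast

lemma op_le_adj:
  fixes A :: "'i \<Rightarrow> 'j \<Rightarrow> complex"
  assumes "op_le I J A C" shows "op_le J I (adj A) C"
  unfolding op_le_def
proof (intro conjI allI impI)
  show "0 \<le> C" using assms(1) by (rule op_le_nonneg)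
  fix I' J' and \<eta> :: "'j \<Rightarrow> complex" and \<xi> assume *: "finite J'" "J' \<subseteq> J" "finite I'" "I' \<subseteq> I"
  have "(\<Sum>j\<in>J'. \<Sum>i\<in>I'. conjugate (\<eta> j) * adj A j i * \<xi> i)
     = cnj (\<Sum>i\<in>I'. \<Sum>j\<in>J'. conjugate (\<xi> i) * A i j * \<eta> j)"
    by (subst sum.swap) (simp add: adj_def mult_ac)
  then have "norm (\<Sum>j\<in>J'. \<Sum>i\<in>I'. conjugate (\<eta> j) * adj A j i * \<xi> i)
     = norm (\<Sum>i\<in>I'. \<Sum>j\<in>J'. conjugate (\<xi> i) * A i j * \<eta> j)"
    by (simp only: complex_mod_cnj)
  also have "\<dots> \<le> C * fnorm I' \<xi> * fnorm J' \<eta>"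
    by (rule op_leD[OF assms(1) *(3,4,1,2)])
  finally show "norm (\<Sum>j\<in>J'. \<Sum>i\<in>I'. conjugate (\<eta> j) * adj A j i * \<xi> i)
      \<le> C * fnorm J' \<eta> * fnorm I' \<xi>"
    by (simp add: mult_ac)
qed

text \<open>Tested on the unit vector at \<open>k\<close> and on the conjugate of a finite piece of
  the row, the form equals the squared norm of that piece.\<close>

lemma op_le_row_l2:
  fixes X :: "'i \<Rightarrow> 'j \<Rightarrow> complex"
  assumes X: "op_le UNIV UNIV X C" shows "l2 (X k)"
proof (rule l2I)
  fix F :: "'j set" assume F: "finite F"
  let ?s = "\<Sum>l\<in>F. (cmod (X k l))\<^sup>2"
  have s0: "0 \<le> ?s" by (intro sum_nonneg) auto
  have "norm (\<Sum>i\<in>{k}. \<Sum>l\<in>F. conjugate ((\<lambda>_. 1) i) * X i l * cnj (X k l))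
      \<le> C * sqrt (\<Sum>i\<in>{k}. (norm ((\<lambda>_. 1::complex) i))\<^sup>2) * sqrt (\<Sum>l\<in>F. (norm (cnj (X k l)))\<^sup>2)"
    using F by (intro op_leD[OF X]) auto
  moreover have "(\<Sum>l\<in>F. X k l * cnj (X k l)) = complex_of_real ?s"
    by (simp add: complex_norm_square[symmetric])
  ultimately have "cmod (complex_of_real ?s) \<le> C * sqrt ?s"
    by (simp del: of_real_sum)
  then have "?s \<le> C * sqrt ?s"
    using s0 by (simp add: norm_of_real del: of_real_sum)
  then show "?s \<le> C\<^sup>2"
    using s0 op_le_nonneg[OF X] by (rule le_square_of_le_mult_sqrt)
qed

text \<open>The passage from finitely supported to square summable vectors is made one side at a
  time: here in \<open>\<xi>\<close>, in \<open>op_le_form\<close> in \<open>\<eta>\<close>.\<close>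

lemma op_le_form_finite:
  fixes X :: "'i \<Rightarrow> 'j \<Rightarrow> complex"
  assumes X: "op_le UNIV UNIV X C" and \<xi>: "l2 \<xi>" and K: "finite K"
  shows "cmod (\<Sum>k\<in>K. \<eta> k * (\<Sum>\<^sub>\<infinity>l. X k l * \<xi> l)) \<le> C * fnorm K \<eta> * l2norm \<xi>"
proof (rule norm_has_sum_le)
  show "((\<lambda>l. \<Sum>k\<in>K. \<eta> k * (X k l * \<xi> l)) has_sum (\<Sum>k\<in>K. \<eta> k * (\<Sum>\<^sub>\<infinity>l. X k l * \<xi> l))) UNIV"
    by (intro has_sum_sum has_sum_cmult_right has_sum_infsum l2_mult_summable op_le_row_l2[OF X] \<xi>)
  fix F :: "'j set" assume F: "finite F"
  have "(\<Sum>l\<in>F. \<Sum>k\<in>K. \<eta> k * (X k l * \<xi> l)) = (\<Sum>k\<in>K. \<Sum>l\<in>F. conjugate (cnj (\<eta> k)) * X k l * \<xi> l)"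
    by (subst sum.swap) (simp add: mult_ac)
  also have "cmod \<dots> \<le> C * sqrt (\<Sum>k\<in>K. (norm (cnj (\<eta> k)))\<^sup>2) * fnorm F \<xi>"
    using K F by (intro op_leD[OF X]) auto
  also have "\<dots> \<le> C * fnorm K \<eta> * l2norm \<xi>"
    using op_le_nonneg[OF X] l2_finite_le[OF \<xi> F]
    by (auto intro!: mult_left_mono mult_nonneg_nonneg sum_nonneg)
  finally show "cmod (\<Sum>l\<in>F. \<Sum>k\<in>K. \<eta> k * (X k l * \<xi> l)) \<le> C * fnorm K \<eta> * l2norm \<xi>" .
qed

text \<open>As for rows, now with the conjugate of the image vector as test vector.\<close>

lemma op_le_apply_l2:
  fixes X :: "'i \<Rightarrow> 'j \<Rightarrow> complex"
  assumes X: "op_le UNIV UNIV X C" and \<xi>: "l2 \<xi>"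
  shows "l2 (\<lambda>k. \<Sum>\<^sub>\<infinity>l. X k l * \<xi> l)"
proof (rule l2I)
  fix K :: "'i set" assume K: "finite K"
  define y where "y k = (\<Sum>\<^sub>\<infinity>l. X k l * \<xi> l)" for k
  let ?s = "\<Sum>k\<in>K. (cmod (y k))\<^sup>2"
  have s0: "0 \<le> ?s" by (intro sum_nonneg) auto
  have "cmod (\<Sum>k\<in>K. cnj (y k) * y k) \<le> C * sqrt (\<Sum>k\<in>K. (cmod (cnj (y k)))\<^sup>2) * l2norm \<xi>"
    unfolding y_def by (intro op_le_form_finite X \<xi> K)
  moreover have "(\<Sum>k\<in>K. cnj (y k) * y k) = complex_of_real ?s"
    by (simp add: complex_norm_square mult_ac del: of_real_power)
  ultimately have "cmod (complex_of_real ?s) \<le> (C * l2norm \<xi>) * sqrt ?s"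
    by (simp add: mult_ac del: of_real_sum)
  then have "?s \<le> (C * l2norm \<xi>) * sqrt ?s"
    using s0 by (simp add: norm_of_real del: of_real_sum)
  then have "?s \<le> (C * l2norm \<xi>)\<^sup>2"
    using s0 op_le_nonneg[OF X] l2norm_nonneg[of \<xi>] by (intro le_square_of_le_mult_sqrt) auto
  then show "(\<Sum>k\<in>K. (cmod (\<Sum>\<^sub>\<infinity>l. X k l * \<xi> l))\<^sup>2) \<le> (C * l2norm \<xi>)\<^sup>2" by (simp add: y_def)
qed

lemma op_le_form_summable:
  fixes X :: "'i \<Rightarrow> 'j \<Rightarrow> complex"
  assumes "op_le UNIV UNIV X C" and "l2 \<xi>" and "l2 \<eta>"
  shows "(\<lambda>k. \<eta> k * (\<Sum>\<^sub>\<infinity>l. X k l * \<xi> l)) summable_on UNIV"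
  by (intro l2_mult_summable assms op_le_apply_l2[OF assms(1)])

lemma op_le_form:
  fixes X :: "'i \<Rightarrow> 'j \<Rightarrow> complex"
  assumes X: "op_le UNIV UNIV X C" and \<xi>: "l2 \<xi>" and \<eta>: "l2 \<eta>"
  shows "cmod (\<Sum>\<^sub>\<infinity>k. \<eta> k * (\<Sum>\<^sub>\<infinity>l. X k l * \<xi> l)) \<le> C * l2norm \<eta> * l2norm \<xi>"
proof (rule norm_has_sum_le[OF has_sum_infsum])
  show "(\<lambda>k. \<eta> k * (\<Sum>\<^sub>\<infinity>l. X k l * \<xi> l)) summable_on UNIV"
    by (rule op_le_form_summable[OF assms])
  fix F :: "'i set" assume F: "finite F"
  have "cmod (\<Sum>k\<in>F. \<eta> k * (\<Sum>\<^sub>\<infinity>l. X k l * \<xi> l)) \<le> C * fnorm F \<eta> * l2norm \<xi>"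
    by (rule op_le_form_finite[OF X \<xi> F])
  also have "\<dots> \<le> C * l2norm \<eta> * l2norm \<xi>"
    using op_le_nonneg[OF X] l2_finite_le[OF \<eta> F] l2norm_nonneg[of \<xi>]
    by (intro mult_right_mono mult_left_mono) auto
  finally show "cmod (\<Sum>k\<in>F. \<eta> k * (\<Sum>\<^sub>\<infinity>l. X k l * \<xi> l)) \<le> C * l2norm \<eta> * l2norm \<xi>" .
qed

section \<open>The map \<open>X \<mapsto> A X A\<^sup>*\<close>\<close>

text \<open>The bracketing is that of \<open>cnj_by\<close> in both ambient spaces and of
  \<open>complexify_fun\<close>, so infinite matrix products never have to be reassociated.\<close>

definition conjm :: "('i \<Rightarrow> 'j \<Rightarrow> 'f::{conjugatable_field,real_normed_field}) \<Rightarrow> ('j \<Rightarrow> 'j \<Rightarrow> 'f) \<Rightarrow> 'i \<Rightarrow>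
    'i \<Rightarrow> 'f" where
  "conjm A X = mmul A (mmul X (adj A))"

lemma conjm_complex: "conjm A X i j = (\<Sum>\<^sub>\<infinity>k. A i k * (\<Sum>\<^sub>\<infinity>l. X k l * cnj (A j l)))"
  by (simp add: conjm_def mmul_def adj_def)

text \<open>The outer factors are moved onto the vectors, as in the form of \<open>X\<close> at the
  images under \<open>adj A\<close>. Only finite sums are taken inside infinite ones.\<close>

lemma conjm_form:
  fixes A :: "'i \<Rightarrow> 'j \<Rightarrow> complex"
  assumes X: "op_le UNIV UNIV X C" and A: "\<And>i. l2 (A i)"
  shows "(\<Sum>i\<in>I. \<Sum>j\<in>J. \<eta> i * conjm A X i j * \<xi> j)
       = (\<Sum>\<^sub>\<infinity>k. (\<Sum>i\<in>I. \<eta> i * A i k) * (\<Sum>\<^sub>\<infinity>l. X k l * (\<Sum>j\<in>J. \<xi> j * cnj (A j l))))"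
proof -
  have A': "l2 (\<lambda>l. cnj (A j l))" for j using A by (simp add: l2_cnj)
  have inner: "(\<Sum>\<^sub>\<infinity>l. X k l * (\<Sum>j\<in>J. \<xi> j * cnj (A j l))) = (\<Sum>j\<in>J. \<xi> j * (\<Sum>\<^sub>\<infinity>l. X k l * cnj (A j l)))"
      for k
  proof (rule infsumI)
    have "((\<lambda>l. \<Sum>j\<in>J. \<xi> j * (X k l * cnj (A j l))) has_sum (\<Sum>j\<in>J. \<xi> j * (\<Sum>\<^sub>\<infinity>l. X k l * cnj (A j l))))
        UNIV"
      by (intro has_sum_sum has_sum_cmult_right has_sum_infsum l2_mult_summable op_le_row_l2[OF X]
          A')
    then show "((\<lambda>l. X k l * (\<Sum>j\<in>J. \<xi> j * cnj (A j l))) has_sum (\<Sum>j\<in>J. \<xi> j * (\<Sum>\<^sub>\<infinity>l. X k l * cnj (A j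
        l)))) UNIV"
      by (simp add: sum_distrib_left mult_ac)
  qed
  have "((\<lambda>k. \<Sum>i\<in>I. \<Sum>j\<in>J. (\<eta> i * \<xi> j) * (A i k * (\<Sum>\<^sub>\<infinity>l. X k l * cnj (A j l))))
      has_sum (\<Sum>i\<in>I. \<Sum>j\<in>J. (\<eta> i * \<xi> j) * conjm A X i j)) UNIV"
    unfolding conjm_complex
    by (intro has_sum_sum has_sum_cmult_right has_sum_infsum op_le_form_summable[OF X] A A')
  moreover have "(\<Sum>i\<in>I. \<eta> i * A i k) * (\<Sum>\<^sub>\<infinity>l. X k l * (\<Sum>j\<in>J. \<xi> j * cnj (A j l)))
      = (\<Sum>i\<in>I. \<Sum>j\<in>J. (\<eta> i * \<xi> j) * (A i k * (\<Sum>\<^sub>\<infinity>l. X k l * cnj (A j l))))" for k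
    unfolding inner sum_product by (simp add: mult_ac)
  ultimately show ?thesis
    by (simp add: infsumI mult_ac)
qed

lemma l2norm_row_combination:
  fixes A :: "'i \<Rightarrow> 'j \<Rightarrow> complex"
  assumes A: "\<And>i. l2 (A i)"
  shows "(l2norm (\<lambda>k. \<Sum>i\<in>I. \<eta> i * A i k))\<^sup>2 = Re (\<Sum>i\<in>I. \<Sum>j\<in>I. \<eta> i * cnj (\<eta> j) * mmul A (adj A) i j)"
proof -
  have A': "l2 (\<lambda>l. cnj (A j l))" for j using A by (simp add: l2_cnj)
  have "((\<lambda>k. \<Sum>i\<in>I. \<Sum>j\<in>I. \<eta> i * cnj (\<eta> j) * (A i k * cnj (A j k)))
      has_sum (\<Sum>i\<in>I. \<Sum>j\<in>I. \<eta> i * cnj (\<eta> j) * mmul A (adj A) i j)) UNIV"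
    unfolding mmul_def adj_def conjugate_complex_def
    by (intro has_sum_sum has_sum_cmult_right has_sum_infsum l2_mult_summable A A')
  moreover have "(\<Sum>i\<in>I. \<Sum>j\<in>I. \<eta> i * cnj (\<eta> j) * (A i k * cnj (A j k)))
      = complex_of_real ((cmod (\<Sum>i\<in>I. \<eta> i * A i k))\<^sup>2)" for k
    unfolding complex_norm_square cnj_sum sum_product by (simp add: mult_ac)
  ultimately have "((\<lambda>k. complex_of_real ((cmod (\<Sum>i\<in>I. \<eta> i * A i k))\<^sup>2))
      has_sum (\<Sum>i\<in>I. \<Sum>j\<in>I. \<eta> i * cnj (\<eta> j) * mmul A (adj A) i j)) UNIV"
    by simp
  from has_sum_Re[OF this] show ?thesis
    unfolding l2norm_sq by (simp add: infsumI)
qed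

text \<open>The operators \<open>adj (A t)\<close> together form an isometry on l2 of
  \<open>M\<close>, so this is Bessel's inequality. Coordinates of \<open>\<eta>\<close> outside
  \<open>M\<close> are killed by \<open>idm M\<close>, a second source of inequality besides the
  truncation to \<open>F\<close>.\<close>

lemma sum_l2norm_row_combination_le:
  fixes A :: "'t \<Rightarrow> 'i \<Rightarrow> 'j \<Rightarrow> complex"
  assumes rows: "\<And>t i. t \<in> T \<Longrightarrow> l2 (A t i)"
    and id: "\<And>k l. ((\<lambda>t. mmul (A t) (adj (A t)) k l) has_sum idm M k l) T"
    and F: "finite F" "F \<subseteq> T" and I: "finite I"
  shows "(\<Sum>t\<in>F. (l2norm (\<lambda>k. \<Sum>i\<in>I. \<eta> i * A t i k))\<^sup>2) \<le> (\<Sum>i\<in>I. (cmod (\<eta> i))\<^sup>2)"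
proof -
  define N where "N t = (l2norm (\<lambda>k. \<Sum>i\<in>I. \<eta> i * A t i k))\<^sup>2" for t
  have "((\<lambda>t. \<Sum>i\<in>I. \<Sum>j\<in>I. \<eta> i * cnj (\<eta> j) * mmul (A t) (adj (A t)) i j)
      has_sum (\<Sum>i\<in>I. \<Sum>j\<in>I. \<eta> i * cnj (\<eta> j) * idm M i j)) T"
    by (intro has_sum_sum has_sum_cmult_right id)
  from has_sum_Re[OF this]
  have N: "(N has_sum Re (\<Sum>i\<in>I. \<Sum>j\<in>I. \<eta> i * cnj (\<eta> j) * idm M i j)) T"
    by (rule has_sum_cong[THEN iffD1, rotated])
      (simp only: N_def l2norm_row_combination[OF rows])
  have "(\<Sum>j\<in>I. \<eta> i * cnj (\<eta> j) * idm M i j) = (if i \<in> M then complex_of_real ((cmod (\<eta> i))\<^sup>2) else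
      0)"
    if "i \<in> I" for i
    using that I by (simp add: idm_def if_distrib complex_norm_square sum.delta' del: of_real_power
        cong: if_cong)
  then have "Re (\<Sum>i\<in>I. \<Sum>j\<in>I. \<eta> i * cnj (\<eta> j) * idm M i j) = (\<Sum>i\<in>I. if i \<in> M then (cmod (\<eta> i))\<^sup>2 else
      0)"
    by (simp add: if_distrib[of Re] cong: if_cong)
  also have "\<dots> \<le> (\<Sum>i\<in>I. (cmod (\<eta> i))\<^sup>2)"
    by (intro sum_mono) auto
  finally show ?thesis
    using finite_sum_le_has_sum[OF N F(1) F(2)] unfolding N_def by fastforce
qed

text \<open>Cauchy-Schwarz over \<open>t\<close>, then Bessel's inequality for both vectors; the
  bound \<open>C\<close> of the summands survives however many there are. The absolute values inside
  the sum give absolute convergence of single entries.\<close>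

lemma sum_conjm_form_le:
  fixes A :: "'t \<Rightarrow> 'i \<Rightarrow> 'j \<Rightarrow> complex"
  assumes X: "\<And>t. t \<in> T \<Longrightarrow> op_le UNIV UNIV (X t) C" and C: "0 \<le> C"
    and rows: "\<And>t i. t \<in> T \<Longrightarrow> l2 (A t i)"
    and id: "\<And>k l. ((\<lambda>t. mmul (A t) (adj (A t)) k l) has_sum idm M k l) T"
    and F: "finite F" "F \<subseteq> T" and I: "finite I" and J: "finite J"
  shows "(\<Sum>t\<in>F. cmod (\<Sum>i\<in>I. \<Sum>j\<in>J. \<eta> i * conjm (A t) (X t) i j * \<xi> j))
    \<le> C * fnorm I \<eta> * fnorm J \<xi>"
proof -
  define a where "a t = l2norm (\<lambda>k. \<Sum>i\<in>I. \<eta> i * A t i k)" for t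
  define b where "b t = l2norm (\<lambda>l. \<Sum>j\<in>J. cnj (\<xi> j) * A t j l)" for t
  have "cmod (\<Sum>i\<in>I. \<Sum>j\<in>J. \<eta> i * conjm (A t) (X t) i j * \<xi> j) \<le> C * (a t * b t)" if t: "t \<in> T" for t
  proof -
    have "b t = l2norm (\<lambda>l. cnj (\<Sum>j\<in>J. cnj (\<xi> j) * A t j l))"
      by (simp add: b_def l2norm_def del: cnj_sum)
    then have b: "b t = l2norm (\<lambda>l. \<Sum>j\<in>J. \<xi> j * cnj (A t j l))" by simp
    show ?thesis
      unfolding conjm_form[OF X[OF t] rows[OF t]] a_def b
      unfolding mult.assoc[symmetric]
      by (intro op_le_form[OF X[OF t]] l2_sum l2_scale rows[OF t]) (simp add: l2_cnj rows[OF t])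
  qed
  then have "(\<Sum>t\<in>F. cmod (\<Sum>i\<in>I. \<Sum>j\<in>J. \<eta> i * conjm (A t) (X t) i j * \<xi> j)) \<le> (\<Sum>t\<in>F. C * (a t * b t))"
    using F by (intro sum_mono) auto
  also have "\<dots> = C * (\<Sum>t\<in>F. \<bar>a t\<bar> * \<bar>b t\<bar>)"
    by (simp add: sum_distrib_left a_def b_def l2norm_nonneg)
  also have "\<dots> \<le> C * (L2_set a F * L2_set b F)"
    using C by (intro mult_left_mono L2_set_mult_ineq)
  also have "L2_set a F \<le> fnorm I \<eta>"
    unfolding L2_set_def a_def
    by (intro real_sqrt_le_mono sum_l2norm_row_combination_le[OF rows id F I])
  also have "L2_set b F \<le> sqrt (\<Sum>j\<in>J. (cmod (cnj (\<xi> j)))\<^sup>2)"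
    unfolding L2_set_def b_def
    by (intro real_sqrt_le_mono sum_l2norm_row_combination_le[OF rows id F J])
  finally show ?thesis
    using C by (simp add: mult_left_mono mult_right_mono mult_ac L2_set_nonneg sum_nonneg)
qed

text \<open>Unit vectors as test vectors bound the finite sums of absolute values of an entry by
  \<open>C\<close>. The manipulations of infinite direct sums rest on this.\<close>

lemma conjm_family_summable:
  fixes A :: "'t \<Rightarrow> 'i \<Rightarrow> 'j \<Rightarrow> complex"
  assumes X: "\<And>t. t \<in> T \<Longrightarrow> op_le UNIV UNIV (X t) C"
    and rows: "\<And>t i. t \<in> T \<Longrightarrow> l2 (A t i)"
    and id: "\<And>k l. ((\<lambda>t. mmul (A t) (adj (A t)) k l) has_sum idm M k l) T"
  shows "(\<lambda>t. conjm (A t) (X t) i j) summable_on T"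
proof (cases "T = {}")
  case False
  then have C: "0 \<le> C" using X op_le_nonneg by blast
  have "(\<lambda>t. cmod (conjm (A t) (X t) i j)) summable_on T"
  proof (rule nonneg_bdd_above_summable_on)
    show "bdd_above (sum (\<lambda>t. cmod (conjm (A t) (X t) i j)) ` {F. F \<subseteq> T \<and> finite F})"
    proof (rule bdd_aboveI2)
      fix F assume "F \<in> {F. F \<subseteq> T \<and> finite F}"
      then show "(\<Sum>t\<in>F. cmod (conjm (A t) (X t) i j)) \<le> C"
        using sum_conjm_form_le[OF X C rows id, where F = F and I = "{i}" and J = "{j}"
            and \<eta> = "\<lambda>_. 1" and \<xi> = "\<lambda>_. 1"]
        by auto
    qed
  qed auto
  then show ?thesis by (rule Infinite_Sum.abs_summable_summable)
qed simp

lemma conjm_family_op_le: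
  fixes A :: "'t \<Rightarrow> 'i \<Rightarrow> 'j \<Rightarrow> complex"
  assumes X: "\<And>t. t \<in> T \<Longrightarrow> op_le UNIV UNIV (X t) C" and C: "0 \<le> C"
    and rows: "\<And>t i. t \<in> T \<Longrightarrow> l2 (A t i)"
    and id: "\<And>k l. ((\<lambda>t. mmul (A t) (adj (A t)) k l) has_sum idm M k l) T"
  shows "op_le UNIV UNIV (\<lambda>i j. \<Sum>\<^sub>\<infinity>t\<in>T. conjm (A t) (X t) i j) C"
  unfolding op_le_def
proof (intro conjI allI impI C)
  fix I J :: "'i set" and \<eta> \<xi> :: "'i \<Rightarrow> complex" assume I: "finite I" and J: "finite J"
  show "cmod (\<Sum>i\<in>I. \<Sum>j\<in>J. conjugate (\<eta> i) * (\<Sum>\<^sub>\<infinity>t\<in>T. conjm (A t) (X t) i j) * \<xi> j)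
      \<le> C * fnorm I \<eta> * fnorm J \<xi>"
  proof (rule norm_has_sum_le)
    show "((\<lambda>t. \<Sum>i\<in>I. \<Sum>j\<in>J. conjugate (\<eta> i) * conjm (A t) (X t) i j * \<xi> j) has_sum
        (\<Sum>i\<in>I. \<Sum>j\<in>J. conjugate (\<eta> i) * (\<Sum>\<^sub>\<infinity>t\<in>T. conjm (A t) (X t) i j) * \<xi> j)) T"
      by (intro has_sum_sum has_sum_cmult_right has_sum_cmult_left has_sum_infsum
          conjm_family_summable[OF X rows id])
    fix F assume F: "finite F" "F \<subseteq> T"
    have "cmod (\<Sum>t\<in>F. \<Sum>i\<in>I. \<Sum>j\<in>J. conjugate (\<eta> i) * conjm (A t) (X t) i j * \<xi> j)
        \<le> (\<Sum>t\<in>F. cmod (\<Sum>i\<in>I. \<Sum>j\<in>J. conjugate (\<eta> i) * conjm (A t) (X t) i j * \<xi> j))"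
      by (rule norm_sum)
    also have "\<dots> \<le> C * sqrt (\<Sum>i\<in>I. (cmod (conjugate (\<eta> i)))\<^sup>2) * fnorm J \<xi>"
      by (rule sum_conjm_form_le[OF X C rows id F I J])
    finally show "cmod (\<Sum>t\<in>F. \<Sum>i\<in>I. \<Sum>j\<in>J. conjugate (\<eta> i) * conjm (A t) (X t) i j * \<xi> j)
        \<le> C * fnorm I \<eta> * fnorm J \<xi>" by simp
  qed
qed

lemma conjm_add:
  fixes A :: "'i \<Rightarrow> 'j \<Rightarrow> complex"
  assumes X: "op_le UNIV UNIV X C" and Y: "op_le UNIV UNIV Y D" and A: "\<And>i. l2 (A i)"
  shows "conjm A (\<lambda>k l. X k l + Y k l) i j = conjm A X i j + conjm A Y i j"
proof -
  have A': "l2 (\<lambda>l. cnj (A j l))" for j using A by (simp add: l2_cnj)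
  have "(\<Sum>\<^sub>\<infinity>l. (X k l + Y k l) * cnj (A j l)) = (\<Sum>\<^sub>\<infinity>l. X k l * cnj (A j l)) + (\<Sum>\<^sub>\<infinity>l. Y k l * cnj (A j
      l))" for k
    unfolding distrib_right
    by (intro infsum_add l2_mult_summable op_le_row_l2[OF X] op_le_row_l2[OF Y] A')
  then show ?thesis
    unfolding conjm_complex
    by (simp add: distrib_left infsum_add op_le_form_summable[OF X A' A] op_le_form_summable[OF Y A'
        A])
qed

lemma conjm_scale:
  fixes A :: "'i \<Rightarrow> 'j \<Rightarrow> complex"
  shows "conjm A (\<lambda>k l. c * X k l) i j = c * conjm A X i j"
  unfolding conjm_complex
  by (simp add: mult.assoc mult.left_commute[of _ c] infsum_cmult_right')

section \<open>Stability of operator bounds: sums, reindexing, blocks, real parts, embedding\<close>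

lemma op_le_scale:
  assumes "op_le I J A C" shows "op_le I J (\<lambda>i j. c * A i j) (norm c * C)"
  unfolding op_le_def
proof (intro conjI allI impI)
  show "0 \<le> norm c * C" using op_le_nonneg[OF assms] by simp
  fix I' J' \<eta> \<xi> assume *: "finite I'" "I' \<subseteq> I" "finite J'" "J' \<subseteq> J"
  have "(\<Sum>i\<in>I'. \<Sum>j\<in>J'. conjugate (\<eta> i) * (c * A i j) * \<xi> j)
      = c * (\<Sum>i\<in>I'. \<Sum>j\<in>J'. conjugate (\<eta> i) * A i j * \<xi> j)"
    by (simp add: sum_distrib_left mult_ac)
  also have "norm \<dots> \<le> norm c * (C * fnorm I' \<eta> * fnorm J' \<xi>)"
    unfolding norm_mult by (intro mult_left_mono op_leD[OF assms *]) auto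
  finally show "norm (\<Sum>i\<in>I'. \<Sum>j\<in>J'. conjugate (\<eta> i) * (c * A i j) * \<xi> j)
      \<le> norm c * C * fnorm I' \<eta> * fnorm J' \<xi>"
    by (simp add: mult.assoc)
qed

lemma op_le_add:
  assumes "op_le I J A C" "op_le I J B D" shows "op_le I J (\<lambda>i j. A i j + B i j) (C + D)"
  unfolding op_le_def
proof (intro conjI allI impI)
  show "0 \<le> C + D" using op_le_nonneg[OF assms(1)] op_le_nonneg[OF assms(2)] by simp
  fix I' J' \<eta> \<xi> assume *: "finite I'" "I' \<subseteq> I" "finite J'" "J' \<subseteq> J"
  have "(\<Sum>i\<in>I'. \<Sum>j\<in>J'. conjugate (\<eta> i) * (A i j + B i j) * \<xi> j)
      = (\<Sum>i\<in>I'. \<Sum>j\<in>J'. conjugate (\<eta> i) * A i j * \<xi> j) + (\<Sum>i\<in>I'. \<Sum>j\<in>J'. conjugate (\<eta> i) * B i j * \<xi>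
          j)"
    by (simp add: distrib_left distrib_right sum.distrib)
  also have "norm \<dots> \<le> C * fnorm I' \<eta> * fnorm J' \<xi>
      + D * fnorm I' \<eta> * fnorm J' \<xi>"
    by (intro norm_triangle_le add_mono op_leD[OF assms(1) *] op_leD[OF assms(2) *])
  finally show "norm (\<Sum>i\<in>I'. \<Sum>j\<in>J'. conjugate (\<eta> i) * (A i j + B i j) * \<xi> j)
      \<le> (C + D) * fnorm I' \<eta> * fnorm J' \<xi>"
    by (simp add: distrib_right)
qed

lemma op_le_reindex:
  fixes A :: "'i \<Rightarrow> 'j \<Rightarrow> 'f::{conjugatable_field,real_normed_field}"
  assumes A: "op_le I J A C" and f: "inj_on f P" "f ` P \<subseteq> I" and g: "inj_on g Q" "g ` Q \<subseteq> J"
  shows "op_le P Q (\<lambda>i j. A (f i) (g j)) C"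
  unfolding op_le_def
proof (intro conjI allI impI)
  show "0 \<le> C" using A by (rule op_le_nonneg)
  fix I' :: "'a set" and J' :: "'b set" and \<eta> :: "'a \<Rightarrow> 'f" and \<xi> :: "'b \<Rightarrow> 'f"
  assume *: "finite I'" "I' \<subseteq> P" "finite J'" "J' \<subseteq> Q"
  have f': "inj_on f I'" and g': "inj_on g J'" using f g * inj_on_subset by blast+
  have "norm (\<Sum>i\<in>f ` I'. \<Sum>j\<in>g ` J'. conjugate (\<eta> (inv_into I' f i)) * A i j * \<xi> (inv_into J' g j))
      \<le> C * sqrt (\<Sum>i\<in>f ` I'. (norm (\<eta> (inv_into I' f i)))\<^sup>2) * sqrt (\<Sum>j\<in>g ` J'. (norm (\<xi> (inv_into J'
          g j)))\<^sup>2)"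
    using * f(2) g(2) by (intro op_leD[OF A] finite_imageI) (blast+)
  then show "norm (\<Sum>i\<in>I'. \<Sum>j\<in>J'. conjugate (\<eta> i) * A (f i) (g j) * \<xi> j)
      \<le> C * fnorm I' \<eta> * fnorm J' \<xi>"
    by (simp add: sum.reindex f' g')
qed

lemma op_le_Un_left:
  fixes A :: "'i \<Rightarrow> 'j \<Rightarrow> 'f::{conjugatable_field,real_normed_field}"
  assumes A: "op_le I1 J A C" "op_le I2 J A D" shows "op_le (I1 \<union> I2) J A (C + D)"
  unfolding op_le_def
proof (intro conjI allI impI)
  show "0 \<le> C + D" using op_le_nonneg[OF A(1)] op_le_nonneg[OF A(2)] by simp
  fix I' J' and \<eta> :: "'i \<Rightarrow> 'f" and \<xi> :: "'j \<Rightarrow> 'f"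
  assume *: "finite I'" "I' \<subseteq> I1 \<union> I2" "finite J'" "J' \<subseteq> J"
  let ?S = "\<lambda>I. \<Sum>i\<in>I. \<Sum>j\<in>J'. conjugate (\<eta> i) * A i j * \<xi> j"
  let ?n = "\<lambda>I. fnorm I \<eta>" and ?x = "fnorm J' \<xi>"
  have n: "?n I \<le> ?n I'" if "I \<subseteq> I'" for I
    using that * by (intro real_sqrt_le_mono sum_mono2) auto
  have x: "0 \<le> ?x" by (simp add: sum_nonneg)
  have "?S I' = ?S (I' \<inter> I1) + ?S (I' - I1)"
    using *(1) by (subst sum.union_disjoint[symmetric]) (auto intro!: sum.cong)
  also have "norm \<dots> \<le> C * ?n (I' \<inter> I1) * ?x + D * ?n (I' - I1) * ?x"
    using * by (intro norm_triangle_le add_mono op_leD[OF A(1)] op_leD[OF A(2)]) auto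
  also have "\<dots> \<le> C * ?n I' * ?x + D * ?n I' * ?x"
    using n op_le_nonneg[OF A(1)] op_le_nonneg[OF A(2)] x
    by (intro add_mono mult_right_mono mult_left_mono) auto
  finally show "norm (?S I') \<le> (C + D) * ?n I' * ?x"
    by (simp add: distrib_right)
qed

lemma op_le_Un_right:
  fixes A :: "'i \<Rightarrow> 'j \<Rightarrow> complex"
  assumes A: "op_le I J1 A C" "op_le I J2 A D" shows "op_le I (J1 \<union> J2) A (C + D)"
proof -
  have "adj (adj A) = A" by (simp add: adj_def)
  moreover have "op_le I (J1 \<union> J2) (adj (adj A)) (C + D)"
    by (intro op_le_adj op_le_Un_left A)
  ultimately show ?thesis by simp
qed

text \<open>Unimodular factors on rows and columns are diagonal unitaries and can be absorbed into
  the test vectors.\<close>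

lemma op_le_phases:
  fixes A :: "'i \<Rightarrow> 'j \<Rightarrow> complex"
  assumes A: "op_le I J A C" and a: "\<And>i. cmod (a i) = 1" and b: "\<And>j. cmod (b j) = 1"
  shows "op_le I J (\<lambda>i j. a i * A i j * b j) C"
  unfolding op_le_def
proof (intro conjI allI impI)
  show "0 \<le> C" using A by (rule op_le_nonneg)
  fix I' :: "'i set" and J' :: "'j set" and \<eta> :: "'i \<Rightarrow> complex" and \<xi> :: "'j \<Rightarrow> complex"
  assume *: "finite I'" "I' \<subseteq> I" "finite J'" "J' \<subseteq> J"
  have "norm (\<Sum>i\<in>I'. \<Sum>j\<in>J'. conjugate (cnj (a i) * \<eta> i) * A i j * (b j * \<xi> j))
      \<le> C * sqrt (\<Sum>i\<in>I'. (norm (cnj (a i) * \<eta> i))\<^sup>2) * sqrt (\<Sum>j\<in>J'. (norm (b j * \<xi> j))\<^sup>2)"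
    by (rule op_leD[OF A *])
  then show "norm (\<Sum>i\<in>I'. \<Sum>j\<in>J'. conjugate (\<eta> i) * (a i * A i j * b j) * \<xi> j)
      \<le> C * fnorm I' \<eta> * fnorm J' \<xi>"
    by (simp add: norm_mult a b mult_ac)
qed

lemma op_le_Re:
  fixes A :: "'i \<Rightarrow> 'j \<Rightarrow> complex"
  assumes A: "op_le I J A C"
  shows "op_le I J (\<lambda>i j. Re (A i j)) C"
  unfolding op_le_def
proof (intro conjI allI impI)
  show "0 \<le> C" using A by (rule op_le_nonneg)
  fix I' J' and \<eta> :: "'i \<Rightarrow> real" and \<xi> :: "'j \<Rightarrow> real"
  assume *: "finite I'" "I' \<subseteq> I" "finite J'" "J' \<subseteq> J"
  let ?S = "\<Sum>i\<in>I'. \<Sum>j\<in>J'. conjugate (complex_of_real (\<eta> i)) * A i j * complex_of_real (\<xi> j)"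
  have "norm (\<Sum>i\<in>I'. \<Sum>j\<in>J'. conjugate (\<eta> i) * Re (A i j) * \<xi> j) = \<bar>Re ?S\<bar>"
    by simp
  also have "\<dots> \<le> cmod ?S" by (rule abs_Re_le_cmod)
  also have "\<dots> \<le> C * sqrt (\<Sum>i\<in>I'. (norm (complex_of_real (\<eta> i)))\<^sup>2) * sqrt (\<Sum>j\<in>J'. (norm
      (complex_of_real (\<xi> j)))\<^sup>2)"
    by (rule op_leD[OF A *])
  finally show "norm (\<Sum>i\<in>I'. \<Sum>j\<in>J'. conjugate (\<eta> i) * Re (A i j) * \<xi> j)
      \<le> C * fnorm I' \<eta> * fnorm J' \<xi>" by simp
qed

definition emb :: "('i \<Rightarrow> 'j \<Rightarrow> real) \<Rightarrow> 'i \<Rightarrow> 'j \<Rightarrow> complex" where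
  "emb A = (\<lambda>i j. complex_of_real (A i j))"

text \<open>The sharp bound is \<open>C\<close>; here and below only the existence of a uniform constant matters.\<close>

lemma op_le_emb:
  fixes A :: "'i \<Rightarrow> 'j \<Rightarrow> real"
  assumes A: "op_le I J A C"
  shows "op_le I J (emb A) (4 * C)"
  unfolding op_le_def
proof (intro conjI allI impI)
  show C: "0 \<le> 4 * C" using op_le_nonneg[OF A] by simp
  fix I' :: "'i set" and J' :: "'j set" and \<eta> :: "'i \<Rightarrow> complex" and \<xi> :: "'j \<Rightarrow> complex"
  assume *: "finite I'" "I' \<subseteq> I" "finite J'" "J' \<subseteq> J"
  let ?S = "\<Sum>i\<in>I'. \<Sum>j\<in>J'. conjugate (\<eta> i) * emb A i j * \<xi> j"
  let ?b = "\<lambda>u v. \<Sum>i\<in>I'. \<Sum>j\<in>J'. conjugate (u i) * A i j * v j"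
  let ?n = "C * fnorm I' \<eta> * fnorm J' \<xi>"
  have bd: "\<bar>?b u v\<bar> \<le> ?n" if "\<And>i. \<bar>u i\<bar> \<le> cmod (\<eta> i)" "\<And>j. \<bar>v j\<bar> \<le> cmod (\<xi> j)" for u v
  proof -
    have "\<bar>?b u v\<bar> \<le> C * sqrt (\<Sum>i\<in>I'. (norm (u i))\<^sup>2) * sqrt (\<Sum>j\<in>J'. (norm (v j))\<^sup>2)"
      using op_leD[OF A *, of u v] by simp
    also have "\<dots> \<le> ?n"
      using that op_le_nonneg[OF A]
      by (intro mult_mono mult_left_mono mult_nonneg_nonneg real_sqrt_le_mono sum_mono power_mono)
          (auto intro!: sum_nonneg)
    finally show ?thesis .
  qed
  note bds = abs_Re_le_cmod abs_Im_le_cmod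
  have "Re ?S = ?b (\<lambda>i. Re (\<eta> i)) (\<lambda>j. Re (\<xi> j)) + ?b (\<lambda>i. Im (\<eta> i)) (\<lambda>j. Im (\<xi> j))"
    by (simp add: emb_def sum.distrib[symmetric] algebra_simps)
  then have 1: "\<bar>Re ?S\<bar> \<le> 2 * ?n"
    using bd[of "\<lambda>i. Re (\<eta> i)" "\<lambda>j. Re (\<xi> j)"] bd[of "\<lambda>i. Im (\<eta> i)" "\<lambda>j. Im (\<xi> j)"] bds
    by (smt (verit))
  have "Im ?S = ?b (\<lambda>i. Re (\<eta> i)) (\<lambda>j. Im (\<xi> j)) - ?b (\<lambda>i. Im (\<eta> i)) (\<lambda>j. Re (\<xi> j))"
    by (simp add: emb_def sum_subtractf[symmetric] algebra_simps)
  then have 2: "\<bar>Im ?S\<bar> \<le> 2 * ?n"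
    using bd[of "\<lambda>i. Re (\<eta> i)" "\<lambda>j. Im (\<xi> j)"] bd[of "\<lambda>i. Im (\<eta> i)" "\<lambda>j. Re (\<xi> j)"] bds
    by (smt (verit))
  show "cmod ?S \<le> 4 * C * fnorm I' \<eta> * fnorm J' \<xi>"
    using 1 2 cmod_le[of ?S] by linarith
qed

section \<open>Real block matrices of complex matrices\<close>

definition phase :: "'a + 'a \<Rightarrow> complex" where "phase = case_sum (\<lambda>_. 1) (\<lambda>_. - \<i>)"

definition strip :: "'a + 'a \<Rightarrow> 'a" where "strip = case_sum id id"

text \<open>With the phases \<open>1\<close> and \<open>-i\<close> on the two halves, the block matrix with rows \<open>(Re A, -Im A)\<close> and
  \<open>(Im A, Re A)\<close> is \<open>2 Re (u A u\<^sup>*)\<close>. The maps \<open>h\<close> and \<open>e\<close> split the row and column indices into halves.\<close>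

definition blk :: "'i set \<Rightarrow> ('i \<Rightarrow> 'a + 'a) \<Rightarrow> 'j set \<Rightarrow> ('j \<Rightarrow> 'b + 'b) \<Rightarrow> ('a \<Rightarrow> 'b \<Rightarrow> complex) \<Rightarrow> 'i \<Rightarrow> 'j
    \<Rightarrow> real" where
  "blk D h E e A i j = (if i \<in> D \<and> j \<in> E then Re (phase (h i) * A (strip (h i)) (strip (e j)) * cnj
      (phase (e j))) else 0)"

lemma phase_simps [simp]: "phase (Inl k) = 1" "phase (Inr k) = - \<i>"
  and strip_simps [simp]: "strip (Inl k) = k" "strip (Inr k) = k"
  by (simp_all add: phase_def strip_def)

lemma cmod_phase [simp]: "cmod (phase s) = 1"
  by (cases s) auto

lemma blk_adj: "adj (blk D h E e A) = blk E e D h (adj A)"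
  by (auto simp: adj_def blk_def fun_eq_iff algebra_simps)

lemma blk_idm:
  assumes "bij_betw h D (M <+> M)" shows "blk D h D h (idm M) = idm D"
proof (intro ext)
  fix i j
  show "blk D h D h (idm M) i j = idm D i j"
  proof (cases "i \<in> D \<and> j \<in> D")
    case True
    then have "h i = h j \<longleftrightarrow> i = j" and "h i \<in> M <+> M" and "h j \<in> M <+> M"
      using assms by (auto simp: bij_betw_def inj_on_def)
    then show ?thesis using True by (auto simp: blk_def idm_def)
  qed (auto simp: blk_def idm_def)
qed

text \<open>The two halves of the middle index contribute the two terms of
  \<open>Re (c d) = Re c * Re d - Im c * Im d\<close>. As \<open>A\<close> vanishes on columns
  outside \<open>N\<close>, the sum over the whole type is one over \<open>N\<close>, which the
  bijection \<open>e\<close> matches with \<open>E\<close>.\<close>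

lemma blk_mmul:
  assumes e: "bij_betw e E (N <+> N)" and A0: "\<And>i j. j \<notin> N \<Longrightarrow> A i j = 0"
    and sm: "\<And>i l. (\<lambda>j. A i j * B j l) summable_on UNIV"
  shows "blk D h G g (mmul A B) = mmul (blk D h E e A) (blk E e G g B)"
proof (intro ext)
  fix i l
  show "blk D h G g (mmul A B) i l = mmul (blk D h E e A) (blk E e G g B) i l"
  proof (cases "i \<in> D \<and> l \<in> G")
    case True
    define c where "c j = phase (h i) * A (strip (h i)) j" for j
    define d where "d j = B j (strip (g l)) * cnj (phase (g l))" for j
    define S where "S = (\<Sum>\<^sub>\<infinity>j. A (strip (h i)) j * B j (strip (g l)))"
    have "((\<lambda>j. phase (h i) * (A (strip (h i)) j * B j (strip (g l))) * cnj (phase (g l)))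
        has_sum phase (h i) * S * cnj (phase (g l))) UNIV"
      unfolding S_def by (intro has_sum_cmult_left has_sum_cmult_right has_sum_infsum sm)
    then have "((\<lambda>j. c j * d j) has_sum phase (h i) * S * cnj (phase (g l))) UNIV"
      by (simp add: c_def d_def mult_ac)
    then have cd: "((\<lambda>j. c j * d j) has_sum phase (h i) * S * cnj (phase (g l))) N"
      by (rule has_sum_cong_neutral[THEN iffD1, rotated -1]) (auto simp: c_def A0)
    \<comment> \<open>A summable complex family is absolutely summable, so the products of real
      parts and those of imaginary parts are summable separately.\<close>
    have abs: "(\<lambda>j. cmod (c j * d j)) summable_on N"
      using cd summable_on_iff_abs_summable_on_complex[of "\<lambda>j. c j * d j" N] has_sum_imp_summable
      by fastforce
    have le: "\<bar>Re (c j) * Re (d j)\<bar> \<le> cmod (c j * d j)" "\<bar>Im (c j) * Im (d j)\<bar> \<le> cmod (c j * d j)"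
        for j
      unfolding norm_mult abs_mult by (intro mult_mono abs_Re_le_cmod abs_Im_le_cmod; simp)+
    have RR: "(\<lambda>j. Re (c j) * Re (d j)) summable_on N" and II: "(\<lambda>j. - (Im (c j) * Im (d j)))
        summable_on N"
      by (rule Infinite_Sum.abs_summable_summable, rule summable_on_comparison_test[OF abs]; use le
          in simp)+
    define f where "f s = Re (phase (h i) * A (strip (h i)) (strip s) * cnj (phase s)) * Re (phase s
        * B (strip s) (strip (g l)) * cnj (phase (g l)))" for s
    have fl: "f (Inl j) = Re (c j) * Re (d j)" for j by (simp add: f_def c_def d_def)
    have fr: "f (Inr j) = - (Im (c j) * Im (d j))" for j
    proof -
      \<comment> \<open>The factors are the phase of the middle index, conjugated on the side of
        \<open>A\<close>; they turn real parts into imaginary parts.\<close>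
      have "f (Inr j) = Re (c j * \<i>) * Re (- \<i> * d j)" by (simp add: f_def c_def d_def mult_ac)
      then show ?thesis by simp
    qed
    let ?l = "\<Sum>\<^sub>\<infinity>j\<in>N. Re (c j) * Re (d j)" and ?r = "\<Sum>\<^sub>\<infinity>j\<in>N. - (Im (c j) * Im (d j))"
    have "(f has_sum ?l) (Inl ` N)"
      by (subst has_sum_reindex) (use has_sum_infsum[OF RR] in \<open>auto simp: o_def fl\<close>)
    moreover have "(f has_sum ?r) (Inr ` N)"
      by (subst has_sum_reindex) (use has_sum_infsum[OF II] in \<open>auto simp: o_def fr\<close>)
    ultimately have "(f has_sum (?l + ?r)) (N <+> N)"
      unfolding Plus_def by (rule has_sum_Un_disjoint) auto
    then have "((\<lambda>j. f (e j)) has_sum (?l + ?r)) E"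
      using has_sum_reindex_bij_betw[OF e, of f "?l + ?r"] by simp
    then have "((\<lambda>j. blk D h E e A i j * blk E e G g B j l) has_sum (?l + ?r)) UNIV"
      by (rule has_sum_cong_neutral[THEN iffD1, rotated -1])
          (use True in \<open>auto simp: blk_def f_def\<close>)
    then have "mmul (blk D h E e A) (blk E e G g B) i l = ?l + ?r"
      unfolding mmul_def by (rule infsumI)
    also have "?l + ?r = (\<Sum>\<^sub>\<infinity>j\<in>N. Re (c j * d j))"
      by (subst infsum_add[symmetric, OF RR II]) simp
    also have "\<dots> = Re (phase (h i) * S * cnj (phase (g l)))"
      using has_sum_Re[OF cd] by (rule infsumI)
    also have "\<dots> = blk D h G g (mmul A B) i l"
      using True by (simp add: blk_def mmul_def S_def)
    finally show ?thesis ..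
  qed (auto simp: blk_def mmul_def)
qed

lemma blk_conjm:
  assumes e: "bij_betw e E (N <+> N)" and A: "\<And>i. l2 (A i)" and A0: "\<And>i j. j \<notin> N \<Longrightarrow> A i j = 0"
    and X: "op_le UNIV UNIV X C" and X0: "\<And>k l. l \<notin> N \<Longrightarrow> X k l = 0"
  shows "blk D h D h (conjm A X) = conjm (blk D h E e A) (blk E e E e X)"
proof -
  have A': "l2 (\<lambda>l. adj A l j)" for j using A by (simp add: l2_cnj adj_def)
  have "blk E e D h (mmul X (adj A)) = mmul (blk E e E e X) (blk E e D h (adj A))"
    by (rule blk_mmul[OF e]) (simp_all add: X0 l2_mult_summable op_le_row_l2[OF X] A')
  moreover have "blk D h D h (mmul A (mmul X (adj A))) = mmul (blk D h E e A) (blk E e D h (mmul X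
      (adj A)))"
  proof (rule blk_mmul[OF e A0])
    show "(\<lambda>j. A i j * mmul X (adj A) j l) summable_on UNIV" for i l
      unfolding mmul_def by (intro op_le_form_summable[OF X] A A')
  qed
  ultimately show ?thesis
    by (simp add: conjm_def blk_adj)
qed

lemma has_sum_blk:
  assumes "\<And>k l. ((\<lambda>t. f t k l) has_sum S k l) T"
  shows "((\<lambda>t. blk D h E e (f t) i j) has_sum blk D h E e S i j) T"
  unfolding blk_def
  by (cases "i \<in> D \<and> j \<in> E") (auto intro!: has_sum_Re has_sum_cmult_left has_sum_cmult_right assms
      simp del: times_complex.simps)

text \<open>Only the level index is split. \<open>pairl\<close> serves amplifications, where that
  index stands second; \<open>pairr\<close> serves the index sets \<open>m \<times> {..<q}\<close>
  of \<open>dual_le\<close>.\<close>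

definition pairl :: "('i \<Rightarrow> 'a + 'a) \<Rightarrow> 'p \<times> 'i \<Rightarrow> 'p \<times> 'a + 'p \<times> 'a" where
  "pairl h = (\<lambda>(p, i). map_sum (Pair p) (Pair p) (h i))"

definition pairr :: "('i \<Rightarrow> 'a + 'a) \<Rightarrow> 'i \<times> 'p \<Rightarrow> 'a \<times> 'p + 'a \<times> 'p" where
  "pairr h = (\<lambda>(i, p). map_sum (\<lambda>k. (k, p)) (\<lambda>k. (k, p)) (h i))"

lemma phase_strip_map_sum [simp]: "phase (map_sum f f s) = phase s" "strip (map_sum f f s)
    = f (strip s)"
  by (cases s; simp)+

lemma map_sum_eq_cases: "map_sum f f s = map_sum g g t \<longleftrightarrow> f (strip s) = g (strip t) \<and>
    phase s = phase t"
  by (cases s; cases t) (auto simp: complex_eq_iff)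

lemma sum_eqI: "strip s = strip t \<Longrightarrow> phase s = phase t \<Longrightarrow> s = t"
  by (cases s; cases t) (auto simp: complex_eq_iff)

lemma bij_betw_pairl:
  assumes h: "bij_betw h D (M <+> M)"
  shows "bij_betw (pairl h) (n \<times> D) ((n \<times> M) <+> (n \<times> M))"
proof (rule bij_betw_imageI)
  show "inj_on (pairl h) (n \<times> D)"
    using h by (auto simp: inj_on_def bij_betw_def pairl_def map_sum_eq_cases intro: sum_eqI)
  have 1: "\<And>i. i \<in> D \<Longrightarrow> h i \<in> M <+> M" using h by (auto simp: bij_betw_def)
  have 2: "\<exists>i\<in>D. h i = s" if "s \<in> M <+> M" for s using h that by (metis bij_betw_def imageE)
  show "pairl h ` (n \<times> D) = (n \<times> M) <+> (n \<times> M)"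
  proof (intro equalityI subsetI)
    fix s assume "s \<in> pairl h ` (n \<times> D)"
    then show "s \<in> (n \<times> M) <+> (n \<times> M)" using 1 by (force simp: pairl_def)
  next
    fix s assume "s \<in> (n \<times> M) <+> (n \<times> M)"
    then consider (l) p k where "p \<in> n" "k \<in> M" "s = Inl (p, k)" | (r) p k where "p \<in> n" "k \<in> M"
        "s = Inr (p, k)" by auto
    then show "s \<in> pairl h ` (n \<times> D)"
    proof cases
      case l
      with 2[of "Inl k"] obtain i where "i \<in> D" "h i = Inl k" by auto
      with l show ?thesis by (intro image_eqI[of _ _ "(p, i)"]) (auto simp: pairl_def)
    next
      case r
      with 2[of "Inr k"] obtain i where "i \<in> D" "h i = Inr k" by auto
      with r show ?thesis by (intro image_eqI[of _ _ "(p, i)"]) (auto simp: pairl_def)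
    qed
  qed
qed

lemma bij_betw_pairr:
  fixes n :: "'p set"
  assumes h: "bij_betw h D (M <+> M)"
  shows "bij_betw (pairr h) (D \<times> n) ((M \<times> n) <+> (M \<times> n))"
proof -
  have "(pairr h :: _ \<times> 'p \<Rightarrow> _) = map_sum prod.swap prod.swap \<circ> pairl h \<circ> prod.swap"
    by (auto simp: pairr_def pairl_def fun_eq_iff sum.map_comp o_def)
  moreover have 1: "bij_betw (map_sum prod.swap prod.swap) ((n \<times> M) <+> (n \<times> M)) ((M \<times> n) <+> (M \<times>
      n))"
    by (rule bij_betw_byWitness[where f' = "map_sum prod.swap prod.swap"]) auto
  have 2: "bij_betw prod.swap (D \<times> n) (n \<times> D)"
    by (rule bij_betw_byWitness[where f' = prod.swap]) auto
  ultimately show ?thesis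
    using bij_betw_trans[OF bij_betw_trans[OF 2 bij_betw_pairl[OF h]] 1] by (simp add: o_assoc)
qed

text \<open>An exact equality, since \<open>pairl\<close> leaves the coordinate in \<open>n\<close>
  alone; no permutation unitary intervenes.\<close>

lemma amp_blk: "amp n (blk D h E e A) = blk (n \<times> D) (pairl h) (n \<times> E) (pairl e) (amp n A)"
  by (auto simp: amp_def blk_def pairl_def fun_eq_iff)

text \<open>The halves of rows and columns cut the matrix into four quadrants. On each, before the
  real part is taken, it is a reindexed \<open>A\<close> with unimodular factors; the constant
  counts the quadrants.\<close>

lemma op_le_blk:
  assumes A: "op_le M N A C" and h: "bij_betw h D (M <+> M)" and e: "bij_betw e E (N <+> N)"
  shows "op_le D E (blk D h E e A) (4 * C)"
proof -
  let ?B = "\<lambda>i j. phase (h i) * A (strip (h i)) (strip (e j)) * cnj (phase (e j))"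
  define D1 D2 where "D1 = {i\<in>D. isl (h i)}" and "D2 = {i\<in>D. \<not> isl (h i)}"
  define E1 E2 where "E1 = {i\<in>E. isl (e i)}" and "E2 = {i\<in>E. \<not> isl (e i)}"
  have hM: "h i \<in> M <+> M" if "i \<in> D" for i using h that by (auto simp: bij_betw_def)
  have eN: "e i \<in> N <+> N" if "i \<in> E" for i using e that by (auto simp: bij_betw_def)
  have hi: "inj_on h D" and ei: "inj_on e E" using h e by (auto simp: bij_betw_def)
  have inj: "inj_on (\<lambda>i. strip (g i)) {i\<in>P. isl (g i)}" "inj_on (\<lambda>i. strip (g i)) {i\<in>P. \<not> isl (g
      i)}"
    if g: "inj_on g P" for g :: "'z \<Rightarrow> 'y + 'y" and P
  proof -
    have *: "g i = g j" if "strip (g i) = strip (g j)" "isl (g i) = isl (g j)" for i j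
      using that by (cases "g i"; cases "g j") auto
    show "inj_on (\<lambda>i. strip (g i)) {i\<in>P. isl (g i)}" "inj_on (\<lambda>i. strip (g i)) {i\<in>P. \<not> isl (g i)}"
      by (rule inj_onI, rule inj_onD[OF g], rule *, simp_all)+
  qed
  have "inj_on (\<lambda>i. strip (h i)) D1" "inj_on (\<lambda>i. strip (h i)) D2"
    unfolding D1_def D2_def by (rule inj[OF hi])+
  note f0 = this
  have "inj_on (\<lambda>i. strip (e i)) E1" "inj_on (\<lambda>i. strip (e i)) E2"
    unfolding E1_def E2_def by (rule inj[OF ei])+
  note f1 = this
  have "(\<lambda>i. strip (h i)) ` D1 \<subseteq> M" "(\<lambda>i. strip (h i)) ` D2 \<subseteq> M"
    using hM by (force simp: D1_def D2_def)+
  note f2 = this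
  have "(\<lambda>i. strip (e i)) ` E1 \<subseteq> N" "(\<lambda>i. strip (e i)) ` E2 \<subseteq> N"
    using eN by (force simp: E1_def E2_def)+
  note f3 = this
  have "op_le P Q ?B C"
    if "inj_on (\<lambda>i. strip (h i)) P" "(\<lambda>i. strip (h i)) ` P \<subseteq> M" "inj_on (\<lambda>i. strip (e i)) Q"
        "(\<lambda>i. strip (e i)) ` Q \<subseteq> N" for P Q
    by (rule op_le_phases[OF op_le_reindex[OF A that]]) simp_all
  from this[OF f0(1) f2(1) f1(1) f3(1)] this[OF f0(1) f2(1) f1(2) f3(2)]
    this[OF f0(2) f2(2) f1(1) f3(1)] this[OF f0(2) f2(2) f1(2) f3(2)]
  have "op_le D1 E1 ?B C" "op_le D1 E2 ?B C" "op_le D2 E1 ?B C" "op_le D2 E2 ?B C" .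
  then have "op_le (D1 \<union> D2) (E1 \<union> E2) ?B ((C + C) + (C + C))"
    by (intro op_le_Un_left op_le_Un_right)
  moreover have "D1 \<union> D2 = D" "E1 \<union> E2 = E" by (auto simp: D1_def D2_def E1_def E2_def)
  ultimately have "op_le D E ?B (4 * C)" by simp
  then have "op_le D E (\<lambda>i j. Re (?B i j)) (4 * C)" by (rule op_le_Re)
  then show ?thesis by (rule op_le_cong) (auto simp: blk_def)
qed

text \<open>The first block column carries the real part of \<open>A\<close> above and the imaginary
  part below. Embedding each as a complex matrix costs a factor 4, whence 8.\<close>

lemma op_le_of_blk:
  assumes B: "op_le D D (blk D h D h A) C" and h: "bij_betw h D (M <+> M)"
  shows "op_le M M A (8 * C)"
proof -
  define lo hi where "lo k = inv_into D h (Inl k)" and "hi k = inv_into D h (Inr k)" for k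
  have surj: "s \<in> M <+> M \<Longrightarrow> inv_into D h s \<in> D \<and> h (inv_into D h s) = s" for s
    using h by (metis bij_betw_def f_inv_into_f inv_into_into)
  have lo: "lo k \<in> D" "h (lo k) = Inl k" and hi: "hi k \<in> D" "h (hi k) = Inr k" if "k \<in> M" for k
    using surj[of "Inl k"] surj[of "Inr k"] that by (auto simp: lo_def hi_def)
  have inj: "inj_on lo M" "inj_on hi M"
    by (rule inj_onI, metis lo(2) sum.inject(1)) (rule inj_onI, metis hi(2) sum.inject(2))
  have "op_le M M (\<lambda>k l. blk D h D h A (lo k) (lo l)) C" "op_le M M (\<lambda>k l. blk D h D h A (hi k) (lo
      l)) C"
    using lo hi by (intro op_le_reindex[OF B inj(1) _ inj(1)] op_le_reindex[OF B inj(2) _ inj(1)];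
        blast)+
  then have "op_le M M (\<lambda>k l. emb (\<lambda>k l. blk D h D h A (lo k) (lo l)) k l
      + \<i> * emb (\<lambda>k l. blk D h D h A (hi k) (lo l)) k l) (4 * C + cmod \<i> * (4 * C))"
    by (intro op_le_add op_le_scale op_le_emb)
  then have "op_le M M A (4 * C + cmod \<i> * (4 * C))"
    by (rule op_le_cong) (auto simp: emb_def blk_def lo hi complex_eq_iff)
  then show ?thesis by simp
qed

section \<open>Real matrices as complex matrices\<close>

lemma emb_adj: "emb (adj A) = adj (emb A)"
  by (simp add: emb_def adj_def)

text \<open>If \<open>f\<close> is not summable, both sides are 0 by convention; so
  \<open>emb\<close> commutes with \<open>mmul\<close> unconditionally.\<close>

lemma infsum_complex_of_real: "(\<Sum>\<^sub>\<infinity>x\<in>A. complex_of_real (f x)) = complex_of_real (\<Sum>\<^sub>\<infinity>x\<in>A. f x)"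
proof (cases "f summable_on A")
  case True
  then show ?thesis by (intro infsumI) (simp add: has_sum_of_real_iff)
next
  case False
  then have "\<not> (\<lambda>x. complex_of_real (f x)) summable_on A"
    using summable_on_Re[of "\<lambda>x. complex_of_real (f x)" A] by auto
  with False show ?thesis by (simp add: infsum_not_exists)
qed

lemma emb_mmul: "emb (mmul A B) = mmul (emb A) (emb B)"
  by (simp add: emb_def mmul_def infsum_complex_of_real[symmetric])

lemma emb_conjm: "emb (conjm A X) = conjm (emb A) (emb X)"
  by (simp add: conjm_def emb_mmul emb_adj)

lemma emb_idm: "emb (idm I) = idm I"
  by (auto simp: emb_def idm_def fun_eq_iff)

lemma emb_inject: "emb A = emb B \<longleftrightarrow> A = B"
  by (simp add: emb_def fun_eq_iff)

lemma emb_amp: "emb (amp n A) = amp n (emb A)"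
  by (auto simp: emb_def amp_def fun_eq_iff)

lemma emb_Mat: "emb A \<in> Mat I J \<longleftrightarrow> A \<in> Mat I J"
proof
  assume "emb A \<in> Mat I J"
  then obtain C where "op_le I J (emb A) C" "\<forall>i j. i \<notin> I \<or> j \<notin> J \<longrightarrow> emb A i j = 0"
      by (auto simp: Mat_def)
  with op_le_Re[OF this(1)] show "A \<in> Mat I J" by (auto simp: Mat_def emb_def)
next
  assume "A \<in> Mat I J"
  then obtain C where "op_le I J A C" "\<forall>i j. i \<notin> I \<or> j \<notin> J \<longrightarrow> A i j = 0" by (auto simp: Mat_def)
  with op_le_emb[OF this(1)] show "emb A \<in> Mat I J" by (auto simp: Mat_def emb_def)
qed

lemma emb_isometry: "isometry I J (emb A) \<longleftrightarrow> isometry I J A"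
proof -
  have "mmul (adj (emb A)) (emb A) = idm J \<longleftrightarrow> mmul (adj A) A = idm J"
    unfolding emb_adj[symmetric] emb_mmul[symmetric] by (metis emb_idm emb_inject)
  then show ?thesis by (simp add: isometry_def emb_Mat)
qed

section \<open>Isometries with square summable columns\<close>

text \<open>The relation for \<open>mmul (adj \<beta>) \<beta>\<close> itself yields the bound 1
  that membership in \<open>Mat\<close> demands, once square summable columns make its infinite sums
  meaningful.\<close>

lemma isometryI:
  fixes \<beta> :: "'i \<Rightarrow> 'j \<Rightarrow> complex"
  assumes 0: "\<And>i j. i \<notin> I \<or> j \<notin> J \<Longrightarrow> \<beta> i j = 0" and cols: "\<And>j. l2 (\<lambda>i. \<beta> i j)"
    and id: "mmul (adj \<beta>) \<beta> = idm J"
  shows "isometry I J \<beta>"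
proof -
  have rows: "l2 (adj \<beta> j)" for j using cols[of j] by (simp add: adj_def l2_cnj)
  have "op_le I J \<beta> 1"
    unfolding op_le_def
  proof (intro conjI allI impI)
    fix I' :: "'i set" and J' :: "'j set" and \<eta> :: "'i \<Rightarrow> complex" and \<xi> :: "'j \<Rightarrow> complex"
    assume *: "finite I'" "I' \<subseteq> I" "finite J'" "J' \<subseteq> J"
    define y where "y i = (\<Sum>j\<in>J'. cnj (\<xi> j) * adj \<beta> j i)" for i
    have "adj (adj \<beta>) = \<beta>" by (simp add: adj_def)
    \<comment> \<open>Bessel's inequality for the family with the single member
      \<open>adj \<beta>\<close>.\<close>
    then have "(l2norm y)\<^sup>2 \<le> (\<Sum>j\<in>J'. (cmod (cnj (\<xi> j)))\<^sup>2)"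
      using sum_l2norm_row_combination_le[of "{()}" "\<lambda>_. adj \<beta>" J "{()}" J'
          "\<lambda>j. cnj (\<xi> j)"] rows *(3)
      unfolding y_def by (simp add: id has_sum_finite_iff)
    then have n: "l2norm y \<le> fnorm J' \<xi>"
      by (simp add: real_le_rsqrt)
    have l2: "l2 y" unfolding y_def by (intro l2_sum l2_scale rows)
    have "(\<Sum>i\<in>I'. \<Sum>j\<in>J'. conjugate (\<eta> i) * \<beta> i j * \<xi> j) = (\<Sum>i\<in>I'. cnj (\<eta> i) * cnj (y i))"
      by (simp add: y_def adj_def sum_distrib_left mult_ac)
    also have "cmod \<dots> \<le> (\<Sum>i\<in>I'. \<bar>cmod (\<eta> i)\<bar> * \<bar>cmod (y i)\<bar>)"
      by (rule sum_norm_le) (simp add: norm_mult)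
    also have "\<dots> \<le> L2_set (\<lambda>i. cmod (\<eta> i)) I' * L2_set (\<lambda>i. cmod (y i)) I'"
      by (rule L2_set_mult_ineq)
    also have "\<dots> \<le> fnorm I' \<eta> * fnorm J' \<xi>"
      unfolding L2_set_def using order_trans[OF l2_finite_le[OF l2 *(1)] n]
      by (intro mult_left_mono) (auto simp: sum_nonneg)
    finally show "cmod (\<Sum>i\<in>I'. \<Sum>j\<in>J'. conjugate (\<eta> i) * \<beta> i j * \<xi> j)
        \<le> 1 * fnorm I' \<eta> * fnorm J' \<xi>" by simp
  qed simp
  then show ?thesis using 0 id by (auto simp: isometry_def Mat_def)
qed

lemma l2_finite_support: "finite S \<Longrightarrow> (\<And>x. x \<notin> S \<Longrightarrow> \<xi> x = 0) \<Longrightarrow> l2 \<xi>"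
  unfolding l2_def by (rule finite_nonzero_values_imp_summable_on) (auto elim!:
      finite_subset[rotated])

lemma infsum_finite_support:
  assumes "finite S" "\<And>x. x \<notin> S \<Longrightarrow> f x = 0"
  shows "(\<Sum>\<^sub>\<infinity>x. f x) = sum f S"
  using assms by (subst infsum_cong_neutral[of S UNIV f f]) auto

lemma mmul_adj_finite_cols:
  assumes "\<And>j. finite (S j)" "\<And>a j. a \<notin> S j \<Longrightarrow> \<beta> a j = 0"
  shows "mmul (adj \<beta>) \<gamma> i j = (\<Sum>a\<in>S i. conjugate (\<beta> a i) * \<gamma> a j)"
  unfolding mmul_def adj_def by (rule infsum_finite_support) (use assms in auto)

lemma conjm_adj_finite_cols:
  assumes "\<And>j. finite (S j)" "\<And>a j. a \<notin> S j \<Longrightarrow> \<beta> a j = 0"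
  shows "conjm (adj \<beta>) X i j = (\<Sum>a\<in>S i. \<Sum>b\<in>S j. conjugate (\<beta> a i) * X a b * \<beta> b j)"
proof -
  have "mmul X (adj (adj \<beta>)) a j = (\<Sum>b\<in>S j. X a b * \<beta> b j)" for a
    unfolding mmul_def adj_def conjugate_id by (rule infsum_finite_support) (use assms in auto)
  then show ?thesis
    by (simp add: conjm_def mmul_adj_finite_cols[of S \<beta>, OF assms] sum_distrib_left mult.assoc)
qed

section \<open>Isometries attached to a splitting of an index set into two halves\<close>

definition half :: "bool \<Rightarrow> 'i set \<Rightarrow> ('i \<Rightarrow> 'a + 'a) \<Rightarrow> 'i \<Rightarrow> 'a \<Rightarrow> real" where
  "half b D h i k = (if i \<in> D \<and> isl (h i) = b \<and> strip (h i) = k then 1 else 0)"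

text \<open>The matrix \<open>umat\<close> over an arbitrary splitting: in this generality its
  amplification has the same form.\<close>

definition um :: "'i set \<Rightarrow> ('i \<Rightarrow> 'a + 'a) \<Rightarrow> 'i \<Rightarrow> 'a \<Rightarrow> complex" where
  "um D h i k = (if i \<in> D \<and> strip (h i) = k then phase (h i) / complex_of_real (sqrt 2) else 0)"

text \<open>\<open>twist\<close> is the isometry \<open>(1, J)\<^sup>T / sqrt 2\<close>, where \<open>J\<close> has rows \<open>(0, -1)\<close> and \<open>(1, 0)\<close>: compressing
  \<open>X \<oplus> X\<close> by it yields the average of \<open>X\<close> and \<open>J\<^sup>* X J\<close>.\<close>

definition half_sign :: "'a + 'a \<Rightarrow> real" where "half_sign s = (if isl s then 1 else - 1)"

definition twist :: "'q set \<Rightarrow> ('q \<Rightarrow> 'i + 'i) \<Rightarrow> 'i set \<Rightarrow> ('i \<Rightarrow> 'a + 'a) \<Rightarrow> 'q \<Rightarrow> 'i \<Rightarrow> real" where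
  "twist DD H D h a j = (if a \<in> DD \<and> j \<in> D
     then (if isl (H a) then if strip (H a) = j then 1 / sqrt 2 else 0
           else if strip (h (strip (H a))) = strip (h j) \<and>
               isl (h (strip (H a))) \<noteq> isl (h j) then half_sign (h j) / sqrt 2 else 0)
     else 0)"

lemma isl_map_sum [simp]: "isl (map_sum f g s) = isl s" by (cases s) auto

lemma amp_half: "amp n (half b D h) = half b (n \<times> D) (pairl h)"
  by (auto simp: amp_def half_def pairl_def fun_eq_iff)

lemma amp_um: "amp n (um D h) = um (n \<times> D) (pairl h)"
  by (auto simp: amp_def um_def pairl_def fun_eq_iff)

lemma amp_twist: "amp n (twist DD H D h) = twist (n \<times> DD) (pairl H) (n \<times> D) (pairl h)"
  by (auto simp: amp_def twist_def pairl_def half_sign_def fun_eq_iff)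

lemma amp_adj: "amp n (adj A) = adj (amp n A)"
  by (auto simp: amp_def adj_def fun_eq_iff)

text \<open>Interpreted at a level with \<open>halves m\<close> and at its amplification with
  \<open>pairl (halves m)\<close>, so that each compression identity serves both components of a
  graph point.\<close>

locale splitting =
  fixes D :: "'i set" and M :: "'a set" and h :: "'i \<Rightarrow> 'a + 'a"
  assumes bij: "bij_betw h D (M <+> M)"
begin

definition sel :: "'a + 'a \<Rightarrow> 'i" where "sel = inv_into D h"

lemma sel: "s \<in> M <+> M \<Longrightarrow> sel s \<in> D" "s \<in> M <+> M \<Longrightarrow> h (sel s) = s"
  unfolding sel_def using bij by (metis bij_betw_def inv_into_into, metis bij_betw_inv_into_right)

lemma sel_h: "i \<in> D \<Longrightarrow> sel (h i) = i"
  unfolding sel_def using bij by (metis bij_betw_inv_into_left)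

lemma sel_simps [simp]:
  "k \<in> M \<Longrightarrow> sel (Inl k) \<in> D" "k \<in> M \<Longrightarrow> h (sel (Inl k)) = Inl k"
  "k \<in> M \<Longrightarrow> sel (Inr k) \<in> D" "k \<in> M \<Longrightarrow> h (sel (Inr k)) = Inr k"
  using sel by auto

lemma split_cases:
  assumes "i \<in> D"
  obtains (Inl) k where "k \<in> M" "i = sel (Inl k)" "h i = Inl k"
        | (Inr) k where "k \<in> M" "i = sel (Inr k)" "h i = Inr k"
proof (cases "h i")
  case (Inl k)
  then have "k \<in> M" using assms bij bij_betwE by fastforce
  then show thesis using that(1)[of k] sel_h[OF assms] Inl by simp
next
  case (Inr k)
  then have "k \<in> M" using assms bij bij_betwE by fastforce
  then show thesis using that(2)[of k] sel_h[OF assms] Inr by simp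
qed

lemma strip_h_in: "i \<in> D \<Longrightarrow> strip (h i) \<in> M"
  by (erule split_cases) auto

lemma sel_strip [simp]:
  "i \<in> D \<Longrightarrow> isl (h i) \<Longrightarrow> sel (Inl (strip (h i))) = i"
  "i \<in> D \<Longrightarrow> \<not> isl (h i) \<Longrightarrow> sel (Inr (strip (h i))) = i"
  by (erule split_cases; simp)+

lemma eq_iff_h: "i \<in> D \<Longrightarrow> j \<in> D \<Longrightarrow> i = j \<longleftrightarrow> isl (h i) = isl (h j) \<and> strip (h i) = strip (h j)"
  using sel_strip by metis

lemma sel_neq [simp]: "k \<in> M \<Longrightarrow> l \<in> M \<Longrightarrow> sel (Inl k) \<noteq> sel (Inr l)" "k \<in> M \<Longrightarrow> l \<in> M \<Longrightarrow>
    sel (Inr k) \<noteq> sel (Inl l)"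
  by (metis sel_simps(2,4) sum.distinct(1))+

lemma sel_eq [simp]: "k \<in> M \<Longrightarrow> l \<in> M \<Longrightarrow> sel (Inl k) = sel (Inl l) \<longleftrightarrow> k = l"
   "k \<in> M \<Longrightarrow> l \<in> M \<Longrightarrow> sel (Inr k) = sel (Inr l) \<longleftrightarrow> k = l"
  by (metis sel_simps(2,4) sum.inject)+

lemma half_isometry: "isometry D M (half b D h)"
proof -
  let ?S = "\<lambda>k. if k \<in> M then {sel (if b then Inl k else Inr k)} else {}"
  have z: "emb (half b D h) i j = 0" if "i \<notin> ?S j" for i j
    using that by (auto simp: emb_def half_def strip_h_in split: if_splits)
  have "isometry D M (emb (half b D h))"
  proof (rule isometryI)
    show "l2 (\<lambda>i. emb (half b D h) i j)" for j
      by (rule l2_finite_support[of "?S j"]) (use z in auto)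
    show "mmul (adj (emb (half b D h))) (emb (half b D h)) = idm M"
      by (intro ext, subst mmul_adj_finite_cols[of ?S])
        (use z in \<open>auto simp: emb_def half_def idm_def\<close>)
  qed (auto simp: emb_def half_def strip_h_in)
  then show ?thesis by (simp add: emb_isometry)
qed

lemma half_row_support: "k \<notin> {strip (h i)} \<Longrightarrow> adj (half b D h) k i = 0"
  by (auto simp: half_def adj_def)

lemma half_mmul_adj:
  "mmul (half b D h) (adj (half b D h)) i j = (if i \<in> D \<and> isl (h i) = b \<and> i = j then 1 else 0)"
proof -
  have "mmul (half b D h) (adj (half b D h)) i j = mmul (adj (adj (half b D h))) (adj (half b D h))
      i j"
    by (simp add: adj_def)
  also have "\<dots> = (\<Sum>a\<in>{strip (h i)}. conjugate (adj (half b D h) a i) * adj (half b D h) a j)"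
    by (rule mmul_adj_finite_cols[of "\<lambda>i. {strip (h i)}", OF _ half_row_support]) simp
  also have "\<dots> = (if i \<in> D \<and> isl (h i) = b \<and> i = j then 1 else 0)"
    by (auto simp: adj_def half_def eq_iff_h)
  finally show ?thesis .
qed

text \<open>The ranges of the two inclusions are complementary, as a direct sum of two copies
  requires.\<close>

lemma half_sum_mmul_adj:
  "mmul (half True D h) (adj (half True D h)) i j + mmul (half False D h) (adj (half False D h)) i j
      = idm D i j"
  by (auto simp: half_mmul_adj idm_def)

lemma half_conjm:
  "conjm (half b D h) X i j = (if i \<in> D \<and> j \<in> D \<and> isl (h i) = b \<and>
      isl (h j) = b then X (strip (h i)) (strip (h j)) else 0)"
proof -
  have "conjm (half b D h) X i j = conjm (adj (adj (half b D h))) X i j"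
    by (simp add: adj_def)
  also have "\<dots> = (\<Sum>a\<in>{strip (h i)}. \<Sum>c\<in>{strip (h j)}. conjugate (adj (half b D h) a i) * X a c * adj
      (half b D h) c j)"
    by (rule conjm_adj_finite_cols[of "\<lambda>i. {strip (h i)}", OF _ half_row_support]) simp
  finally show ?thesis by (auto simp: adj_def half_def)
qed

text \<open>A real matrix produces no off-diagonal blocks, so \<open>X \<oplus> X\<close> coincides
  with \<open>c(X + i0)\<close>.\<close>

lemma half_sum_conjm:
  "conjm (half True D h) X i j + conjm (half False D h) X i j = blk D h D h (emb X) i j"
  unfolding half_conjm blk_def emb_def by (cases "h i"; cases "h j") auto

text \<open>Taking real parts is thus a compression by a real isometry; this is how real parts of
  the complex envelope land in the real one.\<close>

lemma half_compress:
  "conjm (adj (half True D h)) (blk D h D h X) = (\<lambda>k l. if k \<in> M \<and> l \<in> M then Re (X k l) else 0)"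
proof (intro ext)
  fix k l
  let ?S = "\<lambda>k. if k \<in> M then {sel (Inl k)} else {}"
  have z: "half True D h i j = 0" if "i \<notin> ?S j" for i j
    using that by (auto simp: half_def strip_h_in split: if_splits)
  show "conjm (adj (half True D h)) (blk D h D h X) k l = (if k \<in> M \<and> l \<in> M then Re (X k l) else 0)"
    by (subst conjm_adj_finite_cols[of ?S, OF _ z]) (auto simp: half_def blk_def)
qed

lemma um_support: "i \<notin> (if k \<in> M then {sel (Inl k), sel (Inr k)} else {}) \<Longrightarrow> um D h i k = 0"
  by (cases "isl (h i)") (auto simp: um_def strip_h_in split: if_splits)

lemma um_isometry: "isometry D M (um D h)"
proof (rule isometryI)
  let ?S = "\<lambda>k. if k \<in> M then {sel (Inl k), sel (Inr k)} else {}"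
  show "l2 (\<lambda>i. um D h i j)" for j
    by (rule l2_finite_support[of "?S j"]) (use um_support in auto)
  have [simp]: "complex_of_real (sqrt 2) * complex_of_real (sqrt 2) = 2"
    by (simp flip: of_real_mult)
  show "mmul (adj (um D h)) (um D h) = idm M"
    by (intro ext, subst mmul_adj_finite_cols[of ?S, OF _ um_support])
      (auto simp: um_def idm_def)
qed (auto simp: um_def strip_h_in)

lemma um_compress:
  "conjm (adj (um D h)) X k l = (if k \<in> M \<and> l \<in> M then
     (X (sel (Inl k)) (sel (Inl l)) - \<i> * X (sel (Inl k)) (sel (Inr l))
      + \<i> * X (sel (Inr k)) (sel (Inl l)) + X (sel (Inr k)) (sel (Inr l))) / 2 else 0)"
proof -
  let ?S = "\<lambda>k. if k \<in> M then {sel (Inl k), sel (Inr k)} else {}"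
  have [simp]: "complex_of_real (sqrt 2) * complex_of_real (sqrt 2) = 2"
    by (simp flip: of_real_mult)
  show ?thesis
    by (subst conjm_adj_finite_cols[of ?S, OF _ um_support])
      (auto simp: um_def field_simps)
qed

text \<open>From \<open>c(X) u = u X\<close> and the isometry property of \<open>u\<close>. The
  support condition appears because a compression is 0 off \<open>M\<close>.\<close>

lemma um_compress_blk:
  assumes "\<And>k l. k \<notin> M \<or> l \<notin> M \<Longrightarrow> X k l = 0"
  shows "conjm (adj (um D h)) (emb (blk D h D h X)) = X"
  using assms by (auto simp: um_compress emb_def blk_def fun_eq_iff complex_eq_iff)

end

text \<open>\<open>D\<close> is a doubled level and \<open>DD\<close> its double: two copies of a
  point at \<open>D\<close> are summed at \<open>DD\<close>, and \<open>twist\<close> compresses the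
  sum back to \<open>D\<close>.\<close>

locale double_splitting = inner: splitting D M h + outer: splitting DD D H
  for D :: "'i set" and M :: "'a set" and h :: "'i \<Rightarrow> 'a + 'a" and DD :: "'q set"
      and H :: "'q \<Rightarrow> 'i + 'i"
begin

text \<open>The same index in the other half: \<open>J\<close> sends the basis vector at
  \<open>j\<close> to plus or minus the one at \<open>partner j\<close>.\<close>

definition partner :: "'i \<Rightarrow> 'i" where
  "partner j = inner.sel (if isl (h j) then Inr (strip (h j)) else Inl (strip (h j)))"

lemma partner [simp]: "j \<in> D \<Longrightarrow> partner j \<in> D" "j \<in> D \<Longrightarrow> strip (h (partner j)) = strip (h j)" "j \<in> D \<Longrightarrow>
    isl (h (partner j)) \<longleftrightarrow> \<not> isl (h j)"
  by (erule inner.split_cases; simp add: partner_def)+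

lemma partner_unique: "i \<in> D \<Longrightarrow> j \<in> D \<Longrightarrow> strip (h i) = strip (h j) \<Longrightarrow> isl (h i) \<noteq> isl (h j) \<Longrightarrow>
    partner j = i"
  by (subst inner.eq_iff_h) auto

lemma twist_support:
  assumes "a \<notin> (if j \<in> D then {outer.sel (Inl j), outer.sel (Inr (partner j))} else {})"
  shows "twist DD H D h a j = 0"
proof (rule ccontr)
  assume nz: "twist DD H D h a j \<noteq> 0"
  then have aj: "a \<in> DD" "j \<in> D" by (auto simp: twist_def split: if_splits)
  show False
  proof (cases "isl (H a)")
    case True
    then have "strip (H a) = j" using nz by (auto simp: twist_def split: if_splits)
    then show False using assms True aj outer.sel_strip(1)[OF aj(1)] by auto
  next
    case False
    then have "strip (h (strip (H a))) = strip (h j)" "isl (h (strip (H a))) \<noteq> isl (h j)"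
      using nz by (auto simp: twist_def split: if_splits)
    then have "partner j = strip (H a)" using aj outer.strip_h_in by (intro partner_unique) auto
    then show False using assms False aj outer.sel_strip(2)[OF aj(1)] by auto
  qed
qed

lemma twist_sel [simp]:
  assumes "i \<in> D" "j \<in> D"
  shows "twist DD H D h (outer.sel (Inl i)) j = (if i = j then 1 / sqrt 2 else 0)"
    "twist DD H D h (outer.sel (Inr (partner i))) j = (if i = j then half_sign (h j) / sqrt 2 else
        0)"
  using assms by (auto simp: twist_def inner.eq_iff_h)

lemma half_sign_mult_self [simp]: "half_sign s * half_sign s = 1"
  by (simp add: half_sign_def)

lemma twist_isometry: "isometry DD D (twist DD H D h)"
proof -
  let ?S = "\<lambda>j. if j \<in> D then {outer.sel (Inl j), outer.sel (Inr (partner j))} else {}"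
  have z: "emb (twist DD H D h) a j = 0" if "a \<notin> ?S j" for a j
    using twist_support[OF that] by (simp add: emb_def)
  have "isometry DD D (emb (twist DD H D h))"
  proof (rule isometryI)
    show "emb (twist DD H D h) i j = 0" if "i \<notin> DD \<or> j \<notin> D" for i j
      using that by (auto simp: emb_def twist_def)
    show "l2 (\<lambda>i. emb (twist DD H D h) i j)" for j
      by (rule l2_finite_support[of "?S j"]) (use z in auto)
    have "mmul (adj (twist DD H D h)) (twist DD H D h) i j = idm D i j" for i j
    proof (cases "i \<in> D \<and> j \<in> D")
      case True
      then show ?thesis
        by (subst mmul_adj_finite_cols[of ?S, OF _ twist_support])
          (auto simp: idm_def field_simps)
    next
      case False
      then show ?thesis
        by (subst mmul_adj_finite_cols[of ?S, OF _ twist_support]) (auto simp: idm_def twist_def)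
    qed
    then show "mmul (adj (emb (twist DD H D h))) (emb (twist DD H D h)) = idm D"
      unfolding emb_adj[symmetric] emb_mmul[symmetric]
      by (simp only: emb_idm[symmetric] emb_inject) (rule ext)+
  qed
  then show ?thesis by (simp add: emb_isometry)
qed

text \<open>In \<open>Y \<oplus> Y\<close> only equal copies meet. The first copy contributes
  \<open>Y\<close>, the second \<open>J\<^sup>* Y J\<close>, with \<open>half_sign\<close> as the
  sign of \<open>J\<close> on a basis vector; the two factors \<open>1 / sqrt 2\<close> make it an
  average.\<close>

lemma twist_compress:
  "conjm (adj (twist DD H D h)) (blk DD H DD H (emb Y)) i j
    = (if i \<in> D \<and> j \<in> D then (Y i j + half_sign (h i) * half_sign (h j) * Y (partner i) (partner j))
        / 2 else 0)"
proof -
  let ?S = "\<lambda>j. if j \<in> D then {outer.sel (Inl j), outer.sel (Inr (partner j))} else {}"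
  show ?thesis
    by (subst conjm_adj_finite_cols[of ?S, OF _ twist_support])
      (auto simp: blk_def emb_def field_simps)
qed

text \<open>Averaging over conjugation by \<open>J\<close> projects onto the matrices commuting with
  \<open>J\<close>, which are the \<open>c(A)\<close>; compression by \<open>um\<close> computes
  that \<open>A\<close>. The four blocks are compared one by one.\<close>

lemma twist_compress_eq_blk:
  "conjm (adj (twist DD H D h)) (blk DD H DD H (emb Y)) = blk D h D h (conjm (adj (um D h)) (emb
      Y))"
proof (intro ext)
  fix i j
  show "conjm (adj (twist DD H D h)) (blk DD H DD H (emb Y)) i j = blk D h D h (conjm (adj (um D h))
      (emb Y)) i j"
  proof (cases "i \<in> D \<and> j \<in> D")
    case True
    then show ?thesis unfolding twist_compress
      by (elim conjE inner.split_cases)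
        (simp_all add: inner.um_compress blk_def emb_def partner_def half_sign_def
            add_divide_distrib)
  qed (auto simp: twist_compress blk_def)
qed

end

section \<open>Doubling of levels\<close>

lemma ex_level_eqpoll:
  assumes "A \<noteq> {}"
  shows "\<exists>m\<in>levels :: 'k set set. m \<approx> (A :: 'k set)"
proof
  let ?m = "SOME B :: 'k set. B \<approx> A"
  show m: "?m \<approx> A" by (rule someI[of _ A]) (rule eqpoll_refl)
  have "?m \<noteq> {}" using m assms by (metis eqpoll_empty_iff_empty eqpoll_sym)
  \<comment> \<open>Equipollent sets define the same predicate, so the choice operator returns the
    same representative.\<close>
  moreover have "(\<lambda>B :: 'k set. B \<approx> ?m) = (\<lambda>B. B \<approx> A)"
    using m by (metis eqpoll_sym eqpoll_trans)
  ultimately show "?m \<in> levels" by (simp add: levels_def)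
qed

lemma Plus_lepoll_UNIV:
  assumes "infinite (UNIV :: 'k set)"
  shows "(m :: 'k set) <+> m \<lesssim> (UNIV :: 'k set)"
proof -
  have "(UNIV :: 'k set) <+> (UNIV :: 'k set) \<approx> (UNIV :: 'k set)"
    unfolding eqpoll_iff_card_of_ordIso using card_of_Plus_infinite1[OF assms card_of_mono1[OF
        subset_UNIV]] .
  moreover have "m <+> m \<lesssim> (UNIV :: 'k set) <+> (UNIV :: 'k set)"
    by (rule subset_imp_lepoll) auto
  ultimately show ?thesis by (metis lepoll_trans2)
qed

abbreviation "splits m \<equiv> splitting (dbl m) m (halves m)"

text \<open>Two copies of \<open>m\<close> still embed into an infinite type, which makes the
  choices behind \<open>dbl\<close> and \<open>halves\<close> genuine.\<close>

lemma dbl: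
  assumes "infinite (UNIV :: 'k set)" "(m :: 'k set) \<in> levels"
  shows "dbl m \<in> levels" "splits m"
proof -
  obtain f :: "'k + 'k \<Rightarrow> 'k" where "inj_on f (m <+> m)"
    using Plus_lepoll_UNIV[OF assms(1), of m] unfolding lepoll_def by blast
  then have A: "m <+> m \<approx> f ` (m <+> m)"
    unfolding eqpoll_def by (blast dest: inj_on_imp_bij_betw)
  have "m \<noteq> {}" using assms(2) by (simp add: levels_def)
  then have "f ` (m <+> m) \<noteq> {}" by auto
  from ex_level_eqpoll[OF this] obtain d :: "'k set" where d: "d \<in> levels" "d \<approx> f ` (m <+> m)" ..
  then have "d \<in> levels \<and> d \<approx> m <+> m" using eqpoll_trans[OF d(2) eqpoll_sym[OF A]] by simp
  then have *: "dbl m \<in> levels \<and> dbl m \<approx> m <+> m" unfolding dbl_def by (rule someI)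
  then show "dbl m \<in> levels" by simp
  from * obtain h where "bij_betw h (dbl m) (m <+> m)" by (auto simp: eqpoll_def)
  then have "bij_betw (halves m) (dbl m) (m <+> m)"
    unfolding halves_def by (rule someI[of "\<lambda>h. bij_betw h (dbl m) (m <+> m)"])
  then show "splits m" by (simp add: splitting_def)
qed

lemma umat_eq_um: "splits m \<Longrightarrow> umat m = um (dbl m) (halves m)"
  by (auto simp: umat_def um_def idm_def fun_eq_iff strip_def split: sum.splits dest:
      splitting.strip_h_in)

text \<open>At a fixed \<open>v\<close> the matrix of functionals becomes a scalar matrix, so facts
  on \<open>blk\<close> apply vector by vector.\<close>

lemma cmat_eq_blk: "cmat m z i j v = blk (dbl m) (halves m) (dbl m) (halves m) (\<lambda>k l. z k l (v, 0))
    i j"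
  by (auto simp: cmat_def blk_def re_part_def im_part_def split: sum.splits)

section \<open>Matrix norms of an operator space and of its complexification\<close>

lemma op_le_partial_identity:
  assumes f: "inj_on f I"
  shows "op_le I J (\<lambda>i p. if p = f i then 1 else (0::real)) 1"
  unfolding op_le_def
proof (intro conjI allI impI)
  fix I' J' and \<eta> \<xi> :: "_ \<Rightarrow> real"
  assume *: "finite I'" "I' \<subseteq> I" "finite J'" "J' \<subseteq> J"
  define \<zeta> where "\<zeta> i = (if f i \<in> J' then \<xi> (f i) else 0)" for i
  have "(\<Sum>i\<in>I'. \<Sum>j\<in>J'. conjugate (\<eta> i) * (if j = f i then 1 else 0) * \<xi> j) = (\<Sum>i\<in>I'. \<eta> i * \<zeta> i)"
    using * by (intro sum.cong refl) (simp add: \<zeta>_def if_distrib if_distribR sum.delta cong: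
        if_cong)
  also have "norm \<dots> \<le> (\<Sum>i\<in>I'. \<bar>\<eta> i\<bar> * \<bar>\<zeta> i\<bar>)"
    by (rule sum_norm_le) (simp add: abs_mult)
  also have "\<dots> \<le> L2_set \<eta> I' * L2_set \<zeta> I'"
    by (rule L2_set_mult_ineq)
  also have "(\<Sum>i\<in>I'. (\<zeta> i)\<^sup>2) \<le> (\<Sum>j\<in>J'. (\<xi> j)\<^sup>2)"
  proof -
    have "(\<Sum>i\<in>I'. (\<zeta> i)\<^sup>2) = (\<Sum>i\<in>{i\<in>I'. f i \<in> J'}. (\<xi> (f i))\<^sup>2)"
      using * by (intro sum.mono_neutral_cong_right) (auto simp: \<zeta>_def)
    also have "\<dots> = (\<Sum>j\<in>f ` {i\<in>I'. f i \<in> J'}. (\<xi> j)\<^sup>2)"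
      using * by (subst sum.reindex) (auto intro: inj_on_subset[OF f])
    also have "\<dots> \<le> (\<Sum>j\<in>J'. (\<xi> j)\<^sup>2)"
      using * by (intro sum_mono2) auto
    finally show ?thesis .
  qed
  then have "L2_set \<eta> I' * L2_set \<zeta> I' \<le> L2_set \<eta> I' * L2_set \<xi> J'"
    unfolding L2_set_def by (intro mult_left_mono real_sqrt_le_mono) (auto simp: sum_nonneg)
  finally show "norm (\<Sum>i\<in>I'. \<Sum>j\<in>J'. conjugate (\<eta> i) * (if j = f i then 1 else 0) * \<xi> j)
      \<le> 1 * fnorm I' \<eta> * fnorm J' \<xi>"
    by (simp add: L2_set_def)
qed simp

lemma vector_space_mult: "vector_space ((*) :: 'f::field \<Rightarrow> 'f \<Rightarrow> 'f)"
  by unfold_locales (auto simp: algebra_simps)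

locale opsp =
  fixes V :: "(real, 'v::ab_group_add) opspace"
  assumes opsp: "operator_space V"
begin

abbreviation "VC \<equiv> complexify V"

lemma vs: "vector_space (scale V)"
  using opsp by (simp add: operator_space_def)

sublocale vector_space "scale V" by (rule vs)

lemma mnorm_cong: "(\<And>i j. i < n \<Longrightarrow> j < n \<Longrightarrow> x i j = y i j) \<Longrightarrow> mnorm V n x = mnorm V n y"
  using conjunct1[OF conjunct2[OF opsp[unfolded operator_space_def]]] by blast

lemma mnorm_nonneg: "0 \<le> mnorm V n x"
  using opsp by (simp add: operator_space_def)

lemma mnorm_scale: "mnorm V n (\<lambda>i j. scale V c (x i j)) = \<bar>c\<bar> * mnorm V n x"
  using opsp by (simp add: operator_space_def)

lemma mnorm_sum: "mnorm V (n + k)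
          (\<lambda>i j. if i < n \<and> j < n then x i j
                 else if n \<le> i \<and> n \<le> j then y (i - n) (j - n) else 0)
        = max (mnorm V n x) (mnorm V k y)"
  using opsp unfolding operator_space_def by blast

lemma mnorm_compress: "op_le {..<n} {..<k} \<alpha> a \<Longrightarrow> op_le {..<k} {..<n} \<beta> b \<Longrightarrow>
    mnorm V n (\<lambda>i j. \<Sum>p<k. \<Sum>q<k. scale V (\<alpha> i p * \<beta> q j) (x p q)) \<le> a * mnorm V k x * b"
  using opsp unfolding operator_space_def by blast

text \<open>Selecting rows and columns is multiplication by \<open>\<alpha>\<close> and by the
  transpose of \<open>\<beta>\<close>, which are contractions; Ruan's second axiom applies.\<close>

lemma mnorm_submatrix:
  assumes f: "inj_on f {..<n}" "f ` {..<n} \<subseteq> {..<k}" and g: "inj_on g {..<n}" "g ` {..<n} \<subseteq> {..<k}"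
  shows "mnorm V n (\<lambda>i j. x (f i) (g j)) \<le> mnorm V k x"
proof -
  define \<alpha> :: "nat \<Rightarrow> nat \<Rightarrow> real" where "\<alpha> i p = (if p = f i then 1 else 0)" for i p
  define \<beta> :: "nat \<Rightarrow> nat \<Rightarrow> real" where "\<beta> i p = (if p = g i then 1 else 0)" for i p
  have \<alpha>: "op_le {..<n} {..<k} \<alpha> 1"
    unfolding \<alpha>_def by (rule op_le_partial_identity[OF f(1)])
  have \<beta>: "op_le {..<n} {..<k} \<beta> 1"
    unfolding \<beta>_def by (rule op_le_partial_identity[OF g(1)])
  have \<beta>': "op_le {..<k} {..<n} (\<lambda>q j. \<beta> j q) 1"
    unfolding op_le_def
  proof (intro conjI allI impI)
    fix I' J' and \<eta> \<xi> :: "nat \<Rightarrow> real"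
    assume "finite I'" "I' \<subseteq> {..<k}" "finite J'" "J' \<subseteq> {..<n}"
    from op_leD[OF \<beta> this(3,4,1,2), of \<xi> \<eta>]
    show "norm (\<Sum>i\<in>I'. \<Sum>j\<in>J'. conjugate (\<eta> i) * \<beta> j i * \<xi> j)
        \<le> 1 * fnorm I' \<eta> * fnorm J' \<xi>"
      by (subst sum.swap) (simp add: mult_ac)
  qed simp
  have "mnorm V n (\<lambda>i j. x (f i) (g j)) = mnorm V n (\<lambda>i j. \<Sum>p<k. \<Sum>q<k. scale V (\<alpha> i p * \<beta> j q) (x p
      q))"
  proof (rule mnorm_cong)
    fix i j assume ij: "i < n" "j < n"
    then have "f i < k" "g j < k" using f(2) g(2) by auto
    have "(\<Sum>p<k. \<Sum>q<k. scale V (\<alpha> i p * \<beta> j q) (x p q))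
        = (\<Sum>p<k. \<Sum>q<k. if q = g j then (if p = f i then x p q else 0) else 0)"
      by (intro sum.cong refl) (auto simp: \<alpha>_def \<beta>_def)
    also have "\<dots> = x (f i) (g j)"
      using \<open>f i < k\<close> \<open>g j < k\<close> by (simp add: sum.delta)
    finally show "x (f i) (g j) = (\<Sum>p<k. \<Sum>q<k. scale V (\<alpha> i p * \<beta> j q) (x p q))" ..
  qed
  also have "\<dots> \<le> 1 * mnorm V k x * 1"
    by (rule mnorm_compress[OF \<alpha> \<beta>'])
  finally show ?thesis by simp
qed

text \<open>The block matrix is \<open>x \<oplus> x\<close>, and by Ruan's first axiom its norm is a
  maximum of two equal numbers.\<close>

lemma mnorm_complexify_real: "mnorm VC n (\<lambda>i j. (x i j, 0)) = mnorm V n x"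
proof -
  have "mnorm VC n (\<lambda>i j. (x i j, 0))
      = mnorm V (n + n) (\<lambda>i j. if i < n \<and> j < n then x i j
                 else if n \<le> i \<and> n \<le> j then x (i - n) (j - n) else 0)"
    unfolding complexify_def by (simp add: mult_2) (rule mnorm_cong, auto)
  also have "\<dots> = mnorm V n x" by (simp only: mnorm_sum max.idem)
  finally show ?thesis .
qed

text \<open>Both parts are blocks of the doubled matrix; the imaginary one is taken below the
  diagonal, where it carries no sign.\<close>

lemma mnorm_complexify_ge:
  "mnorm V n (\<lambda>i j. fst (x i j)) \<le> mnorm VC n x"
  "mnorm V n (\<lambda>i j. snd (x i j)) \<le> mnorm VC n x"
proof -
  define B where "B i j = (if i < n then (if j < n then fst (x i j) else - snd (x i (j - n)))
        else (if j < n then snd (x (i - n) j) else fst (x (i - n) (j - n))))" for i j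
  have B: "mnorm VC n x = mnorm V (2 * n) B"
    by (simp add: complexify_def B_def[abs_def])
  have "mnorm V n (\<lambda>i j. fst (x i j)) = mnorm V n (\<lambda>i j. B i j)"
    by (rule mnorm_cong) (simp add: B_def)
  also have "\<dots> \<le> mnorm V (2 * n) B"
    by (rule mnorm_submatrix) auto
  finally show "mnorm V n (\<lambda>i j. fst (x i j)) \<le> mnorm VC n x" by (simp add: B)
  have "mnorm V n (\<lambda>i j. snd (x i j)) = mnorm V n (\<lambda>i j. B (i + n) j)"
    by (rule mnorm_cong) (simp add: B_def)
  also have "\<dots> \<le> mnorm V (2 * n) B"
    by (rule mnorm_submatrix[where f = "\<lambda>i. i + n" and g = "\<lambda>i. i"]) auto
  finally show "mnorm V n (\<lambda>i j. snd (x i j)) \<le> mnorm VC n x" by (simp add: B)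
qed

lemma scale_complexify: "scale VC c (v, w)
    = (scale V (Re c) v - scale V (Im c) w, scale V (Re c) w + scale V (Im c) v)"
  by (simp add: complexify_def)

lemma vs_complexify: "vector_space (scale VC)"
  by unfold_locales (auto simp: scale_complexify algebra_simps split_paired_all)

end

section \<open>Norm balls of the dual space under complexification\<close>

lemma dual_le_iff_finite:
  "(\<forall>A. finite A \<longrightarrow> A \<subseteq> m \<longrightarrow> dual_le V A x C) \<longleftrightarrow> dual_le V m x C"
proof
  assume *: "\<forall>A. finite A \<longrightarrow> A \<subseteq> m \<longrightarrow> dual_le V A x C"
  show "dual_le V m x C"
    unfolding dual_le_def
  proof (intro allI impI)
    fix q v assume v: "mnorm V q v \<le> 1"
    let ?X = "\<lambda>(i, k) (j, l). x i j (v k l)"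
    show "op_le (m \<times> {..<q}) (m \<times> {..<q}) ?X C"
      unfolding op_le_def
    proof (intro conjI allI impI)
      have "dual_le V {} x C" using * by blast
      then have "op_le ({} \<times> {..<q}) ({} \<times> {..<q}) ?X C" using v unfolding dual_le_def by blast
      then show "0 \<le> C" by (rule op_le_nonneg)
      fix I' J' \<eta> \<xi>
      assume I: "finite I'" "I' \<subseteq> m \<times> {..<q}" "finite J'" "J' \<subseteq> m \<times> {..<q}"
      \<comment> \<open>One tested form involves only finitely many indices in \<open>m\<close>, and
        \<open>A\<close> collects those of its rows and columns.\<close>
      define A where "A = fst ` I' \<union> fst ` J'"
      have "finite A" "A \<subseteq> m" using I by (auto simp: A_def)
      then have "op_le (A \<times> {..<q}) (A \<times> {..<q}) ?X C" using * v unfolding dual_le_def by blast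
      moreover have "I' \<subseteq> A \<times> {..<q}" "J' \<subseteq> A \<times> {..<q}"
        using I unfolding A_def by (auto simp: image_iff) force+
      ultimately show "norm (\<Sum>i\<in>I'. \<Sum>j\<in>J'. conjugate (\<eta> i) * ?X i j * \<xi> j)
          \<le> C * fnorm I' \<eta> * fnorm J' \<xi>"
        using I by (intro op_leD)
    qed
  qed
next
  assume *: "dual_le V m x C"
  show "\<forall>A. finite A \<longrightarrow> A \<subseteq> m \<longrightarrow> dual_le V A x C"
    using * unfolding dual_le_def by (meson op_le_subset Sigma_mono order_refl)
qed

lemma Mdual_ball_iff:
  "x \<in> Mdual_ball V m C \<longleftrightarrow> (\<forall>i j. i \<notin> m \<or> j \<notin> m \<longrightarrow> x i j = (\<lambda>_. 0)) \<and>
     (\<forall>i j. Vector_Spaces.linear (scale V) (*) (x i j)) \<and> dual_le V m x C"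
  unfolding Mdual_ball_def dual_le_iff_finite by simp

abbreviation "sq_le m q \<equiv> op_le (m \<times> {..<q}) (m \<times> {..<q})"

lemma dual_leD: "dual_le V m x C \<Longrightarrow> mnorm V q v \<le> 1 \<Longrightarrow>
    sq_le m q (\<lambda>(i, k) (j, l). x i j (v k l)) C"
  by (simp add: dual_le_def)

context opsp begin

lemma Mdual_ball_op_le:
  assumes x: "x \<in> Mdual_ball V m C"
  shows "op_le UNIV UNIV (\<lambda>k l. x k l v) ((mnorm V 1 (\<lambda>_ _. v) + 1) * C)"
proof -
  \<comment> \<open>The summand 1 keeps the divisor positive when \<open>v\<close> is 0.\<close>
  define N where "N = mnorm V 1 (\<lambda>_ _. v) + 1"
  have N: "N > 0" "mnorm V 1 (\<lambda>_ _. v) \<le> N" using mnorm_nonneg[of 1 "\<lambda>_ _. v"] by (auto simp: N_def)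
  have "mnorm V 1 (\<lambda>_ _. scale V (1 / N) v) = \<bar>1 / N\<bar> * mnorm V 1 (\<lambda>_ _. v)"
    by (rule mnorm_scale)
  also have "\<dots> \<le> 1" using N by (simp add: field_simps)
  finally have "mnorm V 1 (\<lambda>_ _. scale V (1 / N) v) \<le> 1" .
  from dual_leD[OF _ this, of m x C] have "op_le (m \<times> {..<1::nat}) (m \<times> {..<1::nat}) (\<lambda>(i, k) (j,
      l). x i j (scale V (1 / N) v)) C"
    using x unfolding Mdual_ball_iff by blast
  then have "op_le (m \<times> {..<1::nat}) (m \<times> {..<1::nat}) (\<lambda>i j. x (fst i) (fst j) (scale V (1 / N) v))
      C"
    by (rule op_le_cong) auto
  from op_le_reindex[OF this, where f = "\<lambda>k. (k, 0)" and P = m and g = "\<lambda>k. (k, 0)" and Q = m]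
  have "op_le m m (\<lambda>i j. x i j (scale V (1 / N) v)) C"
    by (auto simp: inj_on_def)
  then have "op_le m m (\<lambda>i j. N * x i j (scale V (1 / N) v)) (norm N * C)"
    by (rule op_le_scale)
  moreover have "x i j (scale V (1 / N) v) = x i j v / N" for i j
    using x by (simp add: Mdual_ball_iff Vector_Spaces.linear_iff)
  ultimately have "op_le m m (\<lambda>k l. x k l v) (N * C)" using N by simp
  then show ?thesis unfolding N_def
    by (rule op_le_UNIV) (use x in \<open>auto simp: Mdual_ball_iff\<close>)
qed

lemma linear_complexify_split:
  assumes "Vector_Spaces.linear (scale VC) (*) f"
  shows "f (v, w) = f (v, 0) + \<i> * f (w, 0)"
proof -
  have "(v, w) = (v, 0) + scale VC \<i> (w, 0)"
    by (simp add: scale_complexify)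
  then show ?thesis
    using assms by (metis Vector_Spaces.linear_iff)
qed

text \<open>A real \<open>v\<close> keeps its norm in the complexification, and over
  \<open>dbl m \<times> {..<q}\<close> the tested matrix is the block matrix of the one for
  \<open>z\<close>. The 4 is that of \<open>op_le_blk\<close>.\<close>

lemma cmat_Mdual_ball:
  assumes m: "splits m" and z: "z \<in> Mdual_ball VC m C"
  shows "cmat m z \<in> Mdual_ball V (dbl m) (4 * C)"
  unfolding Mdual_ball_iff
proof (intro conjI allI impI)
  note zz = z[unfolded Mdual_ball_iff]
  show "cmat m z i j = (\<lambda>_. 0)" if "i \<notin> dbl m \<or> j \<notin> dbl m" for i j
    using that by (auto simp: cmat_def)
  show "Vector_Spaces.linear (scale V) (*) (cmat m z i j)" for i j
    unfolding Vector_Spaces.linear_iff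
  proof (intro conjI allI vs vector_space_mult)
    have lin: "z k l (v + w, 0) = z k l (v, 0) + z k l (w, 0)"
       "z k l (scale V c v, 0) = of_real c * z k l (v, 0)" for k l v w c
    proof -
      have l: "z k l (a + b) = z k l a + z k l b" "z k l (scale VC c a) = c * z k l a" for a b c
        using zz unfolding Vector_Spaces.linear_iff by blast+
      have "(v + w, 0) = (v, 0) + (w, 0 :: 'v)" "(scale V c v, 0) = scale VC (of_real c) (v, 0)"
        by (auto simp: scale_complexify)
      then show "z k l (v + w, 0) = z k l (v, 0) + z k l (w, 0)"
        "z k l (scale V c v, 0) = of_real c * z k l (v, 0)"
        by (simp_all only: l)
    qed
    show "cmat m z i j (v + w) = cmat m z i j v + cmat m z i j w" for v w
      by (simp add: cmat_eq_blk blk_def lin algebra_simps)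
    show "cmat m z i j (scale V c v) = c * cmat m z i j v" for c v
      by (simp add: cmat_eq_blk blk_def lin algebra_simps)
  qed
  show "dual_le V (dbl m) (cmat m z) (4 * C)"
    unfolding dual_le_def
  proof (intro allI impI)
    fix q v assume "mnorm V q v \<le> 1"
    then have "mnorm VC q (\<lambda>i j. (v i j, 0)) \<le> 1" by (simp add: mnorm_complexify_real)
    then have "sq_le m q (\<lambda>(i, k) (j, l). z i j (v k l, 0)) C"
      using dual_leD[OF conjunct2[OF conjunct2[OF zz]]] by simp
    from op_le_blk[OF this bij_betw_pairr[OF m[unfolded splitting_def]] bij_betw_pairr[OF m[unfolded
        splitting_def]]]
    have "sq_le (dbl m) q
        (blk (dbl m \<times> {..<q}) (pairr (halves m)) (dbl m \<times> {..<q}) (pairr (halves m)) (\<lambda>(i, k) (j,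
            l). z i j (v k l, 0))) (4 * C)" .
    then show "sq_le (dbl m) q (\<lambda>(i, k) (j, l). cmat m z i j (v k l)) (4 * C)"
      by (rule op_le_cong) (auto simp: cmat_eq_blk blk_def pairr_def)
  qed
qed

text \<open>\<open>cmat\<close> sees neither entries outside \<open>m\<close> nor values off the
  real vectors, hence the two extra assumptions. At \<open>v + i w\<close> the form splits into two
  parts, each bounded by \<open>8 * C\<close>.\<close>

lemma Mdual_ball_of_cmat:
  assumes m: "splits m" and z: "cmat m z \<in> Mdual_ball V (dbl m) C"
    and z0: "\<And>i j. i \<notin> m \<or> j \<notin> m \<Longrightarrow> z i j = (\<lambda>_. 0)"
    and lin: "\<And>i j. Vector_Spaces.linear (scale VC) (*) (z i j)"
  shows "z \<in> Mdual_ball VC m (16 * C)"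
  unfolding Mdual_ball_iff
proof (intro conjI allI impI z0 lin)
  note zz = z[unfolded Mdual_ball_iff]
  show "dual_le VC m z (16 * C)"
    unfolding dual_le_def
  proof (intro allI impI)
    fix q v assume v: "mnorm VC q v \<le> 1"
    have *: "sq_le m q (\<lambda>(i, k) (j, l). z i j (u k l, 0)) (8 * C)" if "mnorm V q u \<le> 1" for u
    proof -
      have "sq_le (dbl m) q (\<lambda>(i, k) (j, l). cmat m z i j (u k l)) C"
        using dual_leD[OF conjunct2[OF conjunct2[OF zz]] that] .
      then have "sq_le (dbl m) q
        (blk (dbl m \<times> {..<q}) (pairr (halves m)) (dbl m \<times> {..<q}) (pairr (halves m)) (\<lambda>(i, k) (j,
            l). z i j (u k l, 0))) C"
        by (rule op_le_cong) (auto simp: cmat_eq_blk blk_def pairr_def)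
      then show ?thesis
        by (rule op_le_of_blk) (rule bij_betw_pairr[OF m[unfolded splitting_def]])
    qed
    have "mnorm V q (\<lambda>i j. fst (v i j)) \<le> 1" "mnorm V q (\<lambda>i j. snd (v i j)) \<le> 1"
      using v mnorm_complexify_ge order_trans by blast+
    from op_le_add[OF *[OF this(1)] op_le_scale[OF *[OF this(2)], of \<i>]]
    have "sq_le m q (\<lambda>i j. (case i of (i, k) \<Rightarrow> \<lambda>(j, l). z i j (fst (v k l), 0)) j
        + \<i> * (case i of (i, k) \<Rightarrow> \<lambda>(j, l). z i j (snd (v k l), 0)) j) (16 * C)" by simp
    then show "sq_le m q (\<lambda>(i, k) (j, l). z i j (v k l)) (16 * C)"
      by (rule op_le_cong) (auto simp flip: linear_complexify_split[OF lin])
  qed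
qed

lemma re_embed_Mdual_ball:
  assumes x: "x \<in> Mdual_ball V m C"
  shows "re_embed x \<in> Mdual_ball VC m (8 * C)"
  unfolding Mdual_ball_iff
proof (intro conjI allI impI)
  note xx = x[unfolded Mdual_ball_iff]
  show "re_embed x i j = (\<lambda>_. 0)" if "i \<notin> m \<or> j \<notin> m" for i j
    using that xx by (auto simp: re_embed_def complex_eq_iff fun_eq_iff)
  have lin: "x i j (v + w) = x i j v + x i j w" "x i j (v - w) = x i j v - x i j w"
      "x i j (scale V c v) = c * x i j v" for i j v w c
  proof -
    have l: "Vector_Spaces.linear (scale V) (*) (x i j)" using xx by blast
    then show "x i j (v + w) = x i j v + x i j w" "x i j (scale V c v) = c * x i j v"
      by (simp_all add: Vector_Spaces.linear_iff)
    have "x i j (v - w + w) = x i j (v - w) + x i j w" using l unfolding Vector_Spaces.linear_iff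
        by blast
    then show "x i j (v - w) = x i j v - x i j w" by simp
  qed
  show "Vector_Spaces.linear (scale VC) (*) (re_embed x i j)" for i j
    unfolding Vector_Spaces.linear_iff
    by (auto simp: vs_complexify vector_space_mult re_embed_def scale_complexify lin complex_eq_iff
        algebra_simps)
  show "dual_le VC m (re_embed x) (8 * C)"
    unfolding dual_le_def
  proof (intro allI impI)
    fix q v assume v: "mnorm VC q v \<le> 1"
    have *: "sq_le m q (emb (\<lambda>(i, k) (j, l). x i j (u k l))) (4 * C)" if "mnorm V q u \<le> 1" for u
      by (rule op_le_emb[OF dual_leD[OF conjunct2[OF conjunct2[OF xx]] that]])
    have "mnorm V q (\<lambda>i j. fst (v i j)) \<le> 1" "mnorm V q (\<lambda>i j. snd (v i j)) \<le> 1"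
      using v mnorm_complexify_ge order_trans by blast+
    from op_le_add[OF *[OF this(1)] op_le_scale[OF *[OF this(2)], of \<i>]]
    show "sq_le m q (\<lambda>(i, k) (j, l). re_embed x i j (v k l)) (8 * C)"
      by (rule op_le_cong[THEN op_le_mono]) (auto simp: emb_def re_embed_def complex_eq_iff split:
          prod.splits)
  qed
qed

text \<open>The bound is found on the real side, for \<open>cmat m z\<close> at one vector, and
  pulled back: 32 is the 4 of \<open>cmat_Mdual_ball\<close> times the 8 of
  \<open>op_le_of_blk\<close>. Complex linearity then combines \<open>v\<close> and
  \<open>w\<close>.\<close>

lemma Mdual_ball_complexify_op_le:
  assumes m: "splits m" and z: "z \<in> Mdual_ball VC m C"
  shows "op_le UNIV UNIV (\<lambda>k l. z k l (v, w))
    (32 * (mnorm V 1 (\<lambda>_ _. v) + 1) * C + 32 * (mnorm V 1 (\<lambda>_ _. w) + 1) * C)"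
proof -
  note zz = z[unfolded Mdual_ball_iff]
  have *: "op_le UNIV UNIV (\<lambda>k l. z k l (u, 0)) (32 * (mnorm V 1 (\<lambda>_ _. u) + 1) * C)" for u
  proof -
    have "op_le UNIV UNIV (\<lambda>k l. cmat m z k l u) ((mnorm V 1 (\<lambda>_ _. u) + 1) * (4 * C))"
      by (rule Mdual_ball_op_le[OF cmat_Mdual_ball[OF m z]])
    then have "op_le (dbl m) (dbl m) (\<lambda>k l. cmat m z k l u) ((mnorm V 1 (\<lambda>_ _. u) + 1) * (4 * C))"
      by (rule op_le_subset) auto
    then have "op_le (dbl m) (dbl m) (blk (dbl m) (halves m) (dbl m) (halves m) (\<lambda>k l. z k l (u,
        0))) ((mnorm V 1 (\<lambda>_ _. u) + 1) * (4 * C))"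
      by (rule op_le_cong) (simp add: cmat_eq_blk)
    from op_le_of_blk[OF this m[unfolded splitting_def]]
    have "op_le m m (\<lambda>k l. z k l (u, 0)) (32 * (mnorm V 1 (\<lambda>_ _. u) + 1) * C)"
      by (simp add: mult_ac)
    then show ?thesis by (rule op_le_UNIV) (use zz in auto)
  qed
  have lin: "z k l (v, w) = z k l (v, 0) + \<i> * z k l (w, 0)" for k l
    using zz by (intro linear_complexify_split) blast
  from op_le_add[OF *[of v] op_le_scale[OF *[of w], of \<i>]] show ?thesis
    by (simp add: lin)
qed

end

section \<open>Weak* functionals and continuity\<close>

lemma zero_wstar: "(\<lambda>_. 0) \<in> wstar_functionals X m"
  unfolding wstar_functionals_def by (auto intro!: exI[of _ "{}"])

lemma topspace_weakstar [simp]: "topspace (weakstar X m) = level X m"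
  unfolding weakstar_def topology_generated_by_topspace
  by (auto intro!: exI[of _ "level X m"] exI[of _ "\<lambda>_. 0"] exI[of _ UNIV] zero_wstar)

lemma continuous_map_wstar:
  fixes \<phi> :: "'x \<Rightarrow> 'f::{conjugatable_field,real_normed_field}"
  assumes "\<phi> \<in> wstar_functionals X m" shows "continuous_map (weakstar X m) euclidean \<phi>"
  unfolding continuous_map_def
proof (intro conjI allI impI)
  fix U :: "'f set" assume "openin euclidean U"
  then have "open U" by simp
  with assms have "{x \<in> level X m. \<phi> x \<in> U} \<in> {{x \<in> level X m. \<phi> x \<in> U} | \<phi> U. \<phi>
      \<in> wstar_functionals X m \<and> open U}"
    by blast
  then show "openin (weakstar X m) {x \<in> topspace (weakstar X m). \<phi> x \<in> U}"
    unfolding topspace_weakstar unfolding weakstar_def by (rule topology_generated_by_Basis)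
qed auto

lemma continuous_map_into_weakstar:
  assumes "\<And>x. x \<in> topspace T \<Longrightarrow> f x \<in> level Y k"
    and "\<And>\<phi>. \<phi> \<in> wstar_functionals Y k \<Longrightarrow> continuous_map T euclidean (\<lambda>x. \<phi> (f x))"
  shows "continuous_map T (weakstar Y k) f"
  unfolding weakstar_def
proof (rule continuous_on_generated_topo)
  fix S assume "S \<in> {{x \<in> level Y k. \<phi> x \<in> U} | \<phi> U. \<phi> \<in> wstar_functionals Y k \<and> open U}"
  then obtain \<phi> U where S: "S = {x \<in> level Y k. \<phi> x \<in> U}" "\<phi> \<in> wstar_functionals Y k" "open U"
      by blast
  have "f -` S \<inter> topspace T = {x \<in> topspace T. \<phi> (f x) \<in> U}"
    using S(1) assms(1) by auto
  then show "openin T (f -` S \<inter> topspace T)"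
    using assms(2)[OF S(2)] S(3) by (simp add: continuous_map_def)
next
  show "f ` topspace T \<subseteq> \<Union> {{x \<in> level Y k. \<phi> x \<in> U} | \<phi> U. \<phi> \<in> wstar_functionals Y k \<and> open U}"
  proof -
    have "{x \<in> level Y k. (\<lambda>_. 0) x \<in> UNIV} \<in> {{x \<in> level Y k. \<phi> x \<in> U} | \<phi> U. \<phi>
        \<in> wstar_functionals Y k \<and> open U}"
      using zero_wstar[of Y k] open_UNIV by blast
    then show ?thesis using assms(1) by auto
  qed
qed

lemma wstar_functionalsE:
  assumes "\<phi> \<in> wstar_functionals X m" "0 < \<epsilon>"
  obtains T c where "finite T" "T \<subseteq> entries X m"
    "\<And>C x. 0 \<le> C \<Longrightarrow> x \<in> norm_ball X m C \<Longrightarrow> norm (\<phi> x - (\<Sum>f\<in>T. c f * f x)) \<le> \<epsilon> * C"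
proof -
  have "\<exists>T c. finite T \<and> T \<subseteq> entries X m \<and>
     (\<forall>C\<ge>0. \<forall>x\<in>norm_ball X m C. norm (\<phi> x - (\<Sum>f\<in>T. c f * f x)) \<le> \<epsilon> * C)"
    using assms by (simp add: wstar_functionals_def)
  then show thesis by (elim exE conjE) (rule that, auto)
qed

text \<open>An approximating sum may use the same entry for several indices, as happens after
  pulling entries back; the coefficients are collected over the fibres of \<open>e\<close>.\<close>

lemma wstar_functionalsI:
  assumes "\<And>\<epsilon>. 0 < \<epsilon> \<Longrightarrow> \<exists>(S::'s set) c e. finite S \<and> e ` S \<subseteq> entries X m \<and>
     (\<forall>C\<ge>0. \<forall>x\<in>norm_ball X m C. norm (\<phi> x - (\<Sum>s\<in>S. c s * e s x)) \<le> \<epsilon> * C)"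
  shows "\<phi> \<in> wstar_functionals X m"
  unfolding wstar_functionals_def
proof (intro CollectI allI impI)
  fix \<epsilon> :: real assume "0 < \<epsilon>"
  from assms[OF this] obtain S :: "'s set" and c e where S: "finite S" "e ` S \<subseteq> entries X m"
    and bd: "\<forall>C\<ge>0. \<forall>x\<in>norm_ball X m C. norm (\<phi> x - (\<Sum>s\<in>S. c s * e s x)) \<le> \<epsilon> * C" by blast
  have "(\<Sum>s\<in>S. c s * e s x) = (\<Sum>f\<in>e ` S. (\<Sum>s\<in>{s\<in>S. e s = f}. c s) * f x)" for x
    unfolding sum.image_gen[OF S(1), of "\<lambda>s. c s * e s x" e]
    by (intro sum.cong refl) (simp add: sum_distrib_right)
  then show "\<exists>T c. finite T \<and> T \<subseteq> entries X m \<and>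
     (\<forall>C\<ge>0. \<forall>x\<in>norm_ball X m C. norm (\<phi> x - (\<Sum>f\<in>T. c f * f x)) \<le> \<epsilon> * C)"
    using S bd by (intro exI[of _ "e ` S"] exI[of _ "\<lambda>f. \<Sum>s\<in>{s\<in>S. e s = f}. c s"]) auto
qed

section \<open>The maps between the real and the complex graph space\<close>

type_synonym ('k, 'f) pair_matrix = "'k \<times> 'k \<Rightarrow> 'k \<times> 'k \<Rightarrow> 'f"

type_synonym ('k, 'w, 'f) point = "('k \<Rightarrow> 'k \<Rightarrow> 'w \<Rightarrow> 'f) \<times> ('k, 'f) pair_matrix"

definition cgraph :: "'k set \<Rightarrow> 'k set \<Rightarrow> ('k, 'v \<times> 'v::zero, complex) point
    \<Rightarrow> ('k, 'v, real) point" where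
  "cgraph n m = (\<lambda>(z, \<delta>). (cmat m z,
     blk (n \<times> dbl m) (pairl (halves m)) (n \<times> dbl m) (pairl (halves m)) \<delta>))"

definition rgraph :: "('k, 'v, real) point
    \<Rightarrow> ('k, 'v \<times> 'v::zero, complex) point" where
  "rgraph = (\<lambda>(x, \<gamma>). (re_embed x, emb \<gamma>))"

text \<open>Multiplication by the imaginary unit on both components, needed to recover a complex
  functional from its real part.\<close>

definition imul :: "('k, 'w, complex) point
    \<Rightarrow> ('k, 'w, complex) point" where
  "imul = (\<lambda>(z, \<delta>). (\<lambda>i j v. \<i> * z i j v, \<lambda>p q. \<i> * \<delta> p q))"

lemma graph_norm_ball: "(x, \<gamma>) \<in> norm_ball (graph_space V n) m C \<longleftrightarrow> x \<in> Mdual_ball V m C \<and>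
    (\<forall>p q. p \<notin> n \<times> m \<or> q \<notin> n \<times> m \<longrightarrow> \<gamma> p q = 0) \<and> op_le (n \<times> m) (n \<times> m) \<gamma> C"
  by (auto simp: graph_space_def Mspace_def Mat_def)

lemma entries_fst: "i \<in> m \<Longrightarrow> j \<in> m \<Longrightarrow> (\<lambda>(x, \<gamma>). x i j v) \<in> entries (graph_space V n) m"
  unfolding graph_space_def Mspace_def ncspace.simps
  by (rule UnI1, rule CollectI, rule exI[of _ "\<lambda>x. x i j v"]) blast

lemma entries_snd: "p \<in> n \<times> m \<Longrightarrow> q \<in> n \<times> m \<Longrightarrow> (\<lambda>(x, \<gamma>). \<gamma> p q) \<in> entries (graph_space V n) m"
  unfolding graph_space_def Mspace_def ncspace.simps
  by (rule UnI2, rule CollectI, rule exI[of _ p], rule exI[of _ q]) simp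

lemma entries_cases:
  assumes "f \<in> entries (graph_space V n) m"
  obtains (fst) i j v where "i \<in> m" "j \<in> m" "f = (\<lambda>(x, \<gamma>). x i j v)"
    | (snd) p q where "p \<in> n \<times> m" "q \<in> n \<times> m" "f = (\<lambda>(x, \<gamma>). \<gamma> p q)"
  using assms unfolding graph_space_def Mspace_def ncspace.simps
proof (elim UnE CollectE exE conjE)
  fix g i j v assume "f = (\<lambda>(x, \<gamma>). g x)" "g = (\<lambda>x. x i j v)" "i \<in> m" "j \<in> m"
  then show ?thesis by (intro fst) simp_all
next
  fix p q assume "f = (\<lambda>(x, \<gamma>). \<gamma> p q)" "p \<in> n \<times> m" "q \<in> n \<times> m"
  then show ?thesis by (intro snd)
qed

lemma dual_le_mono: "dual_le V m x C \<Longrightarrow> C \<le> D \<Longrightarrow> dual_le V m x D"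
  unfolding dual_le_def by (meson op_le_mono)

lemma Mdual_ball_mono: "x \<in> Mdual_ball V m C \<Longrightarrow> C \<le> D \<Longrightarrow> x \<in> Mdual_ball V m D"
  unfolding Mdual_ball_iff by (meson dual_le_mono)

lemma graph_level: "(x, \<gamma>) \<in> level (graph_space V n) m \<longleftrightarrow> x \<in> level (Mspace V) m \<and>
    \<gamma> \<in> Mat (n \<times> m) (n \<times> m)"
proof
  assume "(x, \<gamma>) \<in> level (graph_space V n) m"
  then show "x \<in> level (Mspace V) m \<and> \<gamma> \<in> Mat (n \<times> m) (n \<times> m)"
    by (auto simp: level_def graph_space_def)
next
  assume "x \<in> level (Mspace V) m \<and> \<gamma> \<in> Mat (n \<times> m) (n \<times> m)"
  then obtain C D where "x \<in> Mdual_ball V m C" "\<forall>i j. i \<notin> n \<times> m \<or> j \<notin> n \<times> m \<longrightarrow> \<gamma> i j = 0"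
      "op_le (n \<times> m) (n \<times> m) \<gamma> D"
    by (auto simp: level_def Mspace_def Mat_def)
  then have "(x, \<gamma>) \<in> norm_ball (graph_space V n) m (max C D)"
    unfolding graph_norm_ball by (meson Mdual_ball_mono op_le_mono max.cobounded1 max.cobounded2)
  then show "(x, \<gamma>) \<in> level (graph_space V n) m" by (auto simp: level_def)
qed

lemma imul_norm_ball:
  assumes "y \<in> norm_ball (graph_space V n) m C" shows "imul y \<in> norm_ball (graph_space V n) m C"
proof -
  obtain z \<delta> where y: "y = (z, \<delta>)" by (cases y)
  note zz = assms[unfolded y graph_norm_ball Mdual_ball_iff]
  have "Vector_Spaces.linear (scale V) (*) (\<lambda>v. \<i> * z i j v)" for i j
    using zz by (auto simp: Vector_Spaces.linear_iff algebra_simps)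
  moreover have "dual_le V m (\<lambda>i j v. \<i> * z i j v) C"
    unfolding dual_le_def
  proof (intro allI impI)
    fix q v assume "mnorm V q v \<le> 1"
    from op_le_scale[OF dual_leD[OF _ this], of m z C \<i>] zz
    have "sq_le m q (\<lambda>i j. \<i> * (case i of (i, k) \<Rightarrow> \<lambda>(j, l). z i j (v k l)) j) C" by simp
    then show "sq_le m q (\<lambda>(i, k) (j, l). \<i> * z i j (v k l)) C"
      by (rule op_le_cong) auto
  qed
  moreover have "op_le (n \<times> m) (n \<times> m) (\<lambda>p q. \<i> * \<delta> p q) C"
    using op_le_scale[of "n \<times> m" "n \<times> m" \<delta> C \<i>] zz by simp
  ultimately show ?thesis
    using zz unfolding y imul_def case_prod_conv graph_norm_ball Mdual_ball_iff by auto
qed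

context opsp begin

lemma cgraph_norm_ball:
  assumes m: "splits m" and y: "y \<in> norm_ball (graph_space VC n) m C"
  shows "cgraph n m y \<in> norm_ball (graph_space V n) (dbl m) (4 * C)"
proof -
  obtain z \<delta> where [simp]: "y = (z, \<delta>)" by (cases y)
  note b = bij_betw_pairl[OF m[unfolded splitting_def], of n]
  show ?thesis
    using y cmat_Mdual_ball[OF m] op_le_blk[OF _ b b]
    by (auto simp: cgraph_def graph_norm_ball blk_def)
qed

lemma rgraph_norm_ball:
  assumes y: "y \<in> norm_ball (graph_space V n) m C"
  shows "rgraph y \<in> norm_ball (graph_space VC n) m (8 * C)"
proof -
  obtain x \<gamma> where [simp]: "y = (x, \<gamma>)" by (cases y)
  have x: "x \<in> Mdual_ball V m C" and g: "\<forall>p q. p \<notin> n \<times> m \<or> q \<notin> n \<times> m \<longrightarrow> \<gamma> p q = 0"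
      "op_le (n \<times> m) (n \<times> m) \<gamma> C"
    using y by (auto simp: graph_norm_ball)
  have "op_le (n \<times> m) (n \<times> m) (emb \<gamma>) (8 * C)"
    by (rule op_le_mono[OF op_le_emb[OF g(2)]]) (use op_le_nonneg[OF g(2)] in simp)
  then show ?thesis
    using re_embed_Mdual_ball[OF x] g(1) by (simp add: rgraph_def graph_norm_ball) (simp add:
        emb_def)
qed

text \<open>Each entry of a block matrix is the real part of one complex entry times
  \<open>a\<close>, the phase of the row times the conjugate phase of the column. The behaviour
  under \<open>imul\<close> gives access to the imaginary part.\<close>

lemma cgraph_entries:
  fixes m :: "'k set"
  assumes m: "splits m" and f: "f \<in> entries (graph_space V n) (dbl m)"
  shows "\<exists>a e. e \<in> entries (graph_space VC n) m \<and>
    (\<forall>y. f (cgraph n m y) = Re (a * e y) \<and> e (imul y) = \<i> * e y)"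
proof -
  interpret splitting "dbl m" m "halves m" by (rule m)
  interpret p: splitting "n \<times> dbl m" "n \<times> m" "pairl (halves m)"
    by unfold_locales (rule bij_betw_pairl[OF bij])
  from f show ?thesis
  proof (cases rule: entries_cases)
    case x: (fst i j v)
    define e where "e = (\<lambda>(z :: 'k \<Rightarrow> 'k \<Rightarrow> 'v \<times> 'v \<Rightarrow> complex, \<delta> :: ('k, complex) pair_matrix).
      z (strip (halves m i)) (strip (halves m j)) (v, 0))"
    have "e \<in> entries (graph_space VC n) m"
      unfolding e_def by (rule entries_fst[OF strip_h_in[OF x(1)] strip_h_in[OF x(2)]])
    moreover have "\<forall>y. f (cgraph n m y) = Re (phase (halves m i) * cnj (phase (halves m j)) * e y) \<and>
        e (imul y) = \<i> * e y"
      using x by (auto simp: e_def cgraph_def cmat_eq_blk blk_def imul_def algebra_simps)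
    ultimately show ?thesis by blast
  next
    case g: (snd p q)
    define e where "e = (\<lambda>(z :: 'k \<Rightarrow> 'k \<Rightarrow> 'v \<times> 'v \<Rightarrow> complex, \<delta> :: ('k, complex) pair_matrix).
      \<delta> (strip (pairl (halves m) p)) (strip (pairl (halves m) q)))"
    have "e \<in> entries (graph_space VC n) m"
      unfolding e_def by (rule entries_snd[OF p.strip_h_in[OF g(1)] p.strip_h_in[OF g(2)]])
    moreover have "\<forall>y. f (cgraph n m y) = Re (phase (pairl (halves m) p) * cnj (phase (pairl (halves
        m) q)) * e y) \<and> e (imul y) = \<i> * e y"
      using g by (auto simp: e_def cgraph_def blk_def imul_def algebra_simps)
    ultimately show ?thesis by blast
  qed
qed

lemma wstar_cgraph:
  fixes m :: "'k set"
  assumes m: "splits m" and \<phi>: "\<phi> \<in> wstar_functionals (graph_space V n) (dbl m)"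
  shows "(\<lambda>y. Complex (\<phi> (cgraph n m y)) (- \<phi> (cgraph n m (imul y))))
      \<in> wstar_functionals (graph_space VC n) m"
proof (rule wstar_functionalsI)
  fix \<epsilon> :: real assume "0 < \<epsilon>"
  \<comment> \<open>\<open>cgraph\<close> enlarges radii by 4, and the errors in the real and the
    imaginary part are added: 8 in all.\<close>
  then have "0 < \<epsilon> / 8" by simp
  from \<phi> this obtain T c where T: "finite T" "T \<subseteq> entries (graph_space V n) (dbl m)"
    and bd: "\<And>C x. 0 \<le> C \<Longrightarrow> x \<in> norm_ball (graph_space V n) (dbl m) C \<Longrightarrow>
        norm (\<phi> x - (\<Sum>f\<in>T. c f * f x)) \<le> \<epsilon> / 8 * C"
    by (rule wstar_functionalsE) (rule that, assumption+)
  have "\<forall>f\<in>T. \<exists>a e. e \<in> entries (graph_space VC n) m \<and>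
      (\<forall>y. f (cgraph n m y) = Re (a * e y) \<and> e (imul y) = \<i> * e y)"
    by (intro ballI) (rule cgraph_entries[OF m subsetD[OF T(2)]])
  from bchoice[OF this] obtain a where "\<forall>f\<in>T. \<exists>e. e \<in> entries (graph_space VC n) m \<and>
      (\<forall>y. f (cgraph n m y) = Re (a f * e y) \<and> e (imul y) = \<i> * e y)" ..
  from bchoice[OF this] obtain e where "\<forall>f\<in>T. e f \<in> entries (graph_space VC n) m \<and>
      (\<forall>y. f (cgraph n m y) = Re (a f * e f y) \<and> e f (imul y) = \<i> * e f y)" ..
  then have ae: "\<And>f. f \<in> T \<Longrightarrow> e f \<in> entries (graph_space VC n) m"
     "\<And>f y. f \<in> T \<Longrightarrow> f (cgraph n m y) = Re (a f * e f y)" "\<And>f y. f \<in> T \<Longrightarrow> e f (imul y) = \<i> * e f y"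
    by (simp_all del: split_paired_All times_complex.simps)
  define L where "L y = (\<Sum>f\<in>T. complex_of_real (c f) * a f * e f y)" for y
  \<comment> \<open>Evaluation at \<open>imul y\<close> exposes the imaginary part, by
    \<open>Re (\<i> * w) = - Im w\<close>.\<close>
  have L: "(\<Sum>f\<in>T. c f * f (cgraph n m y)) = Re (L y)" "(\<Sum>f\<in>T. c f * f (cgraph n m (imul y)))
      = - Im (L y)" for y
    unfolding L_def Re_sum Im_sum sum_negf[symmetric]
    by (auto intro!: sum.cong simp: ae algebra_simps)
  have "cmod (Complex (\<phi> (cgraph n m y)) (- \<phi> (cgraph n m (imul y))) - L y) \<le> \<epsilon> * C"
    if C: "0 \<le> C" and y: "y \<in> norm_ball (graph_space VC n) m C" for C y
  proof -
    have "norm (\<phi> (cgraph n m y) - Re (L y)) \<le> \<epsilon> / 8 * (4 * C)"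
      using bd[OF _ cgraph_norm_ball[OF m y]] C by (simp add: L)
    moreover have "norm (\<phi> (cgraph n m (imul y)) - - Im (L y)) \<le> \<epsilon> / 8 * (4 * C)"
      using bd[OF _ cgraph_norm_ball[OF m imul_norm_ball[OF y]], unfolded L(2)] C by simp
    moreover have "cmod (Complex (\<phi> (cgraph n m y)) (- \<phi> (cgraph n m (imul y))) - L y)
        \<le> norm (\<phi> (cgraph n m y) - Re (L y)) + norm (\<phi> (cgraph n m (imul y)) - - Im (L y))"
      using cmod_le[of "Complex (\<phi> (cgraph n m y)) (- \<phi> (cgraph n m (imul y))) - L y"]
        abs_minus_cancel[of "\<phi> (cgraph n m (imul y)) + Im (L y)"] by simp
    ultimately show ?thesis by linarith
  qed
  then show "\<exists>(S :: (('k, 'v, real) point \<Rightarrow> real) set) c e. finite S \<and>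
      e ` S \<subseteq> entries (graph_space VC n) m \<and>
      (\<forall>C\<ge>0. \<forall>y\<in>norm_ball (graph_space VC n) m C.
        cmod (Complex (\<phi> (cgraph n m y)) (- \<phi> (cgraph n m (imul y))) - (\<Sum>s\<in>S. c s * e s y))
            \<le> \<epsilon> * C)"
    using T(1) ae(1) unfolding L_def
    by (intro exI[of _ T] exI[of _ "\<lambda>f. complex_of_real (c f) * a f"] exI[of _ e]) auto
qed

lemma continuous_cgraph:
  assumes m: "splits m"
  shows "continuous_map (weakstar (graph_space VC n) m) (weakstar (graph_space V n) (dbl m)) (cgraph
      n m)"
proof (rule continuous_map_into_weakstar)
  show "cgraph n m y \<in> level (graph_space V n) (dbl m)"
      if "y \<in> topspace (weakstar (graph_space VC n) m)" for y
    using that cgraph_norm_ball[OF m] unfolding topspace_weakstar level_def by blast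
  fix \<phi> assume "\<phi> \<in> wstar_functionals (graph_space V n) (dbl m)"
  note c = continuous_map_wstar[OF wstar_cgraph[OF m this]]
  have "continuous_map euclidean euclidean Re" by (simp add: continuous_intros)
  from continuous_map_compose[OF c this]
  show "continuous_map (weakstar (graph_space VC n) m) euclidean (\<lambda>y. \<phi> (cgraph n m y))"
    by (simp add: o_def)
qed

text \<open>The embedded point has imaginary part \<open>x i j w\<close> at \<open>(v, w)\<close>,
  whereas the entries of \<open>emb \<gamma>\<close> are real. So \<open>b\<close> is 1 or 0; the
  zero functional itself need not be an entry.\<close>

lemma rgraph_entries:
  fixes m :: "'k set"
  assumes f: "f \<in> entries (graph_space VC n) m"
  shows "\<exists>b g h. g \<in> entries (graph_space V n) m \<and> h \<in> entries (graph_space V n) m \<and>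
    (\<forall>y. f (rgraph y) = Complex (g y) (b * h y))"
proof -
  from f show ?thesis
  proof (cases rule: entries_cases)
    case x: (fst i j vw)
    obtain v w where vw: "vw = (v, w)" by (cases vw)
    define e where "e v = (\<lambda>(x :: 'k \<Rightarrow> 'k \<Rightarrow> 'v \<Rightarrow> real, \<delta> :: ('k, real) pair_matrix). x i j v)" for v
    have "e u \<in> entries (graph_space V n) m" for u
      unfolding e_def by (rule entries_fst[OF x(1,2)])
    moreover have "\<forall>y. f (rgraph y) = Complex (e v y) (1 * e w y)"
      using x by (auto simp: e_def rgraph_def re_embed_def vw)
    ultimately show ?thesis by blast
  next
    case g: (snd p q)
    define e where "e = (\<lambda>(x :: 'k \<Rightarrow> 'k \<Rightarrow> 'v \<Rightarrow> real, \<delta> :: ('k, real) pair_matrix). \<delta> p q)"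
    have "e \<in> entries (graph_space V n) m"
      unfolding e_def by (rule entries_snd[OF g(1,2)])
    moreover have "\<forall>y. f (rgraph y) = Complex (e y) (0 * e y)"
      using g by (auto simp: e_def rgraph_def emb_def complex_eq_iff)
    ultimately show ?thesis by blast
  qed
qed

lemma wstar_rgraph:
  fixes m :: "'k set"
  assumes \<psi>: "\<psi> \<in> wstar_functionals (graph_space VC n) m"
  shows "(\<lambda>y. Re (\<psi> (rgraph y))) \<in> wstar_functionals (graph_space V n) m" (is ?R)
    and "(\<lambda>y. Im (\<psi> (rgraph y))) \<in> wstar_functionals (graph_space V n) m" (is ?I)
proof -
  \<comment> \<open>The choice \<open>\<kappa> = 1\<close> gives the real part,
    \<open>\<kappa> = - \<i>\<close> the imaginary part.\<close>
  have *: "(\<lambda>y. Re (\<kappa> * \<psi> (rgraph y))) \<in> wstar_functionals (graph_space V n) m" if \<kappa>: "cmod \<kappa> = 1"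
      for \<kappa>
  proof (rule wstar_functionalsI)
    fix \<epsilon> :: real assume "0 < \<epsilon>"
    \<comment> \<open>Here 8 is the factor by which \<open>rgraph\<close> enlarges radii.\<close>
    then have "0 < \<epsilon> / 8" by simp
    from \<psi> this obtain T c where T: "finite T" "T \<subseteq> entries (graph_space VC n) m"
      and bd: "\<And>C x. 0 \<le> C \<Longrightarrow> x \<in> norm_ball (graph_space VC n) m C \<Longrightarrow> norm (\<psi> x - (\<Sum>f\<in>T. c f * f x))
          \<le> \<epsilon> / 8 * C"
      by (rule wstar_functionalsE) (rule that, assumption+)
    have "\<forall>f\<in>T. \<exists>b g h. g \<in> entries (graph_space V n) m \<and> h \<in> entries (graph_space V n) m \<and>
        (\<forall>y. f (rgraph y) = Complex (g y) (b * h y))"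
      by (intro ballI) (rule rgraph_entries[OF subsetD[OF T(2)]])
    from bchoice[OF this] obtain b where "\<forall>f\<in>T. \<exists>g h. g \<in> entries (graph_space V n) m \<and>
        h \<in> entries (graph_space V n) m \<and> (\<forall>y. f (rgraph y) = Complex (g y) (b f * h y))" ..
    from bchoice[OF this] obtain g where "\<forall>f\<in>T. \<exists>h. g f \<in> entries (graph_space V n) m \<and>
        h \<in> entries (graph_space V n) m \<and> (\<forall>y. f (rgraph y) = Complex (g f y) (b f * h y))" ..
    from bchoice[OF this] obtain h where "\<forall>f\<in>T. g f \<in> entries (graph_space V n) m \<and>
        h f \<in> entries (graph_space V n) m \<and> (\<forall>y. f (rgraph y) = Complex (g f y) (b f * h f y))" ..
    then have bgh: "\<And>f. f \<in> T \<Longrightarrow> g f \<in> entries (graph_space V n) m" "\<And>f. f \<in> T \<Longrightarrow>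
        h f \<in> entries (graph_space V n) m"
      "\<And>f y. f \<in> T \<Longrightarrow> f (rgraph y) = Complex (g f y) (b f * h f y)"
      by (simp_all del: split_paired_All)
    \<comment> \<open>Each complex entry contributes two real ones, marked by a Boolean: for
      \<open>k = \<kappa> * c f\<close> the real part of \<open>k * Complex g (b * h)\<close> is
      \<open>Re k * g - Im k * b * h\<close>.\<close>
    define d where "d = (\<lambda>(f, s). if s then Re (\<kappa> * c f) else - Im (\<kappa> * c f) * b f)"
    define e where "e = (\<lambda>(f, s). if s then g f else h f)"
    have S: "(\<Sum>s\<in>T \<times> UNIV. d s * e s y) = Re (\<kappa> * (\<Sum>f\<in>T. c f * f (rgraph y)))" for y
    proof -
      have "(\<Sum>s\<in>T \<times> UNIV. d s * e s y) = (\<Sum>f\<in>T. \<Sum>s\<in>UNIV. d (f, s) * e (f, s) y)"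
        by (simp add: sum.cartesian_product)
      also have "\<dots> = Re (\<kappa> * (\<Sum>f\<in>T. c f * f (rgraph y)))"
        unfolding sum_distrib_left Re_sum
        by (intro sum.cong refl) (simp add: UNIV_bool d_def e_def bgh algebra_simps)
      finally show ?thesis .
    qed
    have "norm (Re (\<kappa> * \<psi> (rgraph y)) - (\<Sum>s\<in>T \<times> UNIV. d s * e s y)) \<le> \<epsilon> * C"
      if C: "0 \<le> C" and y: "y \<in> norm_ball (graph_space V n) m C" for C y
    proof -
      have "norm (Re (\<kappa> * \<psi> (rgraph y)) - (\<Sum>s\<in>T \<times> UNIV. d s * e s y))
          = \<bar>Re (\<kappa> * (\<psi> (rgraph y) - (\<Sum>f\<in>T. c f * f (rgraph y))))\<bar>"
        by (simp add: S right_diff_distrib)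
      also have "\<dots> \<le> cmod (\<kappa> * (\<psi> (rgraph y) - (\<Sum>f\<in>T. c f * f (rgraph y))))"
        by (rule abs_Re_le_cmod)
      also have "\<dots> \<le> \<epsilon> / 8 * (8 * C)"
        using bd[OF _ rgraph_norm_ball[OF y]] C by (simp add: norm_mult \<kappa>)
      finally show ?thesis by simp
    qed
    then show "\<exists>(S :: ((('k, 'v \<times> 'v, complex) point \<Rightarrow> complex) \<times> bool) set) c e. finite S \<and>
        e ` S \<subseteq> entries (graph_space V n) m \<and>
        (\<forall>C\<ge>0. \<forall>y\<in>norm_ball (graph_space V n) m C. norm (Re (\<kappa> * \<psi> (rgraph y)) - (\<Sum>s\<in>S. c s * e s
            y)) \<le> \<epsilon> * C)"
      using T(1) bgh(1,2)
      by (intro exI[of _ "T \<times> UNIV"] exI[of _ d] exI[of _ e]) (auto simp: e_def)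
  qed
  from *[of 1] show ?R by simp
  from *[of "- \<i>"] show ?I by simp
qed

lemma continuous_rgraph:
  "continuous_map (weakstar (graph_space V n) m) (weakstar (graph_space VC n) m) rgraph"
proof (rule continuous_map_into_weakstar)
  show "rgraph y \<in> level (graph_space VC n) m" if "y \<in> topspace (weakstar (graph_space V n) m)"
      for y
    using that rgraph_norm_ball unfolding topspace_weakstar level_def by blast
  fix \<psi> assume "\<psi> \<in> wstar_functionals (graph_space VC n) m"
  note w = wstar_rgraph[OF this, THEN continuous_map_wstar]
  have "continuous_map euclidean euclidean complex_of_real" "continuous_map euclidean euclidean (\<lambda>x.
      \<i> * complex_of_real x)"
    by (simp_all add: continuous_intros)
  from continuous_map_add[OF continuous_map_compose[OF w(1) this(1)] continuous_map_compose[OF w(2)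
      this(2)]]
  show "continuous_map (weakstar (graph_space V n) m) euclidean (\<lambda>y. \<psi> (rgraph y))"
    by (simp add: o_def complex_eq[symmetric])
qed

end

section \<open>Conjugation and direct sums in the ambient spaces\<close>

lemma infsum_blk:
  assumes "\<And>k l. (\<lambda>t. f t k l) summable_on I"
  shows "blk D h E e (\<lambda>k l. \<Sum>\<^sub>\<infinity>t\<in>I. f t k l) i j = (\<Sum>\<^sub>\<infinity>t\<in>I. blk D h E e (f t) i j)"
  by (rule infsumI[symmetric], rule has_sum_blk, rule has_sum_infsum, rule assms)

lemma cnj_by_Mspace: "cnj_by (Mspace V) \<alpha> x = (\<lambda>i j v. conjm \<alpha> (\<lambda>k l. x k l v) i j)"
  by (simp add: Mspace_def conjm_def)

lemma cnj_by_graph: "cnj_by (graph_space V n) \<alpha> (x, \<gamma>) = (cnj_by (Mspace V) \<alpha> x, conjm (amp n \<alpha>) \<gamma>)"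
  by (simp add: graph_space_def conjm_def)

lemma fsum_Mspace: "fsum (Mspace V) I y = (\<lambda>k l v. \<Sum>\<^sub>\<infinity>i\<in>I. y i k l v)"
  by (simp add: Mspace_def)

lemma fsum_graph: "fsum (graph_space V n) I y = (fsum (Mspace V) I (\<lambda>i. fst (y i)), \<lambda>p q. \<Sum>\<^sub>\<infinity>i\<in>I. snd
    (y i) p q)"
  by (simp add: graph_space_def)

lemma isometry_rows:
  fixes \<alpha> :: "'i \<Rightarrow> 'j \<Rightarrow> complex"
  assumes "isometry m k \<alpha>" shows "l2 (\<alpha> i)" "l2 (adj \<alpha> j)"
proof -
  obtain C where C: "op_le UNIV UNIV \<alpha> C"
    using assms Mat_op_le_UNIV unfolding isometry_def by blast
  show "l2 (\<alpha> i)" by (rule op_le_row_l2[OF C])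
  show "l2 (adj \<alpha> j)" by (rule op_le_row_l2[OF op_le_adj[OF C]])
qed

lemma isometry_zero: "isometry m k \<alpha> \<Longrightarrow> i \<notin> m \<or> j \<notin> k \<Longrightarrow> \<alpha> i j = 0"
  unfolding isometry_def by (blast dest: MatD)

lemma adj_adj [simp]: "adj (adj A) = A"
  by (simp add: adj_def)

text \<open>A row of the amplification lives on one fibre, where it is a row of \<open>A\<close> or
  0.\<close>

lemma l2_amp:
  assumes "l2 (A i)" shows "l2 (amp n A (p, i))"
proof -
  have "(\<lambda>x. (cmod (amp n A (p, i) x))\<^sup>2) summable_on range (Pair p)"
  proof (subst summable_on_reindex)
    have "(\<lambda>k. if p \<in> n then (cmod (A i k))\<^sup>2 else 0) summable_on UNIV"
      using assms by (cases "p \<in> n") (auto simp: l2_def)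
    then show "((\<lambda>x. (cmod (amp n A (p, i) x))\<^sup>2) \<circ> Pair p) summable_on UNIV"
      by (rule summable_on_cong[THEN iffD1, rotated]) (simp add: amp_def)
  qed (auto simp: inj_on_def)
  then show ?thesis unfolding l2_def
    by (rule summable_on_cong_neutral[THEN iffD1, rotated -1]) (auto simp: amp_def)
qed

lemma l2_amp': "(\<And>i. l2 (A i)) \<Longrightarrow> l2 (amp n A r)"
  by (cases r) (simp add: l2_amp)

lemma mmul_amp:
  fixes A :: "'i \<Rightarrow> 'j \<Rightarrow> 'f::real_normed_field" and B :: "'j \<Rightarrow> 'l \<Rightarrow> 'f" and n :: "'k set"
  shows "mmul (amp n A) (amp n B) = amp n (mmul A B)"
proof (intro ext)
  fix r :: "'k \<times> 'i" and s :: "'k \<times> 'l"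
  obtain p i q l where [simp]: "r = (p, i)" "s = (q, l)" by (cases r, cases s)
  have "mmul (amp n A) (amp n B) r s = (\<Sum>\<^sub>\<infinity>x\<in>range (Pair p). amp n A r x * amp n B x s)"
    unfolding mmul_def by (rule infsum_cong_neutral) (auto simp: amp_def)
  also have "\<dots> = (\<Sum>\<^sub>\<infinity>j. amp n A r (p, j) * amp n B (p, j) s)"
    by (subst infsum_reindex) (auto simp: inj_on_def o_def)
  also have "\<dots> = amp n (mmul A B) r s"
    by (cases "p = q"; cases "q \<in> n") (simp_all add: amp_def mmul_def)
  finally show "mmul (amp n A) (amp n B) r s = amp n (mmul A B) r s" .
qed

lemma amp_idm: "amp n (idm m) = idm (n \<times> m)"
  by (auto simp: amp_def idm_def fun_eq_iff)

lemma amp_zero: "(\<And>i j. i \<notin> m \<or> j \<notin> k \<Longrightarrow> A i j = 0) \<Longrightarrow> p \<notin> n \<times> m \<or> q \<notin> n \<times> k \<Longrightarrow> amp n A p q = 0"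
  by (cases p; cases q) (auto simp: amp_def)

lemma has_sum_amp:
  assumes "\<And>k l. ((\<lambda>t. mmul (A t) (adj (A t)) k l) has_sum idm m k l) T"
  shows "((\<lambda>t. mmul (amp n (A t)) (adj (amp n (A t))) p q) has_sum idm (n \<times> m) p q) T"
proof -
  obtain a b c d where pq: "p = (a, b)" "q = (c, d)" by (cases p, cases q)
  show ?thesis
    unfolding amp_adj[symmetric] mmul_amp amp_idm[symmetric] pq
    using assms by (cases "a = c"; cases "c \<in> n") (simp_all add: amp_def)
qed

lemma conjm_zero:
  assumes "\<And>i j. i \<notin> m \<Longrightarrow> A i j = 0" "i \<notin> m \<or> j \<notin> m" shows "conjm A X i j = 0"
  using assms by (auto simp: conjm_def mmul_def adj_def)

context opsp begin

lemma cgraph_cnj: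
  assumes m: "splits m" and k: "splits k"
    and y: "y \<in> norm_ball (graph_space VC n) k C"
    and \<alpha>: "\<And>i. l2 (\<alpha> i)" and \<alpha>0: "\<And>i j. i \<notin> m \<or> j \<notin> k \<Longrightarrow> \<alpha> i j = 0"
  shows "cgraph n m (cnj_by (graph_space VC n) \<alpha> y)
    = cnj_by (graph_space V n) (blk (dbl m) (halves m) (dbl k) (halves k) \<alpha>) (cgraph n k y)"
proof -
  obtain z \<delta> where [simp]: "y = (z, \<delta>)" by (cases y)
  have z: "z \<in> Mdual_ball VC k C" and d0: "\<And>p q. p \<notin> n \<times> k \<or> q \<notin> n \<times> k \<Longrightarrow> \<delta> p q = 0"
    and d: "op_le (n \<times> k) (n \<times> k) \<delta> C" using y by (auto simp: graph_norm_ball)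
  note zX = Mdual_ball_complexify_op_le[OF k z]
  have z0: "z i j v = 0" if "j \<notin> k" for i j v using z that by (simp add: Mdual_ball_iff)
  have "cmat m (cnj_by (Mspace VC) \<alpha> z)
      = cnj_by (Mspace V) (blk (dbl m) (halves m) (dbl k) (halves k) \<alpha>) (cmat k z)"
    unfolding cnj_by_Mspace cmat_eq_blk[abs_def]
    by (intro ext) (rule fun_cong[OF fun_cong[OF blk_conjm[OF splitting.bij[OF k] \<alpha> _ zX]]],
        simp_all add: \<alpha>0 z0)
  moreover have az: "amp n \<alpha> p q = 0" if "q \<notin> n \<times> k" for p q
    using amp_zero[of m k \<alpha> p n q] \<alpha>0 that by blast
  have "blk (n \<times> dbl m) (pairl (halves m)) (n \<times> dbl m) (pairl (halves m)) (conjm (amp n \<alpha>) \<delta>)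
    = conjm (amp n (blk (dbl m) (halves m) (dbl k) (halves k) \<alpha>))
      (blk (n \<times> dbl k) (pairl (halves k)) (n \<times> dbl k) (pairl (halves k)) \<delta>)"
    unfolding amp_blk
    by (rule blk_conjm[OF bij_betw_pairl[OF splitting.bij[OF k]] l2_amp'[OF \<alpha>] _ op_le_UNIV[OF d
        d0]])
      (use az d0 in blast)+
  ultimately show ?thesis by (simp add: cgraph_def cnj_by_graph)
qed

lemma rgraph_cnj:
  assumes y: "y \<in> norm_ball (graph_space V n) k C" and \<alpha>: "\<And>i. l2 (emb \<alpha> i)"
  shows "rgraph (cnj_by (graph_space V n) \<alpha> y) = cnj_by (graph_space VC n) (emb \<alpha>) (rgraph y)"
proof -
  obtain x \<gamma> where [simp]: "y = (x, \<gamma>)" by (cases y)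
  have x: "x \<in> Mdual_ball V k C" using y by (auto simp: graph_norm_ball)
  note xX = op_le_emb[OF Mdual_ball_op_le[OF x]]
  have "re_embed (cnj_by (Mspace V) \<alpha> x) i j (v, w) = cnj_by (Mspace VC) (emb \<alpha>) (re_embed x) i j
      (v, w)" for i j v w
  proof -
    have "re_embed (cnj_by (Mspace V) \<alpha> x) i j (v, w)
        = emb (conjm \<alpha> (\<lambda>k l. x k l v)) i j + \<i> * emb (conjm \<alpha> (\<lambda>k l. x k l w)) i j"
      by (simp add: re_embed_def cnj_by_Mspace emb_def complex_eq_iff)
    also have "\<dots> = conjm (emb \<alpha>) (\<lambda>k l. emb (\<lambda>k l. x k l v) k l + \<i> * emb (\<lambda>k l. x k l w) k l) i j"
      unfolding conjm_add[OF xX op_le_scale[OF xX] \<alpha>] conjm_scale emb_conjm ..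
    also have "(\<lambda>k l. emb (\<lambda>k l. x k l v) k l + \<i> * emb (\<lambda>k l. x k l w) k l)
        = (\<lambda>k l. re_embed x k l (v, w))"
      by (simp add: re_embed_def emb_def fun_eq_iff complex_eq_iff)
    finally show ?thesis by (simp add: cnj_by_Mspace)
  qed
  then have "re_embed (cnj_by (Mspace V) \<alpha> x) = cnj_by (Mspace VC) (emb \<alpha>) (re_embed x)"
    by (intro ext) (simp only: split_paired_all)
  then show ?thesis by (simp add: rgraph_def cnj_by_graph emb_conjm emb_amp)
qed

lemma cnj_complexify_summable:
  assumes y: "\<And>t. t \<in> T \<Longrightarrow> splitting (dbl (\<mu> t)) (\<mu> t) (halves (\<mu> t)) \<and> z t \<in> Mdual_ball VC (\<mu> t) C"
    and \<alpha>: "\<And>t i. t \<in> T \<Longrightarrow> l2 (\<alpha> t i)"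
    and id: "\<And>k l. ((\<lambda>t. mmul (\<alpha> t) (adj (\<alpha> t)) k l) has_sum idm m k l) T"
  shows "(\<lambda>t. cnj_by (Mspace VC) (\<alpha> t) (z t) i j v) summable_on T"
proof -
  obtain u w where [simp]: "v = (u, w)" by (cases v)
  have "op_le UNIV UNIV (\<lambda>k l. z t k l v)
      (32 * (mnorm V 1 (\<lambda>_ _. u) + 1) * C + 32 * (mnorm V 1 (\<lambda>_ _. w) + 1) * C)" if "t \<in> T" for t
    using Mdual_ball_complexify_op_le[OF conjunct1[OF y[OF that]] conjunct2[OF y[OF that]], of u w]
    by simp
  then show ?thesis unfolding cnj_by_Mspace
    by (intro conjm_family_summable[where X = "\<lambda>t k l. z t k l v", OF _ _ id] \<alpha>)
qed

text \<open>Additivity splits iterated infinite sums, which is legitimate because the evaluations of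
  \<open>z\<close> are bounded matrices and the rows of \<open>\<alpha>\<close> square
  summable.\<close>

lemma linear_cnj:
  assumes k: "splits k" and z: "z \<in> Mdual_ball VC k C"
    and \<alpha>: "\<And>i. l2 (\<alpha> i)"
  shows "Vector_Spaces.linear (scale VC) (*) (cnj_by (Mspace VC) \<alpha> z i j)"
proof -
  have z': "Vector_Spaces.linear (scale VC) (*) (z i j)" for i j
    using z unfolding Mdual_ball_iff by blast
  have l: "z i j (a + b) = z i j a + z i j b" "z i j (scale VC c a) = c * z i j a" for i j a b c
    using z'[of i j] unfolding Vector_Spaces.linear_iff by blast+
  have op: "\<exists>D. op_le UNIV UNIV (\<lambda>k l. z k l v) D" for v
    using Mdual_ball_complexify_op_le[OF k z] by (cases v) blast
  show ?thesis
    unfolding Vector_Spaces.linear_iff cnj_by_Mspace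
  proof (intro conjI allI vs_complexify vector_space_mult)
    fix a b
    obtain D E where "op_le UNIV UNIV (\<lambda>k l. z k l a) D" "op_le UNIV UNIV (\<lambda>k l. z k l b) E"
      using op by blast
    from conjm_add[OF this \<alpha>]
    show "conjm \<alpha> (\<lambda>k l. z k l (a + b)) i j = conjm \<alpha> (\<lambda>k l. z k l a) i j + conjm \<alpha> (\<lambda>k l. z k l b)
        i j"
      by (simp only: l)
  next
    fix c a
    show "conjm \<alpha> (\<lambda>k l. z k l (scale VC c a)) i j = c * conjm \<alpha> (\<lambda>k l. z k l a) i j"
      by (simp only: l conjm_scale)
  qed
qed

lemma linear_infsum:
  assumes "\<And>t. t \<in> T \<Longrightarrow> Vector_Spaces.linear (scale VC) (*) (f t)"
    and sm: "\<And>v. (\<lambda>t. f t v) summable_on T"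
  shows "Vector_Spaces.linear (scale VC) (*) (\<lambda>v. \<Sum>\<^sub>\<infinity>t\<in>T. f t v)"
  unfolding Vector_Spaces.linear_iff
proof (intro conjI allI vs_complexify vector_space_mult)
  have l: "f t (a + b) = f t a + f t b" "f t (scale VC c a) = c * f t a" if "t \<in> T" for t a b c
    using assms(1)[OF that] unfolding Vector_Spaces.linear_iff by blast+
  show "(\<Sum>\<^sub>\<infinity>t\<in>T. f t (a + b)) = (\<Sum>\<^sub>\<infinity>t\<in>T. f t a) + (\<Sum>\<^sub>\<infinity>t\<in>T. f t b)" for a b
    by (subst infsum_add[OF sm sm, symmetric]) (rule infsum_cong, simp only: l)
  show "(\<Sum>\<^sub>\<infinity>t\<in>T. f t (scale VC c a)) = c * (\<Sum>\<^sub>\<infinity>t\<in>T. f t a)" for c a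
    by (subst infsum_cmult_right'[symmetric]) (rule infsum_cong, simp only: l)
qed

end

section \<open>Competitors in the definition of the convex envelope\<close>

definition competitor where
  "competitor X B G W \<longleftrightarrow> nc_convex X W \<and>
     (\<forall>k\<in>levels. G k \<subseteq> W k \<and> W k \<subseteq> B k \<and> closedin (subtopology (weakstar X k) (B k)) (W k))"

lemma closed_ncconv_iff: "y \<in> closed_ncconv X B G m \<longleftrightarrow> (\<forall>W. competitor X B G W \<longrightarrow> y \<in> W m)"
  unfolding closed_ncconv_def competitor_def by blast

lemma closed_direct_sumsD:
  assumes "closed_direct_sums X W" "m \<in> levels"
    "\<And>i. i \<in> I \<Longrightarrow> \<mu> i \<in> levels \<and> isometry m (\<mu> i) (\<alpha> i) \<and> y i \<in> W (\<mu> i) \<and> y i \<in> norm_ball X (\<mu> i) C"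
    "\<And>k l. ((\<lambda>i. mmul (\<alpha> i) (adj (\<alpha> i)) k l) has_sum idm m k l) I"
  shows "fsum X I (\<lambda>i. cnj_by X (\<alpha> i) (y i)) \<in> W m"
  using assms(1)[unfolded closed_direct_sums_def, rule_format, of m I \<mu> \<alpha> y] assms(2-) by blast

lemma closed_compressionsD:
  "closed_compressions X W \<Longrightarrow> m \<in> levels \<Longrightarrow> k \<in> levels \<Longrightarrow> y \<in> W m \<Longrightarrow> isometry m k \<beta> \<Longrightarrow> cnj_by X (adj \<beta>) y
      \<in> W k"
  unfolding closed_compressions_def by blast

text \<open>Used twice: with \<open>g\<close> the block matrix map into the doubled level, and with
  \<open>g\<close> the embedding of real points at the same level. \<open>a\<close> is the matching
  map on isometries, and the constant \<open>c\<close> keeps bounded families bounded.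
  \<open>L\<close> collects what \<open>g\<close> cannot see: sums and compressions are first shown
  to lie in \<open>L\<close>, and \<open>mem\<close> upgrades this to the ambient set.\<close>

lemma competitor_pullback:
  fixes X :: "('k, 'f::{conjugatable_field,real_normed_field}, 'x) ncspace"
    and Y :: "('k, 'g::{conjugatable_field,real_normed_field}, 'y) ncspace"
  assumes W: "competitor Y B' G' W"
    and B: "\<And>m. m \<in> levels \<Longrightarrow> B m \<subseteq> level X m"
    and d: "\<And>m. m \<in> levels \<Longrightarrow> d m \<in> levels"
    and iso: "\<And>m k \<alpha>. m \<in> levels \<Longrightarrow> k \<in> levels \<Longrightarrow> isometry m k \<alpha> \<Longrightarrow> isometry (d m) (d k) (a m k \<alpha>)"
    and ball: "\<And>m C y. m \<in> levels \<Longrightarrow> y \<in> norm_ball X m C \<Longrightarrow> g m y \<in> norm_ball Y (d m) (c * C)"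
    and cnj: "\<And>m k \<beta> y. m \<in> levels \<Longrightarrow> k \<in> levels \<Longrightarrow> isometry m k \<beta> \<Longrightarrow> y \<in> B m \<Longrightarrow>
        cnj_by X (adj \<beta>) y \<in> L k \<and> g k (cnj_by X (adj \<beta>) y) = cnj_by Y (adj (a m k \<beta>)) (g m y)"
    and sum: "\<And>m I \<mu> \<alpha> y C. m \<in> levels \<Longrightarrow>
        (\<And>i. i \<in> I \<Longrightarrow> \<mu> i \<in> levels \<and> isometry m (\<mu> i) (\<alpha> i) \<and> y i \<in> B (\<mu> i) \<and>
            y i \<in> norm_ball X (\<mu> i) C) \<Longrightarrow>
        (\<And>k l. ((\<lambda>i. mmul (\<alpha> i) (adj (\<alpha> i)) k l) has_sum idm m k l) I) \<Longrightarrow>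
        fsum X I (\<lambda>i. cnj_by X (\<alpha> i) (y i)) \<in> L m \<and>
        (\<forall>k l. ((\<lambda>i. mmul (a m (\<mu> i) (\<alpha> i)) (adj (a m (\<mu> i) (\<alpha> i))) k l) has_sum idm (d m) k l) I) \<and>
        g m (fsum X I (\<lambda>i. cnj_by X (\<alpha> i) (y i))) = fsum Y I (\<lambda>i. cnj_by Y (a m (\<mu> i) (\<alpha> i)) (g (\<mu>
            i) (y i)))"
    and mem: "\<And>m y. m \<in> levels \<Longrightarrow> y \<in> L m \<Longrightarrow> g m y \<in> B' (d m) \<Longrightarrow> y \<in> B m"
    and maps: "\<And>m y. m \<in> levels \<Longrightarrow> y \<in> B m \<Longrightarrow> g m y \<in> B' (d m)"
    and cont: "\<And>m. m \<in> levels \<Longrightarrow> continuous_map (weakstar X m) (weakstar Y (d m)) (g m)"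
    and G: "\<And>m y. m \<in> levels \<Longrightarrow> y \<in> G m \<Longrightarrow> y \<in> B m \<and> g m y \<in> W (d m)"
  shows "competitor X B G (\<lambda>m. {y \<in> B m. g m y \<in> W (d m)})"
proof -
  have WB: "W k \<subseteq> B' k" if "k \<in> levels" for k using W that by (auto simp: competitor_def)
  have ds: "closed_direct_sums Y W" and cc: "closed_compressions Y W"
    using W by (auto simp: competitor_def nc_convex_def)
  have mem': "y \<in> {y \<in> B m. g m y \<in> W (d m)}" if "m \<in> levels" "y \<in> L m" "g m y \<in> W (d m)" for m y
    using mem[OF that(1,2)] WB[OF d[OF that(1)]] that(3) by blast
  have "closed_direct_sums X (\<lambda>m. {y \<in> B m. g m y \<in> W (d m)})"
    unfolding closed_direct_sums_def
  proof (intro ballI allI impI)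
    fix m and I :: "'k set" and \<mu> :: "'k \<Rightarrow> 'k set" and \<alpha> :: "'k \<Rightarrow> 'k \<Rightarrow> 'k \<Rightarrow> 'f" and y :: "'k \<Rightarrow> 'x"
    assume m: "m \<in> levels" and 1: "\<forall>i\<in>I. \<mu> i \<in> levels \<and> isometry m (\<mu> i) (\<alpha> i) \<and>
        y i \<in> {y \<in> B (\<mu> i). g (\<mu> i) y \<in> W (d (\<mu> i))}"
      and 2: "\<exists>C. \<forall>i\<in>I. y i \<in> norm_ball X (\<mu> i) C"
      and 3: "\<forall>k l. ((\<lambda>i. mmul (\<alpha> i) (adj (\<alpha> i)) k l) has_sum idm m k l) I"
    from 2 obtain C where C: "\<forall>i\<in>I. y i \<in> norm_ball X (\<mu> i) C" ..
    have s: "fsum X I (\<lambda>i. cnj_by X (\<alpha> i) (y i)) \<in> L m \<and>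
        (\<forall>k l. ((\<lambda>i. mmul (a m (\<mu> i) (\<alpha> i)) (adj (a m (\<mu> i) (\<alpha> i))) k l) has_sum idm (d m) k l) I) \<and>
        g m (fsum X I (\<lambda>i. cnj_by X (\<alpha> i) (y i))) = fsum Y I (\<lambda>i. cnj_by Y (a m (\<mu> i) (\<alpha> i)) (g (\<mu>
            i) (y i)))"
      by (rule sum[OF m]) (use 1 C 3 in auto)
    have "fsum Y I (\<lambda>i. cnj_by Y (a m (\<mu> i) (\<alpha> i)) (g (\<mu> i) (y i))) \<in> W (d m)"
      by (rule closed_direct_sumsD[OF ds d[OF m], where \<mu> = "\<lambda>i. d (\<mu> i)" and C = "c * C"])
        (use 1 C s m d iso ball in auto)
    with s show "fsum X I (\<lambda>i. cnj_by X (\<alpha> i) (y i)) \<in> {y \<in> B m. g m y \<in> W (d m)}"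
      by (intro mem'[OF m]) auto
  qed
  moreover have "closed_compressions X (\<lambda>m. {y \<in> B m. g m y \<in> W (d m)})"
    unfolding closed_compressions_def
  proof (intro ballI allI impI)
    fix m k y and \<beta> :: "'k \<Rightarrow> 'k \<Rightarrow> 'f" assume *: "m \<in> levels" "k \<in> levels" "y \<in> {y \<in> B m. g m y
        \<in> W (d m)}" "isometry m k \<beta>"
    have "cnj_by Y (adj (a m k \<beta>)) (g m y) \<in> W (d k)"
      using * by (intro closed_compressionsD[OF cc d[of m] d[of k] _ iso]) auto
    then show "cnj_by X (adj \<beta>) y \<in> {y \<in> B k. g k y \<in> W (d k)}"
      using cnj[OF *(1,2,4)] *(2,3) by (intro mem') auto
  qed
  ultimately have "nc_convex X (\<lambda>m. {y \<in> B m. g m y \<in> W (d m)})"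
    unfolding nc_convex_def using B by blast
  moreover have "closedin (subtopology (weakstar X m) (B m)) {y \<in> B m. g m y \<in> W (d m)}"
      if m: "m \<in> levels" for m
  proof -
    have "continuous_map (subtopology (weakstar X m) (B m)) (subtopology (weakstar Y (d m)) (B' (d
        m))) (g m)"
      using continuous_map_from_subtopology[OF cont[OF m], of "B m"] maps[OF m]
      by (auto simp: continuous_map_in_subtopology)
    moreover have "closedin (subtopology (weakstar Y (d m)) (B' (d m))) (W (d m))"
      using W d[OF m] by (simp add: competitor_def)
    ultimately have "closedin (subtopology (weakstar X m) (B m))
        {y \<in> topspace (subtopology (weakstar X m) (B m)). g m y \<in> W (d m)}"
      by (rule closedin_continuous_map_preimage)
    moreover have "topspace (subtopology (weakstar X m) (B m)) = B m"
      using B[OF m] by auto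
    ultimately show ?thesis by (simp only:)
  qed
  ultimately show ?thesis
    unfolding competitor_def using G by blast
qed

lemma blk_mmul_adj:
  assumes k: "splits k" and a: "\<And>i. l2 (\<alpha> i)" and a0: "\<And>i j. j \<notin> k \<Longrightarrow> \<alpha> i j = 0"
  shows "mmul (blk D h (dbl k) (halves k) \<alpha>) (adj (blk D h (dbl k) (halves k) \<alpha>))
      = blk D h D h (mmul \<alpha> (adj \<alpha>))"
  unfolding blk_adj
proof (rule blk_mmul[OF splitting.bij[OF k] a0, symmetric])
  show "(\<lambda>j. \<alpha> i j * adj \<alpha> j l) summable_on UNIV" for i l
    using l2_mult_summable[OF a, of "\<lambda>j. adj \<alpha> j l" i] a[of l] by (simp add: adj_def l2_cnj)
qed auto

lemma blk_isometry:
  assumes m: "splits m" and k: "splits k" and \<alpha>: "isometry m k \<alpha>"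
  shows "isometry (dbl m) (dbl k) (blk (dbl m) (halves m) (dbl k) (halves k) \<alpha>)"
proof -
  obtain C where "op_le m k \<alpha> C" using \<alpha> by (auto simp: isometry_def Mat_def)
  from op_le_blk[OF this splitting.bij[OF m] splitting.bij[OF k]]
  have "blk (dbl m) (halves m) (dbl k) (halves k) \<alpha> \<in> Mat (dbl m) (dbl k)"
    by (auto simp: Mat_def blk_def)
  moreover have "mmul (adj (blk (dbl m) (halves m) (dbl k) (halves k) \<alpha>)) (blk (dbl m) (halves m)
      (dbl k) (halves k) \<alpha>) = idm (dbl k)"
    using blk_mmul_adj[of m "adj \<alpha>", OF m isometry_rows(2)[OF \<alpha>], of "dbl k"
        "halves k"] \<alpha> isometry_zero[OF \<alpha>]
    by (simp add: blk_adj isometry_def blk_idm[OF splitting.bij[OF k]]) (simp add: adj_def)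
  ultimately show ?thesis by (simp add: isometry_def)
qed

lemma Mat_of_blk:
  assumes "blk D h D h \<delta> \<in> Mat D D" "bij_betw h D (M <+> M)" "\<And>p q. p \<notin> M \<or> q \<notin> M \<Longrightarrow> \<delta> p q = 0"
  shows "\<delta> \<in> Mat M M"
  using assms(1,3) op_le_of_blk[OF _ assms(2)] unfolding Mat_def by blast

section \<open>The graph of the given function and its ambient sets\<close>

locale real_multifun = opsp V for V :: "(real, 'v::ab_group_add) opspace" +
  fixes K :: "'k set \<Rightarrow> ('k \<Rightarrow> 'k \<Rightarrow> 'v \<Rightarrow> real) set"
    and F :: "('k, 'v, real) multifun"
    and n :: "'k set"
  assumes inf: "infinite (UNIV :: 'k set)"
    and K: "nc_convex (Mspace V) K"
    and F: "bounded_nc_multifun V K n F"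
begin

abbreviation "GS \<equiv> graph_space V n"
abbreviation "GC \<equiv> graph_space VC n"
abbreviation "KC \<equiv> complexify_set V K"
abbreviation "FC \<equiv> complexify_fun n F"
abbreviation BR :: "'k set \<Rightarrow> (('k, 'v, real) point) set"
  where "BR \<equiv> \<lambda>k. K k \<times> Mat (n \<times> k) (n \<times> k)"
abbreviation BC :: "'k set \<Rightarrow> (('k, 'v \<times> 'v, complex) point) set"
  where "BC \<equiv> \<lambda>k. KC k \<times> Mat (n \<times> k) (n \<times> k)"

abbreviation "dblk m k \<equiv> blk (dbl m) (halves m) (dbl k) (halves k)"
abbreviation "pblk m \<equiv> blk (n \<times> dbl m) (pairl (halves m)) (n \<times> dbl m) (pairl (halves m))"
abbreviation "pum m \<equiv> um (n \<times> dbl m) (pairl (halves m))"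
abbreviation "dtwist m \<equiv> twist (dbl (dbl m)) (halves (dbl m)) (dbl m) (halves m)"
abbreviation "dhalf m b \<equiv> half b (dbl m) (halves m)"

lemmas spl = dbl(2)[OF inf] and dbl_level = dbl(1)[OF inf]

lemma spl_pair:
  fixes m :: "'k set"
  shows "m \<in> levels \<Longrightarrow> splitting (n \<times> dbl m) (n \<times> m) (pairl (halves m))"
  using bij_betw_pairl[OF splitting.bij[OF spl]] by (simp add: splitting_def)

lemma K_ball: assumes "m \<in> levels" "x \<in> K m" obtains C where "x \<in> Mdual_ball V m C"
  using assms K unfolding nc_convex_def level_def Mspace_def by auto

lemma BR_level: assumes m: "m \<in> levels" shows "BR m \<subseteq> level GS m"
proof
  fix y assume "y \<in> BR m"
  then obtain x \<gamma> where y: "y = (x, \<gamma>)" "x \<in> K m" "\<gamma> \<in> Mat (n \<times> m) (n \<times> m)" by auto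
  then have "x \<in> level (Mspace V) m" using K m unfolding nc_convex_def by blast
  then show "y \<in> level GS m" using y by (simp add: graph_level)
qed

lemma BC_level: "BC m \<subseteq> level GC m"
  by (auto simp: graph_level complexify_set_def)

lemma BC_ball:
  assumes "y \<in> BC m" obtains C where "y \<in> norm_ball GC m C"
  using subsetD[OF BC_level assms] unfolding level_def by blast

lemma BR_ball:
  assumes "m \<in> levels" "y \<in> BR m" obtains C where "y \<in> norm_ball GS m C"
  using subsetD[OF BR_level assms(2)] assms(1) unfolding level_def by blast

lemma has_sum_emb:
  assumes "\<And>k l. ((\<lambda>i. mmul (\<alpha> i) (adj (\<alpha> i)) k l) has_sum idm m k l) I"
  shows "((\<lambda>i. mmul (emb (\<alpha> i)) (adj (emb (\<alpha> i))) k l) has_sum idm m k l) I"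
  unfolding emb_adj[symmetric] emb_mmul[symmetric] emb_idm[symmetric]
  using assms unfolding emb_def by (simp add: has_sum_of_real_iff)

lemma amp_rows: "isometry m k \<alpha> \<Longrightarrow> l2 (amp n \<alpha> p)"
  for \<alpha> :: "'k \<Rightarrow> 'k \<Rightarrow> complex"
  by (rule l2_amp') (rule isometry_rows)

lemma amp_emb_rows: "isometry m k \<alpha> \<Longrightarrow> l2 (amp n (emb \<alpha>) p)"
  for \<alpha> :: "'k \<Rightarrow> 'k \<Rightarrow> real"
  by (rule amp_rows) (simp add: emb_isometry)

text \<open>If there were no competitor, the envelope would be the whole type, whose elements need not
  vanish outside of \<open>n \<times> m\<close> and so are not recovered from their compressions.\<close>

lemma BR_competitor: "competitor GS BR (Graph K F) BR"
  unfolding competitor_def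
proof (intro conjI ballI)
  fix k :: "'k set" assume k: "k \<in> levels"
  show "Graph K F k \<subseteq> BR k"
    using F k unfolding bounded_nc_multifun_def Graph_def by blast
  show "closedin (subtopology (weakstar GS k) (BR k)) (BR k)"
    using BR_level[OF k] by simp
next
  have ds: "closed_direct_sums (Mspace V) K" and cc: "closed_compressions (Mspace V) K"
    using K by (auto simp: nc_convex_def)
  \<comment> \<open>Boundedness of the sum is proved for complex scalars, where the estimates live,
    and brought back by \<open>emb_Mat\<close>.\<close>
  have Mat: "(\<lambda>p q. \<Sum>\<^sub>\<infinity>t\<in>T. conjm (A t) (\<gamma> t) p q) \<in> Mat (n \<times> m) (n \<times> m)"
    if A: "\<And>t i. t \<in> T \<Longrightarrow> l2 (emb (A t) i)" and A0: "\<And>t i j. t \<in> T \<Longrightarrow> i \<notin> n \<times> m \<Longrightarrow> A t i j = 0"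
      and id: "\<And>k l. ((\<lambda>t. mmul (emb (A t)) (adj (emb (A t))) k l) has_sum idm (n \<times> m) k l) T"
      and \<gamma>: "\<And>t. t \<in> T \<Longrightarrow> op_le UNIV UNIV (\<gamma> t) C"
    for T :: "'t set" and A and \<gamma> :: "'t \<Rightarrow> ('k, real) pair_matrix" and C and m :: "'k set"
  proof -
    \<comment> \<open>For empty \<open>T\<close> nothing forces \<open>C\<close> to be nonnegative,
      hence the maximum.\<close>
    have "op_le UNIV UNIV (emb (\<gamma> t)) (max (4 * C) 0)" if "t \<in> T" for t
      by (rule op_le_mono[OF op_le_emb[OF \<gamma>[OF that]]]) simp
    from conjm_family_op_le[of T "\<lambda>t. emb (\<gamma> t)" _ "\<lambda>t. emb (A t)", OF this _ A id]
    have "op_le UNIV UNIV (\<lambda>i j. \<Sum>\<^sub>\<infinity>t\<in>T. conjm (emb (A t)) (emb (\<gamma> t)) i j) (max (4 * C) 0)" by simp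
    also have "(\<lambda>i j. \<Sum>\<^sub>\<infinity>t\<in>T. conjm (emb (A t)) (emb (\<gamma> t)) i j) = emb (\<lambda>p q. \<Sum>\<^sub>\<infinity>t\<in>T. conjm (A t) (\<gamma>
        t) p q)"
      unfolding emb_conjm[symmetric] by (simp add: emb_def infsum_complex_of_real)
    finally have "op_le (n \<times> m) (n \<times> m) (emb (\<lambda>p q. \<Sum>\<^sub>\<infinity>t\<in>T. conjm (A t) (\<gamma> t) p q)) (max (4 * C) 0)"
      by (rule op_le_subset) auto
    moreover have "(\<Sum>\<^sub>\<infinity>t\<in>T. conjm (A t) (\<gamma> t) p q) = 0" if "p \<notin> n \<times> m \<or> q \<notin> n \<times> m" for p q
      by (rule infsum_0) (rule conjm_zero[of "n \<times> m", OF _ that], rule A0)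
    ultimately have "emb (\<lambda>p q. \<Sum>\<^sub>\<infinity>t\<in>T. conjm (A t) (\<gamma> t) p q) \<in> Mat (n \<times> m) (n \<times> m)"
      unfolding Mat_def by (auto simp: emb_def)
    then show ?thesis by (simp add: emb_Mat)
  qed
  have "closed_direct_sums GS BR"
    unfolding closed_direct_sums_def
  proof (intro ballI allI impI)
    fix m and I :: "'k set" and \<mu> :: "'k \<Rightarrow> 'k set" and \<alpha> :: "'k \<Rightarrow> 'k \<Rightarrow> 'k \<Rightarrow> real" and y
    assume m: "m \<in> levels" and 1: "\<forall>i\<in>I. \<mu> i \<in> levels \<and> isometry m (\<mu> i) (\<alpha> i) \<and> y i \<in> BR (\<mu> i)"
      and 2: "\<exists>C. \<forall>i\<in>I. y i \<in> norm_ball GS (\<mu> i) C"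
      and 3: "\<forall>k l. ((\<lambda>i. mmul (\<alpha> i) (adj (\<alpha> i)) k l) has_sum idm m k l) I"
    from 2 obtain C where "\<forall>i\<in>I. y i \<in> norm_ball GS (\<mu> i) C" ..
    then have C: "fst (y i) \<in> Mdual_ball V (\<mu> i) C"
      "\<forall>p q. p \<notin> n \<times> \<mu> i \<or> q \<notin> n \<times> \<mu> i \<longrightarrow> snd (y i) p q = 0" "op_le (n \<times> \<mu> i) (n \<times> \<mu> i) (snd (y i))
          C" if "i \<in> I" for i
      using that by (metis graph_norm_ball prod.collapse)+
    have op: "op_le UNIV UNIV (snd (y i)) C" if "i \<in> I" for i
      by (rule op_le_UNIV[OF C(3)[OF that]]) (use C(2)[OF that] in blast)
    have "fsum (Mspace V) I (\<lambda>i. cnj_by (Mspace V) (\<alpha> i) (fst (y i))) \<in> K m"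
      by (rule closed_direct_sumsD[OF ds m, where C = C]) (use 1 3 C(1) in \<open>auto simp: Mspace_def\<close>)
    moreover have "(\<lambda>p q. \<Sum>\<^sub>\<infinity>i\<in>I. conjm (amp n (\<alpha> i)) (snd (y i)) p q) \<in> Mat (n \<times> m) (n \<times> m)"
    proof (rule Mat)
      show "l2 (emb (amp n (\<alpha> t)) i)" if "t \<in> I" for t i
        using 1 that amp_emb_rows[of m "\<mu> t" "\<alpha> t" i] by (simp add: emb_amp)
      show "amp n (\<alpha> t) i j = 0" if "t \<in> I" "i \<notin> n \<times> m" for t i j
        using 1 that amp_zero[of m "\<mu> t" "\<alpha> t" i n j] isometry_zero[of m "\<mu> t" "\<alpha> t"] by blast
      show "((\<lambda>t. mmul (emb (amp n (\<alpha> t))) (adj (emb (amp n (\<alpha> t)))) k l)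
          has_sum idm (n \<times> m) k l) I" for k l
        unfolding emb_amp by (rule has_sum_amp) (rule has_sum_emb, use 3 in blast)
    qed (use op in auto)
    moreover have "snd (cnj_by GS (\<alpha> i) (y i)) = conjm (amp n (\<alpha> i)) (snd (y i))"
      "fst (cnj_by GS (\<alpha> i) (y i)) = cnj_by (Mspace V) (\<alpha> i) (fst (y i))" for i
      by (cases "y i"; simp add: cnj_by_graph)+
    ultimately show "fsum GS I (\<lambda>i. cnj_by GS (\<alpha> i) (y i)) \<in> BR m"
      by (simp add: fsum_graph)
  qed
  moreover have "closed_compressions GS BR"
    unfolding closed_compressions_def
  proof (intro ballI allI impI)
    fix m k y and \<beta> :: "'k \<Rightarrow> 'k \<Rightarrow> real"
    assume *: "m \<in> levels" "k \<in> levels" "y \<in> BR m" "isometry m k \<beta>"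
    obtain x \<gamma> where y: "y = (x, \<gamma>)" "x \<in> K m" "\<gamma> \<in> Mat (n \<times> m) (n \<times> m)" using *(3) by auto
    obtain C where C: "op_le UNIV UNIV \<gamma> C" using Mat_op_le_UNIV[OF y(3)] ..
    have "cnj_by (Mspace V) (adj \<beta>) x \<in> K k" by (rule closed_compressionsD[OF cc *(1,2) y(2) *(4)])
    \<comment> \<open>The compression is written as a sum over one index, so that \<open>Mat\<close>
      covers it too.\<close>
    moreover have "(\<lambda>p q. \<Sum>\<^sub>\<infinity>t\<in>{()}. conjm (amp n (adj \<beta>)) \<gamma> p q) \<in> Mat (n \<times> k) (n \<times> k)"
    proof (rule Mat)
      have e: "isometry m k (emb \<beta>)" using *(4) by (simp add: emb_isometry)
      show "l2 (emb (amp n (adj \<beta>)) i)" for i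
        unfolding emb_amp emb_adj by (rule l2_amp') (rule isometry_rows(2)[OF e])
      show "amp n (adj \<beta>) i j = 0" if "i \<notin> n \<times> k" for i j
        using that amp_zero[of k m "adj \<beta>" i n j] isometry_zero[OF *(4)] by (auto simp: adj_def)
      have "mmul (adj (emb \<beta>)) (emb \<beta>) = idm k" using e by (simp add: isometry_def)
      then show "((\<lambda>t. mmul (emb (amp n (adj \<beta>))) (adj (emb (amp n (adj \<beta>)))) i j)
          has_sum idm (n \<times> k) i j) {()}" for i j
        unfolding emb_amp emb_adj by (intro has_sum_amp) (simp add: has_sum_finite_iff)
    qed (rule C)
    ultimately show "cnj_by GS (adj \<beta>) y \<in> BR k" by (simp add: y cnj_by_graph)
  qed
  ultimately show "nc_convex GS BR"
    unfolding nc_convex_def using BR_level by blast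
qed simp

text \<open>The sum is \<open>y \<oplus> y\<close>; the index set has to consist of two elements of \<open>'k\<close>.\<close>

lemma ex_double_sum:
  assumes X: "closed_direct_sums X W" and m: "m \<in> levels" and y: "y \<in> W m" "y \<in> norm_ball X m C"
  shows "\<exists>a b :: 'k. a \<noteq> b \<and> fsum X {a, b} (\<lambda>t. cnj_by X (dhalf m (t = a)) y) \<in> W (dbl m)"
proof -
  interpret splitting "dbl m" m "halves m" by (rule spl[OF m])
  define a :: 'k where "a = undefined"
  obtain b :: 'k where "b \<noteq> a" using ex_new_if_finite[OF inf, of "{a}"] by auto
  then have ab: "a \<noteq> b" by simp
  have "fsum X {a, b} (\<lambda>t. cnj_by X (dhalf m (t = a)) y) \<in> W (dbl m)"
  proof (rule closed_direct_sumsD[OF X dbl_level[OF m], where \<mu> = "\<lambda>_. m" and C = C])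
    show "((\<lambda>t. mmul (dhalf m (t = a)) (adj (dhalf m (t = a))) k l) has_sum idm (dbl m) k l) {a, b}"
        for k l
      using ab half_sum_mmul_adj[of k l] by (simp add: has_sum_finite_iff)
  qed (use m y half_isometry in auto)
  with ab show ?thesis by blast
qed

lemma Mdual_ball_zero:
  assumes x: "x \<in> Mdual_ball V m C" shows "x k l 0 = 0"
proof -
  have "x k l (0 + 0) = x k l 0 + x k l 0"
    using x unfolding Mdual_ball_iff Vector_Spaces.linear_iff by blast
  then show ?thesis by simp
qed

lemma double_Mspace:
  assumes m: "m \<in> levels" and x: "x \<in> Mdual_ball V m C" and ab: "a \<noteq> (b :: 'k)"
  shows "fsum (Mspace V) {a, b} (\<lambda>t. cnj_by (Mspace V) (dhalf m (t = a)) x) = cmat m (re_embed x)"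
proof -
  interpret splitting "dbl m" m "halves m" by (rule spl[OF m])
  have "(\<lambda>k l. re_embed x k l (v, 0)) = emb (\<lambda>k l. x k l v)" for v
    by (simp add: re_embed_def emb_def complex_eq_iff fun_eq_iff Mdual_ball_zero[OF x])
  then show ?thesis
    using ab by (simp add: fsum_Mspace cnj_by_Mspace cmat_eq_blk[abs_def] half_sum_conjm)
qed

text \<open>Closure under \<open>x \<oplus> x\<close> is what puts \<open>K\<close> inside its
  complexification.\<close>

lemma K_double: assumes m: "m \<in> levels" and x: "x \<in> K m" shows "cmat m (re_embed x) \<in> K (dbl m)"
proof -
  obtain C where C: "x \<in> Mdual_ball V m C" using K_ball[OF m x] .
  have "closed_direct_sums (Mspace V) K" using K by (simp add: nc_convex_def)
  from ex_double_sum[OF this m x, of C] C obtain a b where "a \<noteq> b"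
    "fsum (Mspace V) {a, b} (\<lambda>t. cnj_by (Mspace V) (dhalf m (t = a)) x) \<in> K (dbl m)"
    by (auto simp: Mspace_def)
  then show ?thesis by (simp add: double_Mspace[OF m C])
qed

text \<open>Applied to the graph of \<open>F\<close>, where it expresses that \<open>F\<close>
  respects \<open>x \<oplus> x\<close>, and to real competitors.\<close>

lemma graph_double:
  assumes W: "closed_direct_sums GS W" and m: "m \<in> levels" and y: "y \<in> W m" "y \<in> norm_ball GS m C"
  shows "cgraph n m (rgraph y) \<in> W (dbl m)"
proof -
  interpret splitting "n \<times> dbl m" "n \<times> m" "pairl (halves m)" by (rule spl_pair[OF m])
  obtain x \<gamma> where [simp]: "y = (x, \<gamma>)" by (cases y)
  have x: "x \<in> Mdual_ball V m C" using y(2) by (simp add: graph_norm_ball)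
  obtain a b where ab: "a \<noteq> b" and
    "fsum GS {a, b} (\<lambda>t. cnj_by GS (dhalf m (t = a)) y) \<in> W (dbl m)"
    using ex_double_sum[OF W m y] by blast
  moreover have "fsum GS {a, b} (\<lambda>t. cnj_by GS (dhalf m (t = a)) y) = cgraph n m (rgraph y)"
    using ab double_Mspace[OF m x ab] half_sum_conjm[of \<gamma>]
    by (simp add: fsum_graph cnj_by_graph rgraph_def cgraph_def amp_half fun_eq_iff)
  ultimately show ?thesis by simp
qed

lemma re_embed_KC: assumes m: "m \<in> levels" and x: "x \<in> K m" shows "re_embed x \<in> KC m"
proof -
  obtain C where C: "x \<in> Mdual_ball V m C" using K_ball[OF m x] .
  show ?thesis
    using re_embed_Mdual_ball[OF C] K_double[OF m x]
    by (auto simp: complexify_set_def level_def Mspace_def)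
qed

text \<open>What membership in \<open>BC\<close> requires beyond \<open>cgraph n m y \<in> BR (dbl m)\<close>.\<close>

definition pre_BC :: "'k set \<Rightarrow> (('k, 'v \<times> 'v, complex) point) set" where
  "pre_BC m = {(z, \<delta>). (\<forall>i j. i \<notin> m \<or> j \<notin> m \<longrightarrow> z i j = (\<lambda>_. 0)) \<and>
     (\<forall>i j. Vector_Spaces.linear (scale VC) (*) (z i j)) \<and>
     (\<forall>p q. p \<notin> n \<times> m \<or> q \<notin> n \<times> m \<longrightarrow> \<delta> p q = 0)}"

lemma cnj_zero:
  assumes "\<And>i j. i \<notin> m \<Longrightarrow> \<alpha> i j = 0" "i \<notin> m \<or> j \<notin> m"
  shows "cnj_by (Mspace U) \<alpha> z i j = (\<lambda>_. 0)"
  unfolding cnj_by_Mspace by (rule ext, rule conjm_zero[OF assms])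

lemma amp_conjm_zero:
  fixes m :: "'k set"
  assumes "\<And>i j. i \<notin> m \<Longrightarrow> \<alpha> i j = 0" "p \<notin> n \<times> m \<or> q \<notin> n \<times> m"
  shows "conjm (amp n \<alpha>) (\<delta> :: ('k, complex) pair_matrix) p q = 0"
proof (rule conjm_zero[OF _ assms(2)])
  fix i j :: "'k \<times> 'k" assume i: "i \<notin> n \<times> m"
  obtain a b c d where ij: "i = (a, b)" "j = (c, d)" by (cases i, cases j)
  from i have "a \<notin> n \<or> b \<notin> m" by (simp add: ij)
  then show "amp n \<alpha> i j = 0" by (elim disjE) (simp_all add: ij amp_def assms(1))
qed

lemma cnj_pre_BC:
  assumes k: "k \<in> levels" and y: "y \<in> norm_ball GC k C" and \<alpha>: "\<And>i. l2 (\<alpha> i)" "\<And>i j. i \<notin> m \<Longrightarrow>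
      \<alpha> i j = 0"
  shows "cnj_by GC \<alpha> y \<in> pre_BC m"
proof -
  obtain z \<delta> where [simp]: "y = (z, \<delta>)" by (cases y)
  have z: "z \<in> Mdual_ball VC k C" using y by (simp add: graph_norm_ball)
  have "cnj_by (Mspace VC) \<alpha> z i j = (\<lambda>_. 0)" if "i \<notin> m \<or> j \<notin> m" for i j
    by (rule cnj_zero[of m, OF \<alpha>(2) that])
  moreover have "conjm (amp n \<alpha>) \<delta> p q = 0" if "p \<notin> n \<times> m \<or> q \<notin> n \<times> m" for p q
    by (rule amp_conjm_zero[of m, OF \<alpha>(2) that])
  moreover note linear_cnj[OF spl[OF k] z, of \<alpha>, OF \<alpha>(1)]
  ultimately show ?thesis
    unfolding pre_BC_def \<open>y = (z, \<delta>)\<close> cnj_by_graph mem_Collect_eq case_prod_conv by blast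
qed

text \<open>The condition on \<open>cmat m z\<close> in \<open>KC\<close> is part of the assumption;
  what remains is boundedness of both components, recovered from the bounds of their block
  matrices.\<close>

lemma BC_of_cgraph:
  assumes m: "m \<in> levels" and y: "y \<in> pre_BC m" and c: "cgraph n m y \<in> BR (dbl m)"
  shows "y \<in> BC m"
proof -
  obtain z \<delta> where [simp]: "y = (z, \<delta>)" by (cases y)
  note L = y[unfolded \<open>y = (z, \<delta>)\<close> pre_BC_def mem_Collect_eq case_prod_conv]
  have c': "cmat m z \<in> K (dbl m)"
    "pblk m \<delta> \<in> Mat (n \<times> dbl m) (n \<times> dbl m)"
    using c by (auto simp: cgraph_def)
  obtain C where "cmat m z \<in> Mdual_ball V (dbl m) C" using K_ball[OF dbl_level[OF m] c'(1)] .
  then have "z \<in> Mdual_ball VC m (16 * C)"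
    by (rule Mdual_ball_of_cmat[OF spl[OF m]]) (use L in blast)+
  moreover have "\<delta> \<in> Mat (n \<times> m) (n \<times> m)"
    by (rule Mat_of_blk[OF c'(2) splitting.bij[OF spl_pair[OF m]]]) (use L in blast)
  ultimately show ?thesis using c'(1) by (auto simp: complexify_set_def level_def Mspace_def)
qed

text \<open>\<open>blk\<close> is real linear and acts entrywise, so it passes through convergent
  infinite sums; the same summability makes the sum linear in the vector.\<close>

lemma fsum_cgraph:
  assumes m: "m \<in> levels"
    and 1: "\<And>i. i \<in> I \<Longrightarrow> \<mu> i \<in> levels \<and> isometry m (\<mu> i) (\<alpha> i) \<and> y i \<in> norm_ball GC (\<mu> i) C"
    and id: "\<And>k l. ((\<lambda>i. mmul (\<alpha> i) (adj (\<alpha> i)) k l) has_sum idm m k l) I"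
  shows "fsum GC I (\<lambda>i. cnj_by GC (\<alpha> i) (y i)) \<in> pre_BC m"
    and "cgraph n m (fsum GC I (\<lambda>i. cnj_by GC (\<alpha> i) (y i))) = fsum GS I (\<lambda>i. cgraph n m (cnj_by GC
        (\<alpha> i) (y i)))"
proof -
  define z where "z i = fst (y i)" for i
  define \<delta> where "\<delta> i = snd (y i)" for i
  have y: "y i = (z i, \<delta> i)" for i by (simp add: z_def \<delta>_def)
  have z: "z i \<in> Mdual_ball VC (\<mu> i) C" and
    d: "\<And>p q. p \<notin> n \<times> \<mu> i \<or> q \<notin> n \<times> \<mu> i \<Longrightarrow> \<delta> i p q = 0" "op_le (n \<times> \<mu> i) (n \<times> \<mu> i) (\<delta> i) C"
        if "i \<in> I" for i
    using 1[OF that] by (auto simp: y graph_norm_ball)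
  have op: "op_le UNIV UNIV (\<delta> i) C" if "i \<in> I" for i
    by (rule op_le_UNIV[OF d(2)[OF that] d(1)[OF that]])
  have rows: "l2 (\<alpha> i k)" if "i \<in> I" for i k using 1[OF that] isometry_rows(1)[of m "\<mu> i" "\<alpha> i" k]
      by simp
  have z0: "cnj_by (Mspace VC) (\<alpha> i) (z i) k l = (\<lambda>_. 0)" if "i \<in> I" "k \<notin> m \<or> l \<notin> m" for i k l
  proof -
    have a0: "\<alpha> i k l = 0" if "k \<notin> m" for k l using 1[OF \<open>i \<in> I\<close>] isometry_zero[of m "\<mu> i"
        "\<alpha> i"] that by blast
    show ?thesis by (rule cnj_zero[of m, OF a0 that(2)])
  qed
  have d0: "conjm (amp n (\<alpha> i)) (\<delta> i) p q = 0" if "i \<in> I" "p \<notin> n \<times> m \<or> q \<notin> n \<times> m" for i p q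
  proof -
    have a0: "\<alpha> i k l = 0" if "k \<notin> m" for k l using 1[OF \<open>i \<in> I\<close>] isometry_zero[of m "\<mu> i"
        "\<alpha> i"] that by blast
    show ?thesis by (rule amp_conjm_zero[of m, OF a0 that(2)])
  qed
  have zs: "(\<lambda>i. cnj_by (Mspace VC) (\<alpha> i) (z i) k l v) summable_on I" for k l v
    by (rule cnj_complexify_summable[OF _ rows id]) (use 1 z spl in auto)
  have ds: "(\<lambda>i. conjm (amp n (\<alpha> i)) (\<delta> i) p q) summable_on I" for p q
    by (rule conjm_family_summable[OF op l2_amp'[OF rows] has_sum_amp[OF id]])
  have lin: "Vector_Spaces.linear (scale VC) (*) (\<lambda>v. \<Sum>\<^sub>\<infinity>i\<in>I. cnj_by (Mspace VC) (\<alpha> i) (z i) k l v)"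
      for k l
    by (rule linear_infsum[OF _ zs]) (rule linear_cnj[OF spl z rows], use 1 in auto)
  have eq: "fsum GC I (\<lambda>i. cnj_by GC (\<alpha> i) (y i)) = (\<lambda>k l v. \<Sum>\<^sub>\<infinity>i\<in>I. cnj_by (Mspace VC) (\<alpha> i) (z i) k
      l v,
      \<lambda>p q. \<Sum>\<^sub>\<infinity>i\<in>I. conjm (amp n (\<alpha> i)) (\<delta> i) p q)"
    by (simp add: fsum_graph fsum_Mspace y cnj_by_graph)
  show "fsum GC I (\<lambda>i. cnj_by GC (\<alpha> i) (y i)) \<in> pre_BC m"
    unfolding eq pre_BC_def
  proof (intro CollectI case_prodI conjI allI impI)
    show "(\<lambda>v. \<Sum>\<^sub>\<infinity>i\<in>I. cnj_by (Mspace VC) (\<alpha> i) (z i) k l v) = (\<lambda>_. 0)" if "k \<notin> m \<or> l \<notin> m" for k l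
      using z0[OF _ that] by (simp add: infsum_0)
    show "(\<Sum>\<^sub>\<infinity>i\<in>I. conjm (amp n (\<alpha> i)) (\<delta> i) p q) = 0" if "p \<notin> n \<times> m \<or> q \<notin> n \<times> m" for p q
      using d0[OF _ that] by (simp add: infsum_0)
  qed (rule lin)
  have "cmat m (\<lambda>k l v. \<Sum>\<^sub>\<infinity>i\<in>I. cnj_by (Mspace VC) (\<alpha> i) (z i) k l v)
      = (\<lambda>k l v. \<Sum>\<^sub>\<infinity>i\<in>I. cmat m (cnj_by (Mspace VC) (\<alpha> i) (z i)) k l v)"
    by (intro ext) (simp only: cmat_eq_blk infsum_blk[OF zs])
  moreover have "blk D h D h (\<lambda>p q. \<Sum>\<^sub>\<infinity>i\<in>I. conjm (amp n (\<alpha> i)) (\<delta> i) p q)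
      = (\<lambda>p q. \<Sum>\<^sub>\<infinity>i\<in>I. blk D h D h (conjm (amp n (\<alpha> i)) (\<delta> i)) p q)"
    for D :: "('k \<times> 'k) set" and h :: "'k \<times> 'k \<Rightarrow> 'k \<times> 'k + 'k \<times> 'k"
    by (intro ext) (simp only: infsum_blk[OF ds])
  ultimately show "cgraph n m (fsum GC I (\<lambda>i. cnj_by GC (\<alpha> i) (y i))) = fsum GS I (\<lambda>i. cgraph n m
      (cnj_by GC (\<alpha> i) (y i)))"
    unfolding eq by (simp add: fsum_graph fsum_Mspace y cnj_by_graph cgraph_def)
qed

section \<open>Competitors carried between the real and the complex side\<close>

lemma um_conjm: "mmul (amp n (adj (umat m))) (mmul X (amp n (umat m))) = conjm (adj (pum m)) X"
  if "m \<in> levels" for m :: "'k set"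
  by (simp add: conjm_def umat_eq_um[OF spl[OF that]] amp_adj amp_um)

text \<open>General in \<open>H\<close>, since it serves \<open>F\<close> and the envelope of
  \<open>F\<close> alike.\<close>

lemma FC_eq: "m \<in> levels \<Longrightarrow> complexify_fun n H m z = (\<lambda>\<gamma>. conjm (adj (pum m)) (emb \<gamma>)) ` H (dbl m)
    (cmat m z)"
  for m :: "'k set"
  unfolding complexify_fun_def using um_conjm[of m] by (simp add: emb_def)

text \<open>\<open>graph_double\<close> forms the sum of two copies at level
  \<open>dbl (dbl m)\<close>, and \<open>dtwist\<close> averages both components at once. The second
  becomes a block matrix; the first is one already and is therefore fixed.\<close>

lemma compress_twist:
  assumes W: "nc_convex GS W" and m: "m \<in> levels" and z: "\<And>i j. i \<notin> m \<or> j \<notin> m \<Longrightarrow> z i j = (\<lambda>_. 0)"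
    and w: "(cmat m z, \<gamma>) \<in> W (dbl m)"
  shows "cgraph n m (z, conjm (adj (pum m)) (emb \<gamma>)) \<in> W (dbl m)"
proof -
  let ?y = "(cmat m z, \<gamma>)"
  interpret double_splitting "dbl m" m "halves m" "dbl (dbl m)" "halves (dbl m)"
    using spl[OF m] spl[OF dbl_level[OF m]] by (simp add: double_splitting_def)
  interpret p: double_splitting "n \<times> dbl m" "n \<times> m" "pairl (halves m)" "n \<times> dbl (dbl m)"
      "pairl (halves (dbl m))"
    using spl_pair[OF m] spl_pair[OF dbl_level[OF m]] by (simp add: double_splitting_def)
  have ds: "closed_direct_sums GS W" and cc: "closed_compressions GS W"
      and lev: "W (dbl m) \<subseteq> level GS (dbl m)"
    using W dbl_level[OF m] by (auto simp: nc_convex_def)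
  from lev w obtain C where C: "?y \<in> norm_ball GS (dbl m) C" unfolding level_def by blast
  from graph_double[OF ds dbl_level[OF m] w C]
  have "cgraph n (dbl m) (rgraph ?y) \<in> W (dbl (dbl m))" .
  from closed_compressionsD[OF cc dbl_level[OF dbl_level[OF m]] dbl_level[OF m] this twist_isometry]
  have "cnj_by GS (adj (dtwist m)) (cgraph n (dbl m) (rgraph ?y)) \<in> W (dbl m)" .
  moreover have "cnj_by (Mspace V) (adj (dtwist m)) (cmat (dbl m) (re_embed (cmat m z))) = cmat m z"
  proof (intro ext)
    fix i j v
    have "(\<lambda>k l. re_embed (cmat m z) k l (v, 0)) = emb (\<lambda>k l. cmat m z k l v)"
    proof -
      have "cmat m z k l 0 = 0" for k l
        by (rule Mdual_ball_zero[of "cmat m z" "dbl m" C]) (use C in \<open>simp add: graph_norm_ball\<close>)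
      then show ?thesis by (simp add: re_embed_def emb_def complex_eq_iff fun_eq_iff)
    qed
    then have "cnj_by (Mspace V) (adj (dtwist m)) (cmat (dbl m) (re_embed (cmat m z))) i j v
      = dblk m m (conjm (adj (um (dbl m) (halves m))) (emb (dblk m m (\<lambda>k l. z k l (v, 0))))) i j"
      by (simp add: cnj_by_Mspace cmat_eq_blk twist_compress_eq_blk[symmetric])
    also have "conjm (adj (um (dbl m) (halves m))) (emb (dblk m m (\<lambda>k l. z k l (v, 0))))
        = (\<lambda>k l. z k l (v, 0))"
      by (rule inner.um_compress_blk) (use z in auto)
    finally show "cnj_by (Mspace V) (adj (dtwist m)) (cmat (dbl m) (re_embed (cmat m z))) i j v
        = cmat m z i j v"
      by (simp only: cmat_eq_blk[of m z i j v])
  qed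
  ultimately show ?thesis
    by (simp add: cgraph_def rgraph_def cnj_by_graph amp_adj amp_twist p.twist_compress_eq_blk)
qed

lemma Graph_BR: "m \<in> levels \<Longrightarrow> Graph K F m \<subseteq> BR m"
  using F unfolding bounded_nc_multifun_def Graph_def by blast

lemma competitorD:
  assumes "competitor X B G W" "m \<in> levels"
  shows "nc_convex X W" "G m \<subseteq> W m" "W m \<subseteq> B m"
  using assms by (auto simp: competitor_def)

lemma complexified_competitor:
  assumes W: "competitor GS BR (Graph K F) W"
  shows "competitor GC BC (Graph KC FC) (\<lambda>m. {y \<in> BC m. cgraph n m y \<in> W (dbl m)})"
proof (rule competitor_pullback[OF W, where d = dbl and g = "cgraph n" and c = 4 and L = pre_BC
      and a = "\<lambda>m k. dblk m k"])
  show "BC m \<subseteq> level GC m" if "m \<in> levels" for m by (rule BC_level)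
  show "dbl m \<in> levels" if "m \<in> levels" for m :: "'k set" by (rule dbl_level[OF that])
  show "isometry (dbl m) (dbl k) (dblk m k \<alpha>)"
    if "m \<in> levels" "k \<in> levels" "isometry m k \<alpha>" for m k :: "'k set" and \<alpha>
    by (rule blk_isometry[OF spl[OF that(1)] spl[OF that(2)] that(3)])
  show "cgraph n m y \<in> norm_ball GS (dbl m) (4 * C)" if "m \<in> levels" "y \<in> norm_ball GC m C"
      for m C y
    by (rule cgraph_norm_ball[OF spl[OF that(1)] that(2)])
  show "continuous_map (weakstar GC m) (weakstar GS (dbl m)) (cgraph n m)" if "m \<in> levels" for m
    by (rule continuous_cgraph[OF spl[OF that]])
  show "y \<in> BC m" if "m \<in> levels" "y \<in> pre_BC m" "cgraph n m y \<in> BR (dbl m)" for m y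
    by (rule BC_of_cgraph[OF that])
  show "cgraph n m y \<in> BR (dbl m)" if m: "m \<in> levels" and y: "y \<in> BC m" for m y
  proof -
    obtain z \<delta> where [simp]: "y = (z, \<delta>)" by (cases y)
    obtain C where "y \<in> norm_ball GC m C" using BC_ball[OF y] .
    from cgraph_norm_ball[OF spl[OF m] this]
    have "pblk m \<delta> \<in> Mat (n \<times> dbl m) (n \<times> dbl m)"
      unfolding cgraph_def \<open>y = (z, \<delta>)\<close> case_prod_conv graph_norm_ball Mat_def by blast
    then show ?thesis using y by (simp add: cgraph_def complexify_set_def)
  qed
  show "cnj_by GC (adj \<beta>) y \<in> pre_BC k \<and> cgraph n k (cnj_by GC (adj \<beta>) y)
      = cnj_by GS (adj (dblk m k \<beta>)) (cgraph n m y)"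
    if m: "m \<in> levels" and k: "k \<in> levels" and \<beta>: "isometry m k \<beta>" and y: "y \<in> BC m" for m k \<beta> y
  proof
    obtain C where C: "y \<in> norm_ball GC m C" using BC_ball[OF y] .
    have b0: "adj \<beta> i j = 0" if "i \<notin> k \<or> j \<notin> m" for i j
      using isometry_zero[OF \<beta>, of j i] that by (auto simp: adj_def)
    show "cnj_by GC (adj \<beta>) y \<in> pre_BC k"
      by (rule cnj_pre_BC[OF m C isometry_rows(2)[OF \<beta>]]) (use b0 in blast)
    show "cgraph n k (cnj_by GC (adj \<beta>) y)
        = cnj_by GS (adj (dblk m k \<beta>)) (cgraph n m y)"
      unfolding blk_adj by (rule cgraph_cnj[OF spl[OF k] spl[OF m] C isometry_rows(2)[OF \<beta>] b0])
  qed
  show "fsum GC I (\<lambda>i. cnj_by GC (\<alpha> i) (y i)) \<in> pre_BC m \<and>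
      (\<forall>k l. ((\<lambda>i. mmul (dblk m (\<mu> i) (\<alpha> i))
         (adj (dblk m (\<mu> i) (\<alpha> i))) k l) has_sum idm (dbl m) k l) I) \<and>
      cgraph n m (fsum GC I (\<lambda>i. cnj_by GC (\<alpha> i) (y i)))
        = fsum GS I (\<lambda>i. cnj_by GS (dblk m (\<mu> i) (\<alpha> i)) (cgraph n (\<mu> i) (y i)))"
    if m: "m \<in> levels"
      and 1: "\<And>i. i \<in> I \<Longrightarrow> \<mu> i \<in> levels \<and> isometry m (\<mu> i) (\<alpha> i) \<and> y i \<in> BC (\<mu> i) \<and>
          y i \<in> norm_ball GC (\<mu> i) C"
      and id: "\<And>k l. ((\<lambda>i. mmul (\<alpha> i) (adj (\<alpha> i)) k l) has_sum idm m k l) I"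
    for m I \<mu> \<alpha> y C
  proof (intro conjI allI)
    note s = fsum_cgraph[of m I \<mu> \<alpha> y C, OF m _ id]
    show "fsum GC I (\<lambda>i. cnj_by GC (\<alpha> i) (y i)) \<in> pre_BC m" by (rule s(1)) (use 1 in blast)
    have "cgraph n m (fsum GC I (\<lambda>i. cnj_by GC (\<alpha> i) (y i))) = fsum GS I (\<lambda>i. cgraph n m (cnj_by GC
        (\<alpha> i) (y i)))"
      by (rule s(2)) (use 1 in blast)
    also have "cgraph n m (cnj_by GC (\<alpha> i) (y i))
        = cnj_by GS (dblk m (\<mu> i) (\<alpha> i)) (cgraph n (\<mu> i) (y i))" if "i \<in> I" for i
      using 1[OF that] isometry_rows(1)[of m "\<mu> i" "\<alpha> i"] isometry_zero[of m "\<mu> i" "\<alpha> i"]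
      by (intro cgraph_cnj[OF spl[OF m] spl]) blast+
    then have "fsum GS I (\<lambda>i. cgraph n m (cnj_by GC (\<alpha> i) (y i)))
        = fsum GS I (\<lambda>i. cnj_by GS (dblk m (\<mu> i) (\<alpha> i)) (cgraph n (\<mu> i) (y i)))"
      by (simp add: fsum_graph fsum_Mspace cong: infsum_cong)
    finally show "cgraph n m (fsum GC I (\<lambda>i. cnj_by GC (\<alpha> i) (y i)))
        = fsum GS I (\<lambda>i. cnj_by GS (dblk m (\<mu> i) (\<alpha> i)) (cgraph n (\<mu> i) (y i)))" .
    have "mmul (dblk m (\<mu> i) (\<alpha> i)) (adj (dblk m (\<mu> i) (\<alpha> i)))
        = dblk m m (mmul (\<alpha> i) (adj (\<alpha> i)))" if "i \<in> I" for i
      using 1[OF that] isometry_rows(1)[of m "\<mu> i" "\<alpha> i"] isometry_zero[of m "\<mu> i" "\<alpha> i"]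
      by (intro blk_mmul_adj[OF spl]) blast+
    then show "((\<lambda>i. mmul (dblk m (\<mu> i) (\<alpha> i))
         (adj (dblk m (\<mu> i) (\<alpha> i))) k l) has_sum idm (dbl m) k l) I" for k l
      using has_sum_blk[where f = "\<lambda>t. mmul (\<alpha> t) (adj (\<alpha> t))" and S = "idm m", OF id,
          where D = "dbl m" and h = "halves m" and E = "dbl m" and e = "halves m" and i = k
              and j = l,
          unfolded blk_idm[OF splitting.bij[OF spl[OF m]]]]
      by (simp cong: has_sum_cong)
  qed
  \<comment> \<open>A value of \<open>FC\<close> at \<open>z\<close> is the compression by
    \<open>u\<close> of some \<open>\<gamma>\<close> over \<open>cmat m z\<close>, and
    \<open>compress_twist\<close> yields precisely the block matrix of such a compression.\<close>
  show "y \<in> BC m \<and> cgraph n m y \<in> W (dbl m)" if m: "m \<in> levels" and y: "y \<in> Graph KC FC m" for m y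
  proof -
    obtain z \<gamma> where z: "z \<in> KC m" and \<gamma>: "\<gamma> \<in> F (dbl m) (cmat m z)"
      and y: "y = (z, conjm (adj (pum m)) (emb \<gamma>))"
      using y by (auto simp: Graph_def FC_eq[OF m])
    obtain C where C: "z \<in> Mdual_ball VC m C"
      using z by (auto simp: complexify_set_def level_def Mspace_def)
    then have z': "(\<forall>i j. i \<notin> m \<or> j \<notin> m \<longrightarrow> z i j = (\<lambda>_. 0)) \<and>
        (\<forall>i j. Vector_Spaces.linear (scale VC) (*) (z i j))"
      unfolding Mdual_ball_iff by blast
    have "(cmat m z, \<gamma>) \<in> Graph K F (dbl m)"
      using z \<gamma> by (simp add: Graph_def complexify_set_def)
    then have "(cmat m z, \<gamma>) \<in> W (dbl m)"
      using competitorD(2)[OF W dbl_level[OF m]] by blast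
    from compress_twist[OF competitorD(1)[OF W m] m _ this] z' have w: "cgraph n m y \<in> W (dbl m)"
      unfolding y by blast
    have "y \<in> pre_BC m"
      using z' unfolding y pre_BC_def by (simp add: splitting.um_compress[OF spl_pair[OF m]])
    with w show ?thesis
      using BC_of_cgraph[OF m] competitorD(3)[OF W dbl_level[OF m]] by blast
  qed
qed

text \<open>The second component is left free: its boundedness is read off from its embedding by
  \<open>emb_Mat\<close>.\<close>

definition pre_BR :: "'k set \<Rightarrow> (('k, 'v, real) point) set" where
  "pre_BR m = K m \<times> UNIV"

lemma fsum_rgraph:
  assumes m: "m \<in> levels"
    and 1: "\<And>i. i \<in> I \<Longrightarrow> \<mu> i \<in> levels \<and> isometry m (\<mu> i) (\<alpha> i) \<and> y i \<in> norm_ball GS (\<mu> i) C"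
    and id: "\<And>k l. ((\<lambda>i. mmul (\<alpha> i) (adj (\<alpha> i)) k l) has_sum idm m k l) I"
  shows "rgraph (fsum GS I (\<lambda>i. cnj_by GS (\<alpha> i) (y i))) = fsum GC I (\<lambda>i. rgraph (cnj_by GS (\<alpha> i) (y
      i)))"
proof -
  define x where "x i = fst (y i)" for i
  define \<gamma> where "\<gamma> i = snd (y i)" for i
  have y: "y i = (x i, \<gamma> i)" for i by (simp add: x_def \<gamma>_def)
  have xs: "(\<lambda>i. complex_of_real (cnj_by (Mspace V) (\<alpha> i) (x i) k l v)) summable_on I" for k l v
  proof -
    have "(\<lambda>i. conjm (emb (\<alpha> i)) (emb (\<lambda>k l. x i k l v)) k l) summable_on I"
    proof (rule conjm_family_summable[OF _ _ has_sum_emb[OF id]])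
      show "op_le UNIV UNIV (emb (\<lambda>k l. x i k l v)) (4 * ((mnorm V 1 (\<lambda>_ _. v) + 1) * C))"
          if "i \<in> I" for i
        using 1[OF that] unfolding y graph_norm_ball by (intro op_le_emb Mdual_ball_op_le) blast
      show "l2 (emb (\<alpha> i) k)" if "i \<in> I" for i k
        using 1[OF that] isometry_rows(1)[of m "\<mu> i" "emb (\<alpha> i)" k] by (simp add: emb_isometry)
    qed
    then show ?thesis unfolding emb_conjm[symmetric] by (simp add: emb_def cnj_by_Mspace)
  qed
  have "re_embed (\<lambda>k l v. \<Sum>\<^sub>\<infinity>i\<in>I. cnj_by (Mspace V) (\<alpha> i) (x i) k l v) k l (v, w)
      = (\<Sum>\<^sub>\<infinity>i\<in>I. re_embed (cnj_by (Mspace V) (\<alpha> i) (x i)) k l (v, w))" for k l v w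
  proof -
    have r: "re_embed z k l (v, w) = complex_of_real (z k l v) + \<i> * complex_of_real (z k l w)"
        for z
      by (simp add: re_embed_def complex_eq_iff)
    show ?thesis
      unfolding r infsum_add[OF xs summable_on_cmult_right[OF xs]]
      by (simp only: infsum_cmult_right' infsum_complex_of_real)
  qed
  then have "re_embed (\<lambda>k l v. \<Sum>\<^sub>\<infinity>i\<in>I. cnj_by (Mspace V) (\<alpha> i) (x i) k l v)
      = (\<lambda>k l v. \<Sum>\<^sub>\<infinity>i\<in>I. re_embed (cnj_by (Mspace V) (\<alpha> i) (x i)) k l v)"
    by (intro ext) (simp only: split_paired_all)
  moreover have "emb (\<lambda>p q. \<Sum>\<^sub>\<infinity>i\<in>I. f i p q) = (\<lambda>p q. \<Sum>\<^sub>\<infinity>i\<in>I. emb (f i) p q)"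
      for f :: "'k \<Rightarrow> ('k, real) pair_matrix"
    by (simp only: emb_def infsum_complex_of_real)
  ultimately show ?thesis
    by (simp add: fsum_graph fsum_Mspace y cnj_by_graph rgraph_def)
qed

text \<open>The witness in \<open>F\<close> at \<open>c(x + i0)\<close> is
  \<open>\<gamma> \<oplus> \<gamma>\<close>, whose compression by \<open>u\<close> is
  \<open>\<gamma> + i0\<close>.\<close>

lemma Graph_rgraph:
  assumes m: "m \<in> levels" and y: "y \<in> Graph K F m"
  shows "rgraph y \<in> Graph KC FC m"
proof -
  interpret p: splitting "n \<times> dbl m" "n \<times> m" "pairl (halves m)" by (rule spl_pair[OF m])
  obtain x \<gamma> where [simp]: "y = (x, \<gamma>)" and x: "x \<in> K m" and \<gamma>: "\<gamma> \<in> F m x"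
    using y by (auto simp: Graph_def)
  have yB: "y \<in> BR m" using Graph_BR[OF m] y by blast
  obtain C where C: "y \<in> norm_ball GS m C" using BR_ball[OF m yB] .
  have "closed_direct_sums GS (Graph K F)" using F unfolding bounded_nc_multifun_def by blast
  from graph_double[OF this m y C]
  have "pblk m (emb \<gamma>) \<in> F (dbl m) (cmat m (re_embed x))"
    by (simp add: cgraph_def rgraph_def Graph_def)
  moreover have "conjm (adj (pum m)) (emb (pblk m (emb \<gamma>))) = emb \<gamma>"
  proof (rule p.um_compress_blk)
    show "emb \<gamma> p q = 0" if "p \<notin> n \<times> m \<or> q \<notin> n \<times> m" for p q
      using yB that MatD[of \<gamma> "n \<times> m" "n \<times> m" p q] by (simp add: emb_def)
  qed
  ultimately have "emb \<gamma> \<in> FC m (re_embed x)"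
    unfolding FC_eq[OF m] by (metis image_eqI)
  then show ?thesis using re_embed_KC[OF m x] by (simp add: rgraph_def Graph_def)
qed

lemma restricted_competitor:
  assumes W: "competitor GC BC (Graph KC FC) W"
  shows "competitor GS BR (Graph K F) (\<lambda>m. {y \<in> BR m. rgraph y \<in> W m})"
proof (rule competitor_pullback[OF W, where d = "\<lambda>m. m" and g = "\<lambda>_. rgraph" and c = 8
    and L = pre_BR
      and a = "\<lambda>_ _. emb"])
  have ds: "closed_direct_sums (Mspace V) K" and cc: "closed_compressions (Mspace V) K"
    using K by (auto simp: nc_convex_def)
  show "BR m \<subseteq> level GS m" if "m \<in> levels" for m by (rule BR_level[OF that])
  show "m \<in> levels" if "m \<in> levels" for m :: "'k set" by (rule that)
  show "isometry m k (emb \<alpha>)" if "isometry m k \<alpha>" for m k :: "'k set" and \<alpha>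
    using that by (simp add: emb_isometry)
  show "rgraph y \<in> norm_ball GC m (8 * C)" if "y \<in> norm_ball GS m C" for m C y
    by (rule rgraph_norm_ball[OF that])
  show "continuous_map (weakstar GS m) (weakstar GC m) rgraph" for m
    by (rule continuous_rgraph)
  show "y \<in> BR m" if "y \<in> pre_BR m" "rgraph y \<in> BC m" for m y
    using that by (cases y) (auto simp: rgraph_def pre_BR_def emb_Mat)
  show "rgraph y \<in> BC m" if "m \<in> levels" "y \<in> BR m" for m y
    using that re_embed_KC by (cases y) (auto simp: rgraph_def emb_Mat)
  show "cnj_by GS (adj \<beta>) y \<in> pre_BR k \<and> rgraph (cnj_by GS (adj \<beta>) y) = cnj_by GC (adj (emb \<beta>))
      (rgraph y)"
    if m: "m \<in> levels" and k: "k \<in> levels" and \<beta>: "isometry m k \<beta>" and y: "y \<in> BR m" for m k \<beta> y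
  proof
    obtain x \<gamma> where [simp]: "y = (x, \<gamma>)" by (cases y)
    have "x \<in> K m" using y by simp
    from closed_compressionsD[OF cc m k this \<beta>]
    show "cnj_by GS (adj \<beta>) y \<in> pre_BR k" by (simp add: cnj_by_graph pre_BR_def)
    obtain C where C: "y \<in> norm_ball GS m C" using BR_ball[OF m y] .
    have "isometry m k (emb \<beta>)" using \<beta> by (simp add: emb_isometry)
    from isometry_rows(2)[OF this]
    show "rgraph (cnj_by GS (adj \<beta>) y) = cnj_by GC (adj (emb \<beta>)) (rgraph y)"
      unfolding emb_adj[symmetric] by (rule rgraph_cnj[OF C])
  qed
  show "fsum GS I (\<lambda>i. cnj_by GS (\<alpha> i) (y i)) \<in> pre_BR m \<and>
      (\<forall>k l. ((\<lambda>i. mmul (emb (\<alpha> i)) (adj (emb (\<alpha> i))) k l) has_sum idm m k l) I) \<and>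
      rgraph (fsum GS I (\<lambda>i. cnj_by GS (\<alpha> i) (y i))) = fsum GC I (\<lambda>i. cnj_by GC (emb (\<alpha> i)) (rgraph
          (y i)))"
    if m: "m \<in> levels"
      and 1: "\<And>i. i \<in> I \<Longrightarrow> \<mu> i \<in> levels \<and> isometry m (\<mu> i) (\<alpha> i) \<and> y i \<in> BR (\<mu> i) \<and>
          y i \<in> norm_ball GS (\<mu> i) C"
      and id: "\<And>k l. ((\<lambda>i. mmul (\<alpha> i) (adj (\<alpha> i)) k l) has_sum idm m k l) I"
    for m I \<mu> \<alpha> y C
  proof (intro conjI allI)
    have "fsum (Mspace V) I (\<lambda>i. cnj_by (Mspace V) (\<alpha> i) (fst (y i))) \<in> K m"
    proof (rule closed_direct_sumsD[OF ds m _ id, where C = C])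
      fix i assume "i \<in> I"
      from 1[OF this] show "\<mu> i \<in> levels \<and> isometry m (\<mu> i) (\<alpha> i) \<and> fst (y i) \<in> K (\<mu> i) \<and>
          fst (y i) \<in> norm_ball (Mspace V) (\<mu> i) C"
        by (cases "y i") (simp add: graph_norm_ball Mspace_def)
    qed
    moreover have "fst (cnj_by GS (\<alpha> i) (y i)) = cnj_by (Mspace V) (\<alpha> i) (fst (y i))" for i
      by (cases "y i") (simp add: cnj_by_graph)
    ultimately show "fsum GS I (\<lambda>i. cnj_by GS (\<alpha> i) (y i)) \<in> pre_BR m"
      by (simp add: fsum_graph pre_BR_def)
    show "((\<lambda>i. mmul (emb (\<alpha> i)) (adj (emb (\<alpha> i))) k l) has_sum idm m k l) I" for k l
      by (rule has_sum_emb[OF id])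
    have "rgraph (fsum GS I (\<lambda>i. cnj_by GS (\<alpha> i) (y i))) = fsum GC I (\<lambda>i. rgraph (cnj_by GS (\<alpha> i) (y
        i)))"
      by (rule fsum_rgraph[of m I \<mu> \<alpha> y C, OF m _ id]) (use 1 in blast)
    also have "rgraph (cnj_by GS (\<alpha> i) (y i)) = cnj_by GC (emb (\<alpha> i)) (rgraph (y i))" if "i \<in> I"
        for i
      using 1[OF that] isometry_rows(1)[of m "\<mu> i" "emb (\<alpha> i)"]
      by (intro rgraph_cnj[of _ _ "\<mu> i" C]) (auto simp: emb_isometry)
    then have "fsum GC I (\<lambda>i. rgraph (cnj_by GS (\<alpha> i) (y i))) = fsum GC I (\<lambda>i. cnj_by GC (emb (\<alpha> i))
        (rgraph (y i)))"
      by (simp add: fsum_graph fsum_Mspace cong: infsum_cong)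
    finally show "rgraph (fsum GS I (\<lambda>i. cnj_by GS (\<alpha> i) (y i))) = fsum GC I (\<lambda>i. cnj_by GC (emb (\<alpha>
        i)) (rgraph (y i)))" .
  qed
  show "y \<in> BR m \<and> rgraph y \<in> W m" if "m \<in> levels" "y \<in> Graph K F m" for m y
    using that Graph_BR Graph_rgraph competitorD(2)[OF W] by blast
qed

section \<open>Envelopes\<close>

lemma envelope_real_iff: "\<gamma> \<in> envelope V K n F m x \<longleftrightarrow> (\<forall>W. competitor GS BR (Graph K F) W \<longrightarrow>
    (x, \<gamma>) \<in> W m)"
  unfolding envelope_def by (simp add: closed_ncconv_iff)

lemma envelope_complex_iff: "\<delta> \<in> envelope VC KC n FC m z \<longleftrightarrow>
    (\<forall>W. competitor GC BC (Graph KC FC) W \<longrightarrow> (z, \<delta>) \<in> W m)"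
  unfolding envelope_def by (simp add: closed_ncconv_iff)

lemma KC_Mdual: assumes "z \<in> KC m" obtains C where "z \<in> Mdual_ball VC m C"
  using assms by (auto simp: complexify_set_def level_def Mspace_def)

text \<open>\<open>BR\<close> is a competitor, and its pullback is one for the complex envelope; so
  the intersection runs over a nonempty family and stays within the ambient set.\<close>

lemma envelope_complex_Mat:
  assumes m: "m \<in> levels" and \<delta>: "\<delta> \<in> envelope VC KC n FC m z"
  shows "\<delta> \<in> Mat (n \<times> m) (n \<times> m)"
  using \<delta> complexified_competitor[OF BR_competitor] unfolding envelope_complex_iff by blast

text \<open>Each real competitor supplies a complex one by pullback, and \<open>\<delta>\<close>
  lies over \<open>z\<close> in all of these.\<close>

lemma blk_envelope:
  assumes m: "m \<in> levels" and \<delta>: "\<delta> \<in> envelope VC KC n FC m z"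
    and W: "competitor GS BR (Graph K F) W"
  shows "cgraph n m (z, \<delta>) \<in> W (dbl m)"
  using \<delta> complexified_competitor[OF W] unfolding envelope_complex_iff by blast

text \<open>The isometry \<open>u\<close> is complex, so the real point is first embedded into the
  complex competitor \<open>W\<close> at level \<open>dbl m\<close> and compressed there.\<close>

lemma um_compress_envelope:
  assumes m: "m \<in> levels" and z: "z \<in> KC m" and \<gamma>: "\<gamma> \<in> envelope V K n F (dbl m) (cmat m z)"
  shows "conjm (adj (pum m)) (emb \<gamma>) \<in> envelope VC KC n FC m z"
  unfolding envelope_complex_iff
proof (intro allI impI)
  fix W assume W: "competitor GC BC (Graph KC FC) W"
  interpret splitting "dbl m" m "halves m" by (rule spl[OF m])
  obtain C where C: "z \<in> Mdual_ball VC m C" using KC_Mdual[OF z] .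
  have z0: "z i j = (\<lambda>_. 0)" if "i \<notin> m \<or> j \<notin> m" for i j
    using C that unfolding Mdual_ball_iff by blast
  have lin: "z k l (v, w) = z k l (v, 0) + \<i> * z k l (w, 0)" for k l v w
    using C unfolding Mdual_ball_iff by (intro linear_complexify_split) blast
  have "rgraph (cmat m z, \<gamma>) \<in> W (dbl m)"
    using \<gamma> restricted_competitor[OF W] unfolding envelope_real_iff by blast
  moreover have "closed_compressions GC W"
    using competitorD(1)[OF W m] by (simp add: nc_convex_def)
  ultimately have "cnj_by GC (adj (um (dbl m) (halves m))) (rgraph (cmat m z, \<gamma>)) \<in> W m"
    by (intro closed_compressionsD[OF _ dbl_level[OF m] m _ um_isometry])
  \<comment> \<open>Compression by \<open>u\<close> inverts \<open>c\<close> at each real vector;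
    \<open>lin\<close> extends this to \<open>(v, w)\<close>.\<close>
  moreover have "cnj_by (Mspace VC) (adj (um (dbl m) (halves m))) (re_embed (cmat m z)) = z"
  proof -
    have "conjm (adj (um (dbl m) (halves m))) (\<lambda>k l. re_embed (cmat m z) k l (v, w)) i j
        = z i j (v, w)" for i j v w
    proof (cases "i \<in> m \<and> j \<in> m")
      case True
      then show ?thesis
        unfolding um_compress lin[of i j v w]
        by (simp add: re_embed_def cmat_eq_blk blk_def complex_eq_iff)
    next
      case False
      then show ?thesis using z0[of i j] by (auto simp: um_compress)
    qed
    then show ?thesis unfolding cnj_by_Mspace by (intro ext) (simp only: split_paired_all)
  qed
  ultimately show "(z, conjm (adj (pum m)) (emb \<gamma>)) \<in> W m"
    by (simp add: rgraph_def cnj_by_graph amp_adj amp_um)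
qed

theorem envelope_complexify:
  assumes m: "m \<in> levels" and z: "z \<in> KC m"
  shows "complexify_fun n (envelope V K n F) m z = envelope VC KC n FC m z"
proof
  show "complexify_fun n (envelope V K n F) m z \<subseteq> envelope VC KC n FC m z"
    unfolding FC_eq[OF m] using um_compress_envelope[OF m z] by blast
  show "envelope VC KC n FC m z \<subseteq> complexify_fun n (envelope V K n F) m z"
  proof
    fix \<delta> assume \<delta>: "\<delta> \<in> envelope VC KC n FC m z"
    interpret p: splitting "n \<times> dbl m" "n \<times> m" "pairl (halves m)" by (rule spl_pair[OF m])
    \<comment> \<open>The block matrix of \<open>\<delta>\<close> is the witness; \<open>u\<close>
      returns \<open>\<delta>\<close> because \<open>\<delta>\<close> vanishes outside
      \<open>n \<times> m\<close>.\<close>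
    define \<gamma> where "\<gamma> = pblk m \<delta>"
    have "\<gamma> \<in> envelope V K n F (dbl m) (cmat m z)"
      unfolding envelope_real_iff using blk_envelope[OF m \<delta>] by (simp add: cgraph_def \<gamma>_def)
    moreover have "conjm (adj (pum m)) (emb \<gamma>) = \<delta>"
      unfolding \<gamma>_def by (rule p.um_compress_blk)
          (use MatD[OF envelope_complex_Mat[OF m \<delta>]] in blast)
    ultimately show "\<delta> \<in> complexify_fun n (envelope V K n F) m z"
      unfolding FC_eq[OF m] by blast
  qed
qed

theorem Re_envelope:
  assumes m: "m \<in> levels" and x: "x \<in> K m"
  shows "Re_mats (envelope VC KC n FC m (re_embed x)) = envelope V K n F m x"
proof
  show "envelope V K n F m x \<subseteq> Re_mats (envelope VC KC n FC m (re_embed x))"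
  proof
    fix \<gamma> assume \<gamma>: "\<gamma> \<in> envelope V K n F m x"
    \<comment> \<open>The preimage under \<open>Re\<close> is \<open>\<gamma> + i0\<close>.\<close>
    have "emb \<gamma> \<in> envelope VC KC n FC m (re_embed x)"
      unfolding envelope_complex_iff
    proof (intro allI impI)
      fix W assume "competitor GC BC (Graph KC FC) W"
      from restricted_competitor[OF this] \<gamma> have "rgraph (x, \<gamma>) \<in> W m"
        unfolding envelope_real_iff by blast
      then show "(re_embed x, emb \<gamma>) \<in> W m" by (simp add: rgraph_def)
    qed
    moreover have "\<gamma> = (\<lambda>p q. Re (emb \<gamma> p q))" by (simp add: emb_def)
    ultimately show "\<gamma> \<in> Re_mats (envelope VC KC n FC m (re_embed x))"
      unfolding Re_mats_def by blast
  qed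
  show "Re_mats (envelope VC KC n FC m (re_embed x)) \<subseteq> envelope V K n F m x"
    unfolding Re_mats_def
  proof (intro image_subsetI)
    fix \<delta> assume \<delta>: "\<delta> \<in> envelope VC KC n FC m (re_embed x)"
    interpret splitting "dbl m" m "halves m" by (rule spl[OF m])
    interpret p: splitting "n \<times> dbl m" "n \<times> m" "pairl (halves m)" by (rule spl_pair[OF m])
    obtain C where C: "x \<in> Mdual_ball V m C" using K_ball[OF m x] .
    have x0: "x i j = (\<lambda>_. 0)" if "i \<notin> m \<or> j \<notin> m" for i j
      using C that unfolding Mdual_ball_iff by blast
    have d0: "\<delta> p q = 0" if "p \<notin> n \<times> m \<or> q \<notin> n \<times> m" for p q
      using MatD[OF envelope_complex_Mat[OF m \<delta>]] that by blast
    \<comment> \<open>Compression to the first half sends \<open>(c(x + i0), c(\<delta>))\<close> to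
      \<open>(x, Re \<delta>)\<close>; support within the level makes both components come out
      exactly.\<close>
    have xeq: "cnj_by (Mspace V) (adj (dhalf m True)) (cmat m (re_embed x)) = x"
      unfolding cnj_by_Mspace cmat_eq_blk half_compress using x0
      by (auto simp: re_embed_def fun_eq_iff)
    have deq: "(\<lambda>k l. if k \<in> n \<times> m \<and> l \<in> n \<times> m then Re (\<delta> k l) else 0) = (\<lambda>p q. Re (\<delta> p q))"
      using d0 by (intro ext) (metis zero_complex.simps(1))
    show "(\<lambda>p q. Re (\<delta> p q)) \<in> envelope V K n F m x"
      unfolding envelope_real_iff
    proof (intro allI impI)
      fix W assume W: "competitor GS BR (Graph K F) W"
      have "closed_compressions GS W"
        using competitorD(1)[OF W m] by (simp add: nc_convex_def)
      from closed_compressionsD[OF this dbl_level[OF m] m blk_envelope[OF m \<delta> W] half_isometry[of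
          True]]
      show "(x, \<lambda>p q. Re (\<delta> p q)) \<in> W m"
        by (simp only: cgraph_def case_prod_conv cnj_by_graph xeq amp_adj amp_half p.half_compress
            deq)
    qed
  qed
qed

end

theorem lemma5p6:
  fixes V :: "(real, 'v::ab_group_add) opspace"
    and K :: "'k set \<Rightarrow> ('k \<Rightarrow> 'k \<Rightarrow> 'v \<Rightarrow> real) set"
    and F :: "('k, 'v, real) multifun"
    and n :: "'k set"
  assumes "infinite (UNIV :: 'k set)"
    and "operator_space V"
    and "nc_convex (Mspace V) K"
    and "n \<in> levels"
    and "bounded_nc_multifun V K n F"
  shows "(\<forall>m\<in>levels. \<forall>x\<in>K m.
           Re_mats (envelope (complexify V) (complexify_set V K) n (complexify_fun n F) m (re_embed x))
             = envelope V K n F m x) \<and>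
         (\<forall>m\<in>levels. \<forall>z\<in>complexify_set V K m.
           complexify_fun n (envelope V K n F) m z
             = envelope (complexify V) (complexify_set V K) n (complexify_fun n F) m z)"
proof -
  interpret real_multifun V K F n
    by unfold_locales (use assms in auto)
  show ?thesis using Re_envelope envelope_complexify by blast
qed
end
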